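(* There is a universal numerical constant $C>0$ (independent of all problem parameters) such that for every $d\ge1$, all Borel probability measures $\mu,\nu$ on $\mathbb{R}^d$, every cost $c$ satisfying the cost assumption with Lipschitz constant $L>0$, every $\varepsilon>0$ and every $n\ge1$, $$\mathbb{E}\big[\|\hat p_\varepsilon-p_\varepsilon\|_{L^1(\hat\mu\otimes\hat\nu)}\big]\le C\Big(1+\frac{1}{\sqrt\varepsilon}\Big)\Big(\frac{\mathcal{N}(\mu,\frac{\varepsilon}{L})\wedge\mathcal{N}(\nu,\frac{\varepsilon}{L})}{n}\Big)^{1/4}.$$
   Context: Cost assumption: $c$ is Borel measurable with $\|c\|_{L^\infty(\mu\otimes\nu)}\le 1$; $|c(x,y)-c(x',y)|\le L\|x-x'\|$ for all $x,x'\in\mathrm{supp}(\mu)$, $y\in\mathrm{supp}(\nu)$; and $|c(x,y)-c(x,y')|\le L\|y-y'\|$ for all $x\in\mathrm{supp}(\mu)$, $y,y'\in\mathrm{supp}(\nu)$. Here $\|\cdot\|$ is the Euclidean norm. For probability measures $P,Q$, the entropic OT problem is $S_\varepsilon(P,Q):=\inf_{\pi\in\Pi(P,Q)}\{\int c\,d\pi+\varepsilon\,\mathrm{KL}(\pi\|P\otimes Q)\}$, where $\Pi(P,Q)$ is the set of couplings. Samples: $x_1,\dots,x_n\sim\mu$ iid, $y_1,\dots,y_n\sim\nu$ iid, mutually independent; $\hat\mu=\frac1n\sum_i\delta_{x_i}$, $\hat\nu=\frac1n\sum_j\delta_{y_j}$; $\mathbb{E}$ is expectation over both samples. $\pi_\varepsilon$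 and $\hat\pi_\varepsilon$ are the unique minimizers for $(\mu,\nu)$ and $(\hat\mu,\hat\nu)$ respectively. Densities: $p_\varepsilon:=\frac{d\pi_\varepsilon}{d(\mu\otimes\nu)}$, which has the form $p_\varepsilon(x,y)=e^{-\varepsilon^{-1}(c(x,y)-f_\varepsilon(x)-g_\varepsilon(y))}$ for bounded dual potentials $f_\varepsilon,g_\varepsilon$, and $\hat p_\varepsilon:=\frac{d\hat\pi_\varepsilon}{d(\hat\mu\otimes\hat\nu)}$. Covering numbers: $\mathcal{N}(\mu,\delta)$ is the minimal number of closed Euclidean balls of radius $\delta$ (centers in $\mathbb{R}^d$) covering $\mathrm{supp}(\mu)$; similarly $\mathcal{N}(\nu,\delta)$. $a\wedge b=\min(a,b)$. *)

theory Defs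
  imports "HOL-Probability.Probability"
begin

text \<open>
  The constant of the main inequality is uniform in the dimension, so the dimension has to be
  an ordinary natural number rather than a type. The space of dimension \<open>d\<close> is the set of extensional
  functions on \<open>{..<d}\<close> (that is, \<open>space (Rd d) = {..<d} \<rightarrow>\<^sub>E UNIV\<close>); its finite product
  sigma-algebra is the Borel sigma-algebra.
\<close>

abbreviation Rd :: "nat \<Rightarrow> (nat \<Rightarrow> real) measure" where
  "Rd d \<equiv> Pi\<^sub>M {..<d} (\<lambda>_. borel)"

definition edist :: "nat \<Rightarrow> (nat \<Rightarrow> real) \<Rightarrow> (nat \<Rightarrow> real) \<Rightarrow> real" where
  "edist d x y = L2_set (\<lambda>i. x i - y i) {..<d}"

definition borel_prob :: "nat \<Rightarrow> (nat \<Rightarrow> real) measure \<Rightarrow> bool" where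
  "borel_prob d \<mu> \<longleftrightarrow> prob_space \<mu> \<and> sets \<mu> = sets (Rd d)"

definition supp :: "nat \<Rightarrow> (nat \<Rightarrow> real) measure \<Rightarrow> (nat \<Rightarrow> real) set" where
  "supp d \<mu> = {x \<in> space (Rd d). \<forall>r>0. emeasure \<mu> {y \<in> space (Rd d). edist d x y < r} > 0}"

text \<open>The covering number is \<open>\<infinity>\<close> if no finite cover exists.\<close>

definition covering_number :: "nat \<Rightarrow> (nat \<Rightarrow> real) measure \<Rightarrow> real \<Rightarrow> enat" where
  "covering_number d \<mu> \<delta> =
     Inf {enat (card S) | S. finite S \<and> S \<subseteq> space (Rd d) \<and>
            supp d \<mu> \<subseteq> (\<Union>z\<in>S. {x \<in> space (Rd d). edist d z x \<le> \<delta>})}"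

definition cost_assumption ::
  "nat \<Rightarrow> (nat \<Rightarrow> real) measure \<Rightarrow> (nat \<Rightarrow> real) measure \<Rightarrow> real \<Rightarrow>
     ((nat \<Rightarrow> real) \<times> (nat \<Rightarrow> real) \<Rightarrow> real) \<Rightarrow> bool" where
  "cost_assumption d \<mu> \<nu> L c \<longleftrightarrow>
     c \<in> borel_measurable (Rd d \<Otimes>\<^sub>M Rd d) \<and>
     esssup (\<mu> \<Otimes>\<^sub>M \<nu>) (\<lambda>z. ereal \<bar>c z\<bar>) \<le> 1 \<and>
     (\<forall>x\<in>supp d \<mu>. \<forall>x'\<in>supp d \<mu>. \<forall>y\<in>supp d \<nu>. \<bar>c (x, y) - c (x', y)\<bar> \<le> L * edist d x x') \<and>
     (\<forall>x\<in>supp d \<mu>. \<forall>y\<in>supp d \<nu>. \<forall>y'\<in>supp d \<nu>. \<bar>c (x, y) - c (x, y')\<bar> \<le> L * edist d y y')"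

definition couplings :: "'a measure \<Rightarrow> 'b measure \<Rightarrow> ('a \<times> 'b) measure set" where
  "couplings P Q =
     {\<pi>. sets \<pi> = sets (P \<Otimes>\<^sub>M Q) \<and> distr \<pi> P fst = P \<and> distr \<pi> Q snd = Q}"

text \<open>
  \<open>KL \<pi> R\<close> is the divergence of \<open>\<pi>\<close> from \<open>R\<close>; \<^const>\<open>KL_divergence\<close> takes these two measures in the
  opposite order and is only meaningful under the condition tested here. For probability
  measures the negative part of \<open>ln (d\<pi>/dR)\<close> is always \<open>\<pi>\<close>-integrable, so non-integrability means
  that the integral is \<open>\<infinity>\<close>.
\<close>

definition KL :: "'a measure \<Rightarrow> 'a measure \<Rightarrow> ereal" where
  "KL \<pi> R =
     (if absolutely_continuous R \<pi> \<and> integrable \<pi> (entropy_density (exp 1) R \<pi>)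
      then ereal (KL_divergence (exp 1) R \<pi>) else \<infinity>)"

definition eot_objective ::
  "('a \<times> 'b \<Rightarrow> real) \<Rightarrow> real \<Rightarrow> 'a measure \<Rightarrow> 'b measure \<Rightarrow> ('a \<times> 'b) measure \<Rightarrow> ereal" where
  "eot_objective c \<epsilon> P Q \<pi> = ereal (\<integral>z. c z \<partial>\<pi>) + ereal \<epsilon> * KL \<pi> (P \<Otimes>\<^sub>M Q)"

definition eot_value :: "('a \<times> 'b \<Rightarrow> real) \<Rightarrow> real \<Rightarrow> 'a measure \<Rightarrow> 'b measure \<Rightarrow> ereal" where
  "eot_value c \<epsilon> P Q = (INF \<pi>\<in>couplings P Q. eot_objective c \<epsilon> P Q \<pi>)"

definition eot_plan ::
  "('a \<times> 'b \<Rightarrow> real) \<Rightarrow> real \<Rightarrow> 'a measure \<Rightarrow> 'b measure \<Rightarrow> ('a \<times> 'b) measure" where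
  "eot_plan c \<epsilon> P Q =
     (THE \<pi>. \<pi> \<in> couplings P Q \<and> eot_objective c \<epsilon> P Q \<pi> = eot_value c \<epsilon> P Q)"

definition eot_density ::
  "('a \<times> 'b \<Rightarrow> real) \<Rightarrow> real \<Rightarrow> 'a measure \<Rightarrow> 'b measure \<Rightarrow> 'a \<times> 'b \<Rightarrow> real" where
  "eot_density c \<epsilon> P Q z = enn2real (RN_deriv (P \<Otimes>\<^sub>M Q) (eot_plan c \<epsilon> P Q) z)"

definition empirical :: "'a measure \<Rightarrow> nat \<Rightarrow> (nat \<Rightarrow> 'a) \<Rightarrow> 'a measure" where
  "empirical M n x = distr (uniform_count_measure {..<n}) M x"

lemma emeasure_empirical:
  assumes n: "n \<ge> 1" and x: "\<And>i. i < n \<Longrightarrow> x i \<in> space M" and A: "A \<in> sets M"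
  shows "emeasure (empirical M n x) A = (\<Sum>i<n. emeasure (return M (x i)) A) / of_nat n"
proof -
  have meas: "x \<in> uniform_count_measure {..<n} \<rightarrow>\<^sub>M M"
    using x by (auto simp: measurable_def uniform_count_measure_def space_point_measure
      sets_point_measure)
  have "emeasure (empirical M n x) A = emeasure (uniform_count_measure {..<n}) (x -` A \<inter> {..<n})"
    using meas A by (simp add: empirical_def emeasure_distr space_uniform_count_measure)
  also have "\<dots> = ennreal (card (x -` A \<inter> {..<n}) / n)"
    by (subst emeasure_uniform_count_measure) auto
  also have "\<dots> = of_nat (card (x -` A \<inter> {..<n})) / of_nat n"
    using n by (simp add: divide_ennreal[symmetric] ennreal_of_nat_eq_real_of_nat)
  also have "of_nat (card (x -` A \<inter> {..<n})) = (\<Sum>i<n. emeasure (return M (x i)) A)"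
  proof -
    have "(\<Sum>i<n. emeasure (return M (x i)) A) = (\<Sum>i<n. indicator (x -` A) i)"
      using A by (intro sum.cong) (auto simp: indicator_def)
    also have "\<dots> = of_nat (card (x -` A \<inter> {..<n}))"
      by (simp add: sum_indicator_eq_card Int_commute indicator_def vimage_def)
    finally show ?thesis ..
  qed
  finally show ?thesis .
qed

text \<open>
  Expected error over the two samples, which are mutually independent with laws \<open>\<mu>\<^sup>n\<close> and
  \<open>\<nu>\<^sup>n\<close>. All terms being nonnegative, both integrals are Lebesgue integrals with values
  in \<open>[0, \<infinity>]\<close>.
\<close>

definition expected_density_error ::
  "nat \<Rightarrow> ((nat \<Rightarrow> real) \<times> (nat \<Rightarrow> real) \<Rightarrow> real) \<Rightarrow> real \<Rightarrow>
     (nat \<Rightarrow> real) measure \<Rightarrow> (nat \<Rightarrow> real) measure \<Rightarrow> nat \<Rightarrow> ennreal" where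
  "expected_density_error d c \<epsilon> \<mu> \<nu> n =
     (\<integral>\<^sup>+ (x, y).
        (let \<mu>' = empirical (Rd d) n x; \<nu>' = empirical (Rd d) n y
         in \<integral>\<^sup>+ z. ennreal \<bar>eot_density c \<epsilon> \<mu>' \<nu>' z - eot_density c \<epsilon> \<mu> \<nu> z\<bar> \<partial>(\<mu>' \<Otimes>\<^sub>M \<nu>'))
      \<partial>(Pi\<^sub>M {..<n} (\<lambda>_. \<mu>) \<Otimes>\<^sub>M Pi\<^sub>M {..<n} (\<lambda>_. \<nu>)))"

text \<open>Powers on \<open>[0, \<infinity>]\<close> for exponents \<open>a > 0\<close>.\<close>

definition ennreal_powr :: "ennreal \<Rightarrow> real \<Rightarrow> ennreal" where
  "ennreal_powr x a = (if x = \<infinity> then \<infinity> else ennreal (enn2real x powr a))"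

end

theory Submission
  imports Defs
begin

text \<open>
  Write \<open>p\<close> and \<open>q\<close> for the population and the empirical density. Both have the form
  \<open>exp (u x + v y - c (x, y) / \<epsilon>)\<close> with potentials of size \<open>O(1 / \<epsilon>)\<close>. Hence \<open>ln q - ln p\<close> splits into a
  function of \<open>x\<close> plus a function of \<open>y\<close>, and since \<open>q\<close> has exact marginals, the symmetric divergence
  \<open>\<integral> (q - p) (ln q - ln p)\<close> over the empirical product measure only sees the marginal defects of \<open>p\<close>
  on the sample. Their squared expectation is at most \<open>\<integral> p\<^sup>2 / n\<close>, and a Pinsker-type inequality turns the
  bound on the divergence into one on \<open>|q - p|\<close>. Finally \<open>ln p\<close> is \<open>2 L / \<epsilon>\<close>-Lipschitz in each variable, so
  on a ball of radius \<open>\<epsilon> / L\<close> it varies by at most 4, and \<open>\<integral> p\<^sup>2\<close> is at most \<open>exp 4\<close> times either covering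
  number.
\<close>

section \<open>The Sinkhorn contraction\<close>

text \<open>The claim is about minimisers and Radon-Nikodym densities, so the Gibbs form with
  bounded potentials has to be produced before densities can be compared. Sinkhorn's iteration does
  this for every bounded kernel, hence with the same bounds for the population and for each
  empirical problem; \<open>ratio_near\<close> is closeness in Hilbert's projective metric, with a
  free scale \<alpha>. Gibbs' inequality then identifies the resulting plan as the unique minimiser.

  The obstacle is that \<open>p\<close> restricted to a sample is no coupling density and has random
  mass. The estimates are therefore kept linear in the marginal defects and in the mass, with
  deterministic AM-GM weights that balance the expectations.

  The rate 1/4 arises because the divergence is linear in defects of order \<open>1 / sqrt n\<close>
  and controls the square of the L1 distance. In the constant \<open>sqrt 6 * exp 1\<close>, the
  number 6 = 4 + 2 adds up the bounds on the differences of the two pairs of potentials in units of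
  1 / \<epsilon>, and \<open>exp 1\<close> is the fourth root of the factor \<open>exp 4\<close> in
  the second moment.\<close>

definition ratio_near :: "'a set \<Rightarrow> real \<Rightarrow> ('a \<Rightarrow> real) \<Rightarrow> ('a \<Rightarrow> real) \<Rightarrow> bool" where
  "ratio_near S \<delta> f g \<longleftrightarrow> (\<exists>\<alpha>>0. \<forall>x\<in>S. \<alpha> * g x \<le> f x \<and> f x \<le> \<alpha> * (1 + \<delta>) * g x)"

lemma ratio_near_mono:
  assumes "ratio_near S \<delta> f g" "\<delta> \<le> \<delta>'" "\<And>x. x \<in> S \<Longrightarrow> 0 \<le> g x"
  shows "ratio_near S \<delta>' f g"
proof -
  obtain \<alpha> where \<alpha>: "\<alpha> > 0" "\<And>x. x \<in> S \<Longrightarrow> \<alpha> * g x \<le> f x" "\<And>x. x \<in> S \<Longrightarrow> f x \<le> \<alpha> * (1 + \<delta>) * g x"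
    using assms(1) by (auto simp: ratio_near_def)
  have "f x \<le> \<alpha> * (1 + \<delta>') * g x" if "x \<in> S" for x
  proof -
    have "\<alpha> * (1 + \<delta>) * g x \<le> \<alpha> * (1 + \<delta>') * g x"
      using \<alpha>(1) assms(2,3) that by (intro mult_right_mono mult_left_mono) auto
    then show ?thesis using \<alpha>(3)[OF that] by linarith
  qed
  then show ?thesis using \<alpha> by (auto simp: ratio_near_def)
qed

text \<open>Inversion is an isometry of Hilbert's projective metric: the lower and the upper bound
  swap roles, which only changes the scale to
  \<open>1 / (\<alpha> * (1 + \<delta>))\<close>.\<close>

lemma ratio_near_inverse:
  assumes "ratio_near S \<delta> f g" "0 \<le> \<delta>" "\<And>x. x \<in> S \<Longrightarrow> 0 < f x" "\<And>x. x \<in> S \<Longrightarrow> 0 < g x"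
  shows "ratio_near S \<delta> (\<lambda>x. 1 / f x) (\<lambda>x. 1 / g x)"
proof -
  obtain \<alpha> where \<alpha>: "\<alpha> > 0" "\<And>x. x \<in> S \<Longrightarrow> \<alpha> * g x \<le> f x" "\<And>x. x \<in> S \<Longrightarrow> f x \<le> \<alpha> * (1 + \<delta>) * g x"
    using assms(1) by (auto simp: ratio_near_def)
  show ?thesis
    unfolding ratio_near_def
  proof (intro exI[of _ "1 / (\<alpha> * (1 + \<delta>))"] conjI ballI)
    show "1 / (\<alpha> * (1 + \<delta>)) > 0" using \<alpha> assms(2) by simp
    fix x assume x: "x \<in> S"
    have pos: "\<alpha> * (1 + \<delta>) > 0" using \<alpha> assms(2) by simp
    show "1 / (\<alpha> * (1 + \<delta>)) * (1 / g x) \<le> 1 / f x"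
      using \<alpha>(3)[OF x] assms(3,4)[OF x] pos by (simp add: field_simps)
    show "1 / f x \<le> 1 / (\<alpha> * (1 + \<delta>)) * (1 + \<delta>) * (1 / g x)"
    proof -
      have "1 / (\<alpha> * (1 + \<delta>)) * (1 + \<delta>) * (1 / g x) = 1 / (\<alpha> * g x)"
        using assms(2) by simp
      moreover have "1 / f x \<le> 1 / (\<alpha> * g x)"
        using \<alpha>(1) \<alpha>(2)[OF x] assms(3,4)[OF x] by (intro divide_left_mono) auto
      ultimately show ?thesis by simp
    qed
  qed
qed

text \<open>Projective invariance: constant factors go into \<alpha>, so both functions may be
  normalised independently.\<close>

lemma ratio_near_scale:
  assumes "ratio_near S \<delta> f g" "0 < s" "0 < t"
  shows "ratio_near S \<delta> (\<lambda>x. f x / s) (\<lambda>x. g x / t)"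
proof -
  obtain \<alpha> where \<alpha>: "\<alpha> > 0" "\<And>x. x \<in> S \<Longrightarrow> \<alpha> * g x \<le> f x" "\<And>x. x \<in> S \<Longrightarrow> f x \<le> \<alpha> * (1 + \<delta>) * g x"
    using assms(1) by (auto simp: ratio_near_def)
  show ?thesis
    unfolding ratio_near_def
  proof (intro exI[of _ "\<alpha> * t / s"] conjI ballI)
    show "\<alpha> * t / s > 0" using \<alpha> assms by simp
    fix x assume x: "x \<in> S"
    show "\<alpha> * t / s * (g x / t) \<le> f x / s"
      using \<alpha>(2)[OF x] assms(2,3) by (simp add: divide_right_mono)
    show "f x / s \<le> \<alpha> * t / s * (1 + \<delta>) * (g x / t)"
      using divide_right_mono[OF \<alpha>(3)[OF x], of s] assms(2,3) by simp
  qed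
qed

section \<open>Ratio bounds under averaging\<close>

context prob_space
begin

lemma integrable_bounded:
  fixes f :: "'a \<Rightarrow> real"
  assumes "f \<in> borel_measurable M" "\<And>x. x \<in> space M \<Longrightarrow> \<bar>f x\<bar> \<le> B"
  shows "integrable M f"
  using assms by (intro integrable_const_bound[of _ B]) auto

text \<open>Equal integrals pin the free scale: integrating the two bounds gives
  \<open>\<alpha> \<le> 1\<close> and \<open>1 \<le> \<alpha> * (1 + \<delta>)\<close>. Projective
  closeness thereby becomes pointwise closeness.\<close>

lemma normalized_ratio_near_dist:
  fixes f g :: "'a \<Rightarrow> real"
  assumes "ratio_near (space M) \<delta> f g" "0 \<le> \<delta>" "integrable M f" "integrable M g"
    "(\<integral>x. f x \<partial>M) = 1" "(\<integral>x. g x \<partial>M) = 1" "x \<in> space M" "0 \<le> g x"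
  shows "\<bar>f x - g x\<bar> \<le> \<delta> * g x"
proof -
  obtain \<alpha> where \<alpha>: "\<alpha> > 0" "\<And>x. x \<in> space M \<Longrightarrow> \<alpha> * g x \<le> f x"
    "\<And>x. x \<in> space M \<Longrightarrow> f x \<le> \<alpha> * (1 + \<delta>) * g x"
    using assms(1) by (auto simp: ratio_near_def)
  have "(\<integral>x. \<alpha> * g x \<partial>M) \<le> (\<integral>x. f x \<partial>M)"
    using assms \<alpha> by (intro integral_mono) auto
  then have le: "\<alpha> \<le> 1" using assms by simp
  have "(\<integral>x. f x \<partial>M) \<le> (\<integral>x. \<alpha> * (1 + \<delta>) * g x \<partial>M)"
    using assms \<alpha> by (intro integral_mono) auto
  then have ge: "1 \<le> \<alpha> * (1 + \<delta>)" using assms by simp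
  have \<alpha>\<delta>: "\<alpha> * \<delta> \<le> \<delta>" using le assms(2) mult_right_mono[of \<alpha> 1 \<delta>] by simp
  have "(1 - \<delta>) * g x \<le> \<alpha> * g x" "\<alpha> * (1 + \<delta>) * g x \<le> (1 + \<delta>) * g x"
    using ge le \<alpha>\<delta> assms(2,8) by (intro mult_right_mono; simp add: algebra_simps)+
  with \<alpha>(2,3)[OF assms(7)] show ?thesis by (simp add: abs_le_iff algebra_simps)
qed

text \<open>The averaging step of Birkhoff's contraction theorem: both \<open>f - \<alpha> g\<close> and
  \<open>\<alpha> (1 + \<delta>) g - f\<close> are nonnegative, so integrating them against \<open>\<kappa>\<close> costs at most a factor \<open>m\<close>.\<close>

lemma ratio_near_integral:
  fixes \<kappa> :: "'b \<Rightarrow> 'a \<Rightarrow> real"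
  assumes m: "0 < m" "m \<le> 1"
    and \<kappa>: "\<And>u. u \<in> S \<Longrightarrow> \<kappa> u \<in> borel_measurable M"
      "\<And>u v. m \<le> \<kappa> u v" "\<And>u v. \<kappa> u v \<le> 1 / m"
    and f: "integrable M f" and g: "integrable M g" "\<And>x. x \<in> space M \<Longrightarrow> 0 < g x"
    and near: "ratio_near (space M) \<delta> f g" and \<delta>: "0 \<le> \<delta>"
  shows "ratio_near S ((1 - m\<^sup>2) * \<delta>) (\<lambda>u. \<integral>v. \<kappa> u v * f v \<partial>M) (\<lambda>u. \<integral>v. \<kappa> u v * g v \<partial>M)"
proof -
  obtain \<alpha> where \<alpha>: "\<alpha> > 0" "\<And>x. x \<in> space M \<Longrightarrow> \<alpha> * g x \<le> f x"
    "\<And>x. x \<in> space M \<Longrightarrow> f x \<le> \<alpha> * (1 + \<delta>) * g x"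
    using near by (auto simp: ratio_near_def)
  have int: "integrable M (\<lambda>v. \<kappa> u v * h v)" if "u \<in> S" "integrable M h" for u and h :: "'a \<Rightarrow> real"
  proof (rule Bochner_Integration.integrable_bound)
    show "integrable M (\<lambda>v. (1 / m) * h v)" using that by simp
    have k0: "\<bar>\<kappa> u v\<bar> \<le> 1 / m" for v using \<kappa>(2,3)[of u v] m by auto
    show "AE v in M. norm (\<kappa> u v * h v) \<le> norm (1 / m * h v)"
    proof (intro AE_I2)
      fix v
      have "\<bar>\<kappa> u v\<bar> * \<bar>h v\<bar> \<le> (1 / m) * \<bar>h v\<bar>" using k0 by (rule mult_right_mono) simp
      then show "norm (\<kappa> u v * h v) \<le> norm (1 / m * h v)"
        using m by (simp add: abs_mult)
    qed
    show "(\<lambda>v. \<kappa> u v * h v) \<in> borel_measurable M"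
      using that \<kappa>(1)[OF that(1)] by (intro borel_measurable_times) auto
  qed
  have lower: "m * (\<integral>v. h v \<partial>M) \<le> (\<integral>v. \<kappa> u v * h v \<partial>M)"
    if "u \<in> S" "integrable M h" "\<And>v. v \<in> space M \<Longrightarrow> 0 \<le> h v" for u and h :: "'a \<Rightarrow> real"
  proof -
    have "(\<integral>v. m * h v \<partial>M) \<le> (\<integral>v. \<kappa> u v * h v \<partial>M)"
      using that int \<kappa>(2) by (intro integral_mono mult_right_mono) auto
    then show ?thesis by simp
  qed
  have upper: "(\<integral>v. \<kappa> u v * h v \<partial>M) \<le> (\<integral>v. h v \<partial>M) / m"
    if "u \<in> S" "integrable M h" "\<And>v. v \<in> space M \<Longrightarrow> 0 \<le> h v" for u and h :: "'a \<Rightarrow> real"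
  proof -
    have "(\<integral>v. \<kappa> u v * h v \<partial>M) \<le> (\<integral>v. (1 / m) * h v \<partial>M)"
      using that int \<kappa>(3) by (intro integral_mono mult_right_mono) auto
    then show ?thesis by simp
  qed
  define G where "G = (\<integral>v. g v \<partial>M)"
  define \<theta> where "\<theta> = (\<integral>v. f v - \<alpha> * g v \<partial>M)"
  have G0: "G \<ge> 0" unfolding G_def using g by (intro integral_nonneg_AE) (auto intro: less_imp_le)
  have \<theta>0: "\<theta> \<ge> 0" unfolding \<theta>_def using \<alpha> by (intro integral_nonneg_AE) auto
  have Gpos: "G > 0"
  proof -
    have "G \<noteq> 0"
    proof
      assume "G = 0"
      then have "AE v in M. g v = 0"
        using integral_nonneg_eq_0_iff_AE[OF g(1)] g(2) unfolding G_def by (auto intro: less_imp_le)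
      then have "AE v in M. False"
        using AE_space by eventually_elim (use g(2) in fastforce)
      then show False by simp
    qed
    with G0 show ?thesis by simp
  qed
  \<comment> \<open>The amount by which the lower scale \<alpha> can be raised: the surplus
    \<open>f - \<alpha> g\<close> has mass \<theta>, so averaging it leaves at least
    \<open>m * \<theta>\<close>, while the average of \<open>g\<close> is at most
    \<open>G / m\<close>.\<close>
  define \<tau> where "\<tau> = m\<^sup>2 * (\<theta> / G)"
  have \<tau>0: "\<tau> \<ge> 0" using \<theta>0 G0 by (simp add: \<tau>_def)
  have \<theta>eq: "(\<integral>v. \<alpha> * (1 + \<delta>) * g v - f v \<partial>M) = \<alpha> * \<delta> * G - \<theta>"
    using f g by (simp add: \<theta>_def G_def algebra_simps)
  show ?thesis
    unfolding ratio_near_def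
  proof (intro exI[of _ "\<alpha> + \<tau>"] conjI ballI)
    show "\<alpha> + \<tau> > 0" using \<alpha>(1) \<tau>0 by simp
    fix u assume u: "u \<in> S"
    let ?F = "\<integral>v. \<kappa> u v * f v \<partial>M" and ?G = "\<integral>v. \<kappa> u v * g v \<partial>M"
    have GG: "?G \<le> G / m" "?G \<ge> 0"
      using upper[OF u g(1)] order_trans[OF _ lower[OF u g(1)], of 0] g(2) G0 m
      unfolding G_def[symmetric] by (simp_all add: less_imp_le)
    have tau_le: "\<tau> * ?G \<le> m * \<theta>"
    proof -
      have "\<tau> * ?G \<le> \<tau> * (G / m)" using GG \<tau>0 by (intro mult_left_mono)
      also have "\<dots> = m * \<theta>" using Gpos m by (simp add: \<tau>_def power2_eq_square)
      finally show ?thesis .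
    qed
    have "m * \<theta> \<le> (\<integral>v. \<kappa> u v * (f v - \<alpha> * g v) \<partial>M)"
      unfolding \<theta>_def using u f g \<alpha> by (intro lower) auto
    also have "\<dots> = (\<integral>v. \<kappa> u v * f v - \<alpha> * (\<kappa> u v * g v) \<partial>M)" by (simp add: algebra_simps)
    also have "\<dots> = ?F - \<alpha> * ?G"
      using int[OF u f] int[OF u g(1)] by simp
    finally show "(\<alpha> + \<tau>) * ?G \<le> ?F" using tau_le by (simp add: algebra_simps)
    have "m * (\<alpha> * \<delta> * G - \<theta>) \<le> (\<integral>v. \<kappa> u v * (\<alpha> * (1 + \<delta>) * g v - f v) \<partial>M)"
      unfolding \<theta>eq[symmetric] using u f g \<alpha> by (intro lower) auto
    also have "\<dots> = (\<integral>v. \<alpha> * (1 + \<delta>) * (\<kappa> u v * g v) - \<kappa> u v * f v \<partial>M)" by (simp add: algebra_simps)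
    also have "\<dots> = \<alpha> * (1 + \<delta>) * ?G - ?F"
      using int[OF u f] int[OF u g(1)] by simp
    finally have 1: "?F \<le> \<alpha> * (1 + \<delta>) * ?G - m * (\<alpha> * \<delta> * G - \<theta>)" by simp
    have "\<theta> \<le> \<alpha> * \<delta> * G"
    proof -
      have "0 \<le> (\<integral>v. \<alpha> * (1 + \<delta>) * g v - f v \<partial>M)" using \<alpha> by (intro integral_nonneg_AE) auto
      then show ?thesis using \<theta>eq by simp
    qed
    \<comment> \<open>The amount by which the upper scale can be lowered. The two gains \<tau> and
      \<open>m\<^sup>2 * \<alpha> * \<delta> - \<tau>\<close> add up to the fixed share
      \<open>m\<^sup>2\<close> of the gap \<open>\<alpha> * \<delta>\<close>, whatever \<theta>
      is.\<close>
    then have \<tau>\<alpha>: "m\<^sup>2 * \<alpha> * \<delta> - \<tau> \<ge> 0"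
    proof -
      assume "\<theta> \<le> \<alpha> * \<delta> * G"
      then have "\<theta> / G \<le> \<alpha> * \<delta>" using Gpos by (simp add: field_simps)
      then show ?thesis unfolding \<tau>_def using mult_left_mono[of "\<theta> / G" "\<alpha> * \<delta>" "m\<^sup>2"] by (simp add: mult.assoc)
    qed
    have "(m\<^sup>2 * \<alpha> * \<delta> - \<tau>) * ?G \<le> (m\<^sup>2 * \<alpha> * \<delta> - \<tau>) * (G / m)"
      using GG \<tau>\<alpha> by (intro mult_left_mono)
    also have "\<dots> = m * (\<alpha> * \<delta> * G - \<theta>)"
      using Gpos m by (simp add: \<tau>_def power2_eq_square field_simps)
    finally have 2: "(m\<^sup>2 * \<alpha> * \<delta> - \<tau>) * ?G \<le> m * (\<alpha> * \<delta> * G - \<theta>)" .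
    have "?F \<le> (\<alpha> * (1 + \<delta>) - (m\<^sup>2 * \<alpha> * \<delta> - \<tau>)) * ?G"
      using 1 2 by (simp add: algebra_simps)
    also have "\<dots> = (\<alpha> + \<tau> + (1 - m\<^sup>2) * \<alpha> * \<delta>) * ?G" by (simp add: algebra_simps)
    also have "\<dots> \<le> (\<alpha> + \<tau>) * (1 + (1 - m\<^sup>2) * \<delta>) * ?G"
    proof (intro mult_right_mono GG)
      have "(1 - m\<^sup>2) * \<delta> * \<tau> \<ge> 0" using m \<delta> \<tau>0 by (simp add: power_le_one)
      then show "\<alpha> + \<tau> + (1 - m\<^sup>2) * \<alpha> * \<delta> \<le> (\<alpha> + \<tau>) * (1 + (1 - m\<^sup>2) * \<delta>)"
        by (simp add: algebra_simps)
    qed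
    finally show "?F \<le> (\<alpha> + \<tau>) * (1 + (1 - m\<^sup>2) * \<delta>) * ?G" .
  qed
qed

end

text \<open>The application has \<open>m = exp (- 1 / \<epsilon>)\<close>. The bounds are imposed at
  every pair and not just almost everywhere, which yields scalings that are bounded, and marginals
  that are exact, at every point of the spaces.\<close>

locale bounded_kernel = pair_prob_space M1 M2
  for M1 :: "'a measure" and M2 :: "'b measure" +
  fixes k :: "'a \<times> 'b \<Rightarrow> real" and m :: real
  assumes k_measurable [measurable]: "k \<in> borel_measurable (M1 \<Otimes>\<^sub>M M2)"
    and m_pos: "0 < m" and k_ge: "\<And>z. m \<le> k z" and k_le: "\<And>z. k z \<le> 1 / m"
begin

lemma m_le_1: "m \<le> 1"
proof -
  have "m \<le> 1 / m" using k_ge k_le by (rule order_trans)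
  then have "m\<^sup>2 \<le> 1\<^sup>2" using m_pos by (simp add: field_simps power2_eq_square)
  then show ?thesis by (rule power2_le_imp_le) simp
qed

lemma k_pos: "0 < k z"
  using m_pos k_ge by (rule less_le_trans)

lemma k_ratio: "m\<^sup>2 * k z \<le> k w"
proof -
  have "m\<^sup>2 * k z \<le> m\<^sup>2 * (1 / m)" using k_le by (intro mult_left_mono) auto
  also have "\<dots> = m" using m_pos by (simp add: power2_eq_square)
  finally show ?thesis using k_ge[of w] by linarith
qed

text \<open>This and \<open>scale_fst\<close> are the two half steps of Sinkhorn's algorithm: with
  one scaling fixed, the other is chosen so that one marginal of \<open>a x * b y * k (x, y)\<close>
  becomes exactly 1.\<close>

definition scale_snd :: "('a \<Rightarrow> real) \<Rightarrow> 'b \<Rightarrow> real" where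
  "scale_snd a y = 1 / (\<integral>x. k (x, y) * a x \<partial>M1)"

definition scale_fst :: "('b \<Rightarrow> real) \<Rightarrow> 'a \<Rightarrow> real" where
  "scale_fst b x = 1 / (\<integral>y. k (x, y) * b y \<partial>M2)"

text \<open>Scaling pairs are determined only up to \<open>(t * a, b / t)\<close>; unit mass removes
  this freedom. The bounds are the range of every normalised output of \<open>scale_fst\<close>,
  because two values of the kernel differ at most by the factor \<open>m\<^sup>2\<close>.\<close>

definition normalized :: "('a \<Rightarrow> real) \<Rightarrow> bool" where
  "normalized a \<longleftrightarrow> a \<in> borel_measurable M1 \<and> (\<integral>x. a x \<partial>M1) = 1 \<and>
     (\<forall>x\<in>space M1. m\<^sup>2 \<le> a x \<and> a x \<le> 1 / m\<^sup>2)"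

text \<open>The range of \<open>scale_snd\<close> on normalised input. It is narrower than the range
  in \<open>normalized\<close>, which is why the two potentials end up with the different bounds 1 /
  \<epsilon> and 2 / \<epsilon>.\<close>

definition admissible :: "('b \<Rightarrow> real) \<Rightarrow> bool" where
  "admissible b \<longleftrightarrow> b \<in> borel_measurable M2 \<and> (\<forall>y\<in>space M2. m \<le> b y \<and> b y \<le> 1 / m)"

lemma normalizedD:
  assumes "normalized a"
  shows "a \<in> borel_measurable M1" "(\<integral>x. a x \<partial>M1) = 1"
    "\<And>x. x \<in> space M1 \<Longrightarrow> m\<^sup>2 \<le> a x" "\<And>x. x \<in> space M1 \<Longrightarrow> a x \<le> 1 / m\<^sup>2"
    "\<And>x. x \<in> space M1 \<Longrightarrow> 0 < a x" "integrable M1 a"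
proof -
  show a: "a \<in> borel_measurable M1" "(\<integral>x. a x \<partial>M1) = 1"
    "\<And>x. x \<in> space M1 \<Longrightarrow> m\<^sup>2 \<le> a x" "\<And>x. x \<in> space M1 \<Longrightarrow> a x \<le> 1 / m\<^sup>2"
    using assms by (auto simp: normalized_def)
  show pos: "\<And>x. x \<in> space M1 \<Longrightarrow> 0 < a x"
    using a(3) m_pos by (auto intro: less_le_trans[of 0 "m\<^sup>2"])
  show "integrable M1 a"
    using a pos by (intro M1.integrable_bounded[of _ "1 / m\<^sup>2"]) (auto simp: abs_of_pos)
qed

lemma admissibleD:
  assumes "admissible b"
  shows "b \<in> borel_measurable M2"
    "\<And>y. y \<in> space M2 \<Longrightarrow> m \<le> b y" "\<And>y. y \<in> space M2 \<Longrightarrow> b y \<le> 1 / m"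
    "\<And>y. y \<in> space M2 \<Longrightarrow> 0 < b y" "integrable M2 b"
proof -
  show b: "b \<in> borel_measurable M2"
    "\<And>y. y \<in> space M2 \<Longrightarrow> m \<le> b y" "\<And>y. y \<in> space M2 \<Longrightarrow> b y \<le> 1 / m"
    using assms by (auto simp: admissible_def)
  show pos: "\<And>y. y \<in> space M2 \<Longrightarrow> 0 < b y"
    using b(2) m_pos by (auto intro: less_le_trans[of 0 m])
  show "integrable M2 b"
    using b pos by (intro M2.integrable_bounded[of _ "1 / m"]) (auto simp: abs_of_pos)
qed

lemma integrable_k_fst:
  assumes "normalized a" "y \<in> space M2"
  shows "integrable M1 (\<lambda>x. k (x, y) * a x)"
proof (rule M1.integrable_bounded)
  note [measurable] = normalizedD(1)[OF assms(1)]
  show "(\<lambda>x. k (x, y) * a x) \<in> borel_measurable M1" using assms(2) by measurable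
  show "\<bar>k (x, y) * a x\<bar> \<le> (1 / m) * (1 / m\<^sup>2)" if "x \<in> space M1" for x
    unfolding abs_mult using that k_le[of "(x, y)"] k_pos[of "(x, y)"] normalizedD(4,5)[OF assms(1) that] m_pos
    by (intro mult_mono) auto
qed

lemma integrable_k_snd:
  assumes "admissible b" "x \<in> space M1"
  shows "integrable M2 (\<lambda>y. k (x, y) * b y)"
proof (rule M2.integrable_bounded)
  note [measurable] = admissibleD(1)[OF assms(1)]
  show "(\<lambda>y. k (x, y) * b y) \<in> borel_measurable M2" using assms(2) by measurable
  show "\<bar>k (x, y) * b y\<bar> \<le> (1 / m) * (1 / m)" if "y \<in> space M2" for y
    unfolding abs_mult using that k_le[of "(x, y)"] k_pos[of "(x, y)"] admissibleD(3,4)[OF assms(1) that] m_pos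
    by (intro mult_mono) auto
qed

lemma integral_k_fst:
  assumes "normalized a" "y \<in> space M2"
  shows "m \<le> (\<integral>x. k (x, y) * a x \<partial>M1)" "(\<integral>x. k (x, y) * a x \<partial>M1) \<le> 1 / m"
    "0 < (\<integral>x. k (x, y) * a x \<partial>M1)"
proof -
  note a = normalizedD[OF assms(1)] and i = integrable_k_fst[OF assms]
  have "(\<integral>x. m * a x \<partial>M1) \<le> (\<integral>x. k (x, y) * a x \<partial>M1)"
    using a i k_ge by (intro integral_mono mult_right_mono) (auto intro: less_imp_le)
  then show ge: "m \<le> (\<integral>x. k (x, y) * a x \<partial>M1)" using a by simp
  have "(\<integral>x. k (x, y) * a x \<partial>M1) \<le> (\<integral>x. (1 / m) * a x \<partial>M1)"
    using a i k_le by (intro integral_mono mult_right_mono) (auto intro: less_imp_le)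
  then show "(\<integral>x. k (x, y) * a x \<partial>M1) \<le> 1 / m" using a by simp
  show "0 < (\<integral>x. k (x, y) * a x \<partial>M1)" using ge m_pos by linarith
qed

lemma integral_k_snd:
  assumes "admissible b" "x \<in> space M1"
  shows "m\<^sup>2 \<le> (\<integral>y. k (x, y) * b y \<partial>M2)" "0 < (\<integral>y. k (x, y) * b y \<partial>M2)"
proof -
  note b = admissibleD[OF assms(1)] and i = integrable_k_snd[OF assms]
  have "m * m \<le> k (x, y) * b y" if "y \<in> space M2" for y
    using b(2)[OF that] k_ge[of "(x, y)"] m_pos by (intro mult_mono) auto
  then show ge: "m\<^sup>2 \<le> (\<integral>y. k (x, y) * b y \<partial>M2)"
    using M2.integral_ge_const[OF i, of "m\<^sup>2"] by (auto simp: power2_eq_square)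
  then show "0 < (\<integral>y. k (x, y) * b y \<partial>M2)" using m_pos by (auto intro: less_le_trans[of 0 "m\<^sup>2"])
qed

lemma admissible_scale_snd:
  assumes "normalized a" shows "admissible (scale_snd a)"
proof -
  note [measurable] = normalizedD(1)[OF assms]
  have "(\<lambda>y. 1 / (\<integral>x. k (x, y) * a x \<partial>M1)) \<in> borel_measurable M2" by measurable
  moreover have "m \<le> scale_snd a y" "scale_snd a y \<le> 1 / m" if "y \<in> space M2" for y
    using integral_k_fst[OF assms that] m_pos by (simp_all add: scale_snd_def field_simps)
  ultimately show ?thesis unfolding admissible_def by (simp add: scale_snd_def[abs_def])
qed

lemma scale_fst_measurable:
  assumes "admissible b" shows "scale_fst b \<in> borel_measurable M1"
proof -
  note [measurable] = admissibleD(1)[OF assms]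
  have "(\<lambda>x. 1 / (\<integral>y. k (x, y) * b y \<partial>M2)) \<in> borel_measurable M1" by measurable
  then show ?thesis by (simp add: scale_fst_def[abs_def])
qed

lemma scale_fst_pos:
  assumes "admissible b" "x \<in> space M1" shows "0 < scale_fst b x"
  using integral_k_snd[OF assms] by (simp add: scale_fst_def)

lemma scale_fst_le:
  assumes "admissible b" "x \<in> space M1" shows "scale_fst b x \<le> 1 / m\<^sup>2"
  using integral_k_snd[OF assms] m_pos unfolding scale_fst_def by (intro divide_left_mono) auto

text \<open>Only the kernel depends on the point, so \<open>k_ratio\<close> passes through the
  integral and the reciprocal.\<close>

lemma scale_fst_ratio:
  assumes "admissible b" "x \<in> space M1" "x' \<in> space M1"
  shows "m\<^sup>2 * scale_fst b x \<le> scale_fst b x'"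
proof -
  note b = admissibleD[OF assms(1)]
  have "(\<integral>y. m\<^sup>2 * (k (x', y) * b y) \<partial>M2) \<le> (\<integral>y. k (x, y) * b y \<partial>M2)"
  proof (intro integral_mono)
    fix y assume y: "y \<in> space M2"
    show "m\<^sup>2 * (k (x', y) * b y) \<le> k (x, y) * b y"
      using mult_right_mono[OF k_ratio[of "(x', y)" "(x, y)"], of "b y"] b(4)[OF y] by (simp add: mult.assoc)
  qed (use assms in \<open>simp_all add: integrable_k_snd\<close>)
  then have "m\<^sup>2 * (\<integral>y. k (x', y) * b y \<partial>M2) \<le> (\<integral>y. k (x, y) * b y \<partial>M2)" by simp
  then show ?thesis
    using integral_k_snd[OF assms(1,2)] integral_k_snd[OF assms(1,3)]
    by (simp add: scale_fst_def field_simps)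
qed

lemma integrable_scale_fst:
  assumes "admissible b" shows "integrable M1 (scale_fst b)"
  using scale_fst_measurable[OF assms] scale_fst_pos[OF assms] scale_fst_le[OF assms]
  by (intro M1.integrable_bounded[of _ "1 / m\<^sup>2"]) (auto simp: abs_of_pos)

lemma integral_scale_fst:
  assumes "admissible b" "x \<in> space M1"
  shows "m\<^sup>2 * scale_fst b x \<le> (\<integral>x. scale_fst b x \<partial>M1)"
    "m\<^sup>2 * (\<integral>x. scale_fst b x \<partial>M1) \<le> scale_fst b x"
    "0 < (\<integral>x. scale_fst b x \<partial>M1)"
proof -
  show ge: "m\<^sup>2 * scale_fst b x \<le> (\<integral>x. scale_fst b x \<partial>M1)"
    using integrable_scale_fst[OF assms(1)] scale_fst_ratio[OF assms]
    by (intro M1.integral_ge_const) auto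
  have "(\<integral>x'. m\<^sup>2 * scale_fst b x' \<partial>M1) \<le> scale_fst b x"
    using integrable_scale_fst[OF assms(1)] scale_fst_ratio[OF assms(1) _ assms(2)]
    by (intro M1.integral_le_const) auto
  then show "m\<^sup>2 * (\<integral>x. scale_fst b x \<partial>M1) \<le> scale_fst b x" by simp
  have "0 < m\<^sup>2 * scale_fst b x" using scale_fst_pos[OF assms] m_pos by simp
  with ge show "0 < (\<integral>x. scale_fst b x \<partial>M1)" by linarith
qed

text \<open>Renormalising after every round keeps the iterates inside \<open>normalized\<close>,
  where the bounds are uniform.\<close>

definition sinkhorn :: "('a \<Rightarrow> real) \<Rightarrow> 'a \<Rightarrow> real" where
  "sinkhorn a x = scale_fst (scale_snd a) x / (\<integral>x. scale_fst (scale_snd a) x \<partial>M1)"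

lemma normalized_sinkhorn:
  assumes "normalized a" shows "normalized (sinkhorn a)"
proof -
  let ?F = "scale_fst (scale_snd a)"
  note ad = admissible_scale_snd[OF assms]
  note F = scale_fst_measurable[OF ad] integral_scale_fst[OF ad]
  obtain x0 where "x0 \<in> space M1" using M1.not_empty by auto
  then have pos: "0 < (\<integral>x. ?F x \<partial>M1)" using F(4) by blast
  have "sinkhorn a \<in> borel_measurable M1"
    using F(1) unfolding sinkhorn_def[abs_def] by measurable
  moreover have "(\<integral>x. sinkhorn a x \<partial>M1) = 1" using pos by (simp add: sinkhorn_def)
  moreover have "m\<^sup>2 \<le> sinkhorn a x" "sinkhorn a x \<le> 1 / m\<^sup>2" if "x \<in> space M1" for x
    using F(2,3)[OF that] pos m_pos by (simp_all add: sinkhorn_def field_simps)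
  ultimately show ?thesis by (simp add: normalized_def)
qed

text \<open>Each half step is an averaging, which contracts, followed by an inversion, which is
  isometric; the final normalisation is invisible to the projective metric.\<close>

lemma sinkhorn_contraction:
  assumes a: "normalized a" and a': "normalized a'" and near: "ratio_near (space M1) \<delta> a a'" and \<delta>: "0 \<le> \<delta>"
  shows "ratio_near (space M1) ((1 - m\<^sup>2) * \<delta>) (sinkhorn a) (sinkhorn a')"
proof -
  let ?\<delta> = "(1 - m\<^sup>2) * \<delta>"
  have m2: "0 \<le> 1 - m\<^sup>2" "1 - m\<^sup>2 \<le> 1" using m_pos m_le_1 by (simp_all add: power_le_one)
  then have \<delta>': "0 \<le> ?\<delta>" using \<delta> by simp
  note ad = admissible_scale_snd[OF a] and ad' = admissible_scale_snd[OF a']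
  have "ratio_near (space M2) ?\<delta> (\<lambda>y. \<integral>x. k (x, y) * a x \<partial>M1) (\<lambda>y. \<integral>x. k (x, y) * a' x \<partial>M1)"
    using normalizedD[OF a] normalizedD[OF a'] near \<delta> m_pos m_le_1 k_ge k_le
    by (intro M1.ratio_near_integral[where \<kappa> = "\<lambda>y x. k (x, y)"]) auto
  then have 1: "ratio_near (space M2) ?\<delta> (scale_snd a) (scale_snd a')"
    unfolding scale_snd_def[abs_def] using \<delta>' integral_k_fst(3) a a' by (intro ratio_near_inverse) auto
  have "ratio_near (space M1) ((1 - m\<^sup>2) * ?\<delta>) (\<lambda>x. \<integral>y. k (x, y) * scale_snd a y \<partial>M2)
      (\<lambda>x. \<integral>y. k (x, y) * scale_snd a' y \<partial>M2)"
    using admissibleD[OF ad] admissibleD[OF ad'] 1 \<delta>' m_pos m_le_1 k_ge k_le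
    by (intro M2.ratio_near_integral[where \<kappa> = "\<lambda>x y. k (x, y)"]) auto
  \<comment> \<open>One contraction factor per round suffices for convergence, so the second one is
    given away.\<close>
  then have "ratio_near (space M1) ?\<delta> (\<lambda>x. \<integral>y. k (x, y) * scale_snd a y \<partial>M2)
      (\<lambda>x. \<integral>y. k (x, y) * scale_snd a' y \<partial>M2)"
  proof (rule ratio_near_mono)
    show "(1 - m\<^sup>2) * ?\<delta> \<le> ?\<delta>" using mult_right_mono[OF m2(2) \<delta>'] by simp
    show "0 \<le> (\<integral>y. k (x, y) * scale_snd a' y \<partial>M2)" if "x \<in> space M1" for x
      using integral_k_snd(2)[OF ad' that] by simp
  qed
  then have "ratio_near (space M1) ?\<delta> (scale_fst (scale_snd a)) (scale_fst (scale_snd a'))"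
    unfolding scale_fst_def[abs_def] using \<delta>' integral_k_snd(2) ad ad' by (intro ratio_near_inverse) auto
  moreover obtain x0 where "x0 \<in> space M1" using M1.not_empty by auto
  ultimately show ?thesis
    unfolding sinkhorn_def[abs_def]
    using integral_scale_fst(3)[OF ad] integral_scale_fst(3)[OF ad'] by (intro ratio_near_scale) auto
qed

text \<open>Banach's argument carried out pointwise: increments are bounded by a geometric series at
  each point, and the uniform bounds let dominated convergence carry the limit through both half
  steps and the normalisation.\<close>

lemma sinkhorn_fixpoint:
  obtains a where "normalized a" "\<And>x. x \<in> space M1 \<Longrightarrow> sinkhorn a x = a x"
proof -
  define A where "A = (\<lambda>t. (sinkhorn ^^ t) (\<lambda>_. 1))"
  have A_Suc: "A (Suc t) = sinkhorn (A t)" for t by (simp add: A_def)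
  have "normalized (\<lambda>_. 1)"
    using m_pos m_le_1 by (auto simp: normalized_def M1.prob_space power_le_one)
  then have norm: "normalized (A t)" for t
    by (induction t) (auto simp: A_def normalized_sinkhorn)
  note A = normalizedD[OF norm]
  \<comment> \<open>\<open>A 0\<close> is constantly 1 and \<open>A 1\<close> lies between
    \<open>m\<^sup>2\<close> and \<open>1 / m\<^sup>2\<close>; \<open>1 + \<delta>\<close> is the
    ratio of these bounds, and the scale is \<open>m\<^sup>2\<close>.\<close>
  define \<delta> where "\<delta> = 1 / m\<^sup>2 / m\<^sup>2 - 1"
  have inv: "1 \<le> 1 / m\<^sup>2" using m_pos m_le_1 by (simp add: power_le_one)
  have \<delta>: "0 \<le> \<delta>" unfolding \<delta>_def using mult_mono[OF inv inv] by simp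
  have near: "ratio_near (space M1) ((1 - m\<^sup>2) ^ t * \<delta>) (A (Suc t)) (A t)" for t
  proof (induction t)
    case 0
    have "m\<^sup>2 * 1 \<le> A 1 x" "A 1 x \<le> m\<^sup>2 * (1 + \<delta>) * 1" if "x \<in> space M1" for x
    proof -
      have "m\<^sup>2 * (1 + \<delta>) = 1 / m\<^sup>2" using m_pos by (simp add: \<delta>_def field_simps power2_eq_square power4_eq_xxxx)
      then show "m\<^sup>2 * 1 \<le> A 1 x" "A 1 x \<le> m\<^sup>2 * (1 + \<delta>) * 1"
        using A(3,4)[of x 1] that by simp_all
    qed
    moreover have "0 < m\<^sup>2" using m_pos by simp
    ultimately show ?case unfolding ratio_near_def by (auto intro!: exI[of _ "m\<^sup>2"] simp: A_def)
  next
    case (Suc t)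
    have "0 \<le> (1 - m\<^sup>2) ^ t * \<delta>" using \<delta> m_pos m_le_1 by (simp add: power_le_one)
    from sinkhorn_contraction[OF norm norm Suc this] show ?case by (simp add: A_Suc mult.assoc)
  qed
  define q where "q = 1 - m\<^sup>2"
  have q: "0 \<le> q" "q < 1" using m_pos m_le_1 by (simp_all add: q_def power_le_one)
  have dist: "\<bar>A (Suc t) x - A t x\<bar> \<le> q ^ t * \<delta> / m\<^sup>2" if x: "x \<in> space M1" for t x
  proof -
    have nn: "0 \<le> q ^ t * \<delta>" using \<delta> q by simp
    have "ratio_near (space M1) (q ^ t * \<delta>) (A (Suc t)) (A t)"
      using near[of t] by (simp only: q_def)
    then have "\<bar>A (Suc t) x - A t x\<bar> \<le> q ^ t * \<delta> * A t x"
      using M1.normalized_ratio_near_dist[OF _ nn A(6) A(6) A(2) A(2) x less_imp_le[OF A(5)[OF x]]]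
      by blast
    also have "\<dots> \<le> q ^ t * \<delta> * (1 / m\<^sup>2)" using A(4)[OF x] nn by (intro mult_left_mono)
    finally show ?thesis by simp
  qed
  have conv: "convergent (\<lambda>t. A t x)" if x: "x \<in> space M1" for x
  proof -
    have "summable (\<lambda>t. q ^ t * (\<delta> / m\<^sup>2))" using q by (intro summable_mult2 summable_geometric) auto
    then have "summable (\<lambda>t. A (Suc t) x - A t x)"
      by (rule summable_comparison_test'[of _ 0]) (use dist[OF x] in simp)
    then have "convergent (\<lambda>n. \<Sum>t<n. A (Suc t) x - A t x)" by (simp add: summable_iff_convergent)
    then have "convergent (\<lambda>n. A n x - A 0 x)" by (simp add: sum_lessThan_telescope[of "\<lambda>t. A t x"])
    then have "convergent (\<lambda>n. (A n x - A 0 x) + A 0 x)" by (intro convergent_add convergent_const)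
    then show ?thesis by simp
  qed
  define a where "a = (\<lambda>x. lim (\<lambda>t. A t x))"
  have lim: "(\<lambda>t. A t x) \<longlonglongrightarrow> a x" if "x \<in> space M1" for x
    using conv[OF that] by (simp add: a_def convergent_LIMSEQ_iff)
  have a_meas: "a \<in> borel_measurable M1" using A(1) unfolding a_def by (rule borel_measurable_lim_metric)
  have a_bd: "m\<^sup>2 \<le> a x" "a x \<le> 1 / m\<^sup>2" if "x \<in> space M1" for x
    using A(3,4)[OF that] by (auto intro: LIMSEQ_le_const[OF lim[OF that]] LIMSEQ_le_const2[OF lim[OF that]])
  have absA: "\<bar>A t x\<bar> \<le> 1 / m\<^sup>2" if "x \<in> space M1" for t x
    using A(4,5)[OF that, of t] by simp
  have "(\<lambda>t. \<integral>x. A t x \<partial>M1) \<longlonglongrightarrow> (\<integral>x. a x \<partial>M1)"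
    using A(1) a_meas lim absA by (intro integral_dominated_convergence[where w = "\<lambda>_. 1 / m\<^sup>2"]) auto
  then have "(\<integral>x. a x \<partial>M1) = 1" using A(2) by (simp add: LIMSEQ_const_iff)
  with a_meas a_bd have a_norm: "normalized a" by (simp add: normalized_def)
  have lim_snd: "(\<lambda>t. scale_snd (A t) y) \<longlonglongrightarrow> scale_snd a y" if y: "y \<in> space M2" for y
  proof -
    have "(\<lambda>t. \<integral>x. k (x, y) * A t x \<partial>M1) \<longlonglongrightarrow> (\<integral>x. k (x, y) * a x \<partial>M1)"
    proof (intro integral_dominated_convergence[where w = "\<lambda>_. 1 / m * (1 / m\<^sup>2)"])
      show "AE x in M1. norm (k (x, y) * A t x) \<le> 1 / m * (1 / m\<^sup>2)" for t
      proof (intro AE_I2)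
        fix x assume "x \<in> space M1"
        then show "norm (k (x, y) * A t x) \<le> 1 / m * (1 / m\<^sup>2)"
          unfolding norm_mult using absA k_le[of "(x, y)"] k_pos[of "(x, y)"] m_pos
          by (intro mult_mono) auto
      qed
    qed (use integrable_k_fst[OF norm y] integrable_k_fst[OF a_norm y] lim in \<open>auto intro!: tendsto_intros\<close>)
    then show ?thesis unfolding scale_snd_def
      using integral_k_fst(3)[OF a_norm y] by (intro tendsto_divide tendsto_const) auto
  qed
  note ad = admissible_scale_snd[OF norm] and ad_a = admissible_scale_snd[OF a_norm]
  have lim_fst: "(\<lambda>t. scale_fst (scale_snd (A t)) x) \<longlonglongrightarrow> scale_fst (scale_snd a) x" if x: "x \<in> space M1" for x
  proof -
    have "(\<lambda>t. \<integral>y. k (x, y) * scale_snd (A t) y \<partial>M2) \<longlonglongrightarrow> (\<integral>y. k (x, y) * scale_snd a y \<partial>M2)"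
    proof (intro integral_dominated_convergence[where w = "\<lambda>_. 1 / m * (1 / m)"])
      show "AE y in M2. norm (k (x, y) * scale_snd (A t) y) \<le> 1 / m * (1 / m)" for t
      proof (intro AE_I2)
        fix y assume "y \<in> space M2"
        then show "norm (k (x, y) * scale_snd (A t) y) \<le> 1 / m * (1 / m)"
          unfolding norm_mult using admissibleD(3,4)[OF ad, of y t] k_le[of "(x, y)"] k_pos[of "(x, y)"] m_pos
          by (intro mult_mono) auto
      qed
    qed (use integrable_k_snd[OF ad x] integrable_k_snd[OF ad_a x] lim_snd in \<open>auto intro!: tendsto_intros\<close>)
    then show ?thesis unfolding scale_fst_def
      using integral_k_snd(2)[OF ad_a x] by (intro tendsto_divide tendsto_const) auto
  qed
  have lim_int: "(\<lambda>t. \<integral>x. scale_fst (scale_snd (A t)) x \<partial>M1) \<longlonglongrightarrow> (\<integral>x. scale_fst (scale_snd a) x \<partial>M1)"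
    using scale_fst_measurable[OF ad] scale_fst_measurable[OF ad_a] lim_fst scale_fst_le[OF ad] scale_fst_pos[OF ad]
    by (intro integral_dominated_convergence[where w = "\<lambda>_. 1 / m\<^sup>2"]) (auto simp: abs_of_pos)
  have "sinkhorn a x = a x" if x: "x \<in> space M1" for x
  proof (rule LIMSEQ_unique)
    show "(\<lambda>t. A (Suc t) x) \<longlonglongrightarrow> sinkhorn a x"
      unfolding A_Suc sinkhorn_def using lim_fst[OF x] lim_int integral_scale_fst(3)[OF ad_a x]
      by (intro tendsto_divide) auto
    show "(\<lambda>t. A (Suc t) x) \<longlonglongrightarrow> a x" using lim[OF x] by (rule LIMSEQ_Suc)
  qed
  with a_norm show thesis by (rule that)
qed

text \<open>At a fixed point the choice \<open>b = scale_snd a\<close> makes one marginal exact,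
  whereas the other is only known to be the constant 1 / \<sigma>. Computing the total mass in both
  orders of integration forces \<open>\<sigma> = 1\<close>.\<close>

lemma schroedinger_system:
  obtains a b where "normalized a" "admissible b"
    "\<And>x. x \<in> space M1 \<Longrightarrow> (\<integral>y. a x * b y * k (x, y) \<partial>M2) = 1"
    "\<And>y. y \<in> space M2 \<Longrightarrow> (\<integral>x. a x * b y * k (x, y) \<partial>M1) = 1"
proof -
  obtain a where a: "normalized a" and fix_a: "\<And>x. x \<in> space M1 \<Longrightarrow> sinkhorn a x = a x"
    using sinkhorn_fixpoint by blast
  define b where "b = scale_snd a"
  have b: "admissible b" unfolding b_def by (rule admissible_scale_snd[OF a])
  define \<sigma> where "\<sigma> = (\<integral>x. scale_fst b x \<partial>M1)"
  obtain x0 where "x0 \<in> space M1" using M1.not_empty by auto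
  then have \<sigma>: "\<sigma> > 0" unfolding \<sigma>_def using integral_scale_fst(3)[OF b] by blast
  have 1: "(\<integral>x. a x * b y * k (x, y) \<partial>M1) = 1" if y: "y \<in> space M2" for y
  proof -
    have "(\<integral>x. a x * b y * k (x, y) \<partial>M1) = (\<integral>x. b y * (k (x, y) * a x) \<partial>M1)"
      by (simp add: mult_ac)
    also have "\<dots> = b y * (\<integral>x. k (x, y) * a x \<partial>M1)" by simp
    finally show ?thesis using integral_k_fst(3)[OF a y] by (simp add: b_def scale_snd_def)
  qed
  have 2: "(\<integral>y. a x * b y * k (x, y) \<partial>M2) = 1 / \<sigma>" if x: "x \<in> space M1" for x
  proof -
    have "(\<integral>y. a x * b y * k (x, y) \<partial>M2) = (\<integral>y. a x * (k (x, y) * b y) \<partial>M2)"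
      by (simp add: mult_ac)
    also have "\<dots> = a x * (\<integral>y. k (x, y) * b y \<partial>M2)" by simp
    also have "\<dots> = scale_fst b x * (\<integral>y. k (x, y) * b y \<partial>M2) / \<sigma>"
      by (simp add: fix_a[OF x, unfolded sinkhorn_def, symmetric] b_def \<sigma>_def)
    also have "\<dots> = 1 / \<sigma>" using integral_k_snd(2)[OF b x] by (simp add: scale_fst_def)
    finally show ?thesis .
  qed
  note [measurable] = normalizedD(1)[OF a] admissibleD(1)[OF b]
  have "integrable (M1 \<Otimes>\<^sub>M M2) (\<lambda>(x, y). a x * b y * k (x, y))"
  proof (rule P.integrable_bounded)
    show "\<bar>case z of (x, y) \<Rightarrow> a x * b y * k (x, y)\<bar> \<le> 1 / m\<^sup>2 * (1 / m) * (1 / m)"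
      if zs: "z \<in> space (M1 \<Otimes>\<^sub>M M2)" for z
    proof -
      obtain x y where z: "z = (x, y)" "x \<in> space M1" "y \<in> space M2"
        using zs by (auto simp: space_pair_measure)
      show ?thesis
        unfolding z(1) prod.case abs_mult
        using normalizedD(4,5)[OF a z(2)] admissibleD(3,4)[OF b z(3)] k_le[of "(x, y)"] k_pos[of "(x, y)"] m_pos
        by (intro mult_mono) auto
    qed
  qed measurable
  then have "(\<integral>y. \<integral>x. a x * b y * k (x, y) \<partial>M1 \<partial>M2) = (\<integral>x. \<integral>y. a x * b y * k (x, y) \<partial>M2 \<partial>M1)"
    by (rule Fubini_integral)
  moreover have "(\<integral>y. \<integral>x. a x * b y * k (x, y) \<partial>M1 \<partial>M2) = 1"
    using 1 by (simp cong: Bochner_Integration.integral_cong add: M2.prob_space)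
  moreover have "(\<integral>x. \<integral>y. a x * b y * k (x, y) \<partial>M2 \<partial>M1) = 1 / \<sigma>"
    using 2 by (simp cong: Bochner_Integration.integral_cong add: M1.prob_space)
  ultimately have "\<sigma> = 1" using \<sigma> by (simp add: field_simps)
  with 1 2 a b show thesis by (intro that[of a b]) auto
qed

end

section \<open>The optimal plan\<close>

lemma ln_ratio_bound:
  fixes D p :: real
  assumes "0 \<le> D" "0 < p"
  shows "0 \<le> D * ln D - D * ln p - D + p" "D * ln D - D * ln p - D + p = 0 \<longleftrightarrow> D = p"
proof -
  have "0 \<le> D * ln D - D * ln p - D + p \<and> (D * ln D - D * ln p - D + p = 0 \<longleftrightarrow> D = p)"
  proof (cases "D = 0")
    case False
    then have D: "D > 0" using assms by simp
    have eq: "D * ln D - D * ln p - D + p = D * (p / D - 1 - ln (p / D))"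
      using D assms by (simp add: ln_div field_simps)
    have "ln (p / D) \<le> p / D - 1" using D assms by (intro ln_le_minus_one) simp
    moreover have "ln (p / D) = p / D - 1 \<longleftrightarrow> p / D = 1"
      using D assms ln_eq_minus_one[of "p / D"] by auto
    ultimately show ?thesis using D unfolding eq by (auto simp: zero_le_mult_iff)
  qed (use assms in auto)
  then show "0 \<le> D * ln D - D * ln p - D + p" "D * ln D - D * ln p - D + p = 0 \<longleftrightarrow> D = p"
    by auto
qed

text \<open>The correction \<open>p x - D x\<close> integrates to zero and makes the integrand
  nonnegative at each point. If the two integrals agree, the integrand vanishes almost everywhere,
  which is the source of uniqueness.\<close>

lemma gibbs_inequality:
  fixes D p :: "'a \<Rightarrow> real"
  assumes int: "integrable M D" "integrable M p" "integrable M (\<lambda>x. D x * ln (D x))"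
      "integrable M (\<lambda>x. D x * ln (p x))"
    and pos: "\<And>x. x \<in> space M \<Longrightarrow> 0 \<le> D x" "\<And>x. x \<in> space M \<Longrightarrow> 0 < p x"
    and eq: "(\<integral>x. D x \<partial>M) = (\<integral>x. p x \<partial>M)"
  shows "(\<integral>x. D x * ln (p x) \<partial>M) \<le> (\<integral>x. D x * ln (D x) \<partial>M)"
    "(\<integral>x. D x * ln (p x) \<partial>M) = (\<integral>x. D x * ln (D x) \<partial>M) \<Longrightarrow> AE x in M. D x = p x"
proof -
  let ?h = "\<lambda>x. D x * ln (D x) - D x * ln (p x) - D x + p x"
  have h: "integrable M ?h" using int by simp
  have h0: "AE x in M. 0 \<le> ?h x" using ln_ratio_bound(1) pos by auto
  have I: "(\<integral>x. ?h x \<partial>M) = (\<integral>x. D x * ln (D x) \<partial>M) - (\<integral>x. D x * ln (p x) \<partial>M)"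
    using int eq by simp
  show "(\<integral>x. D x * ln (p x) \<partial>M) \<le> (\<integral>x. D x * ln (D x) \<partial>M)"
    using integral_nonneg_AE[OF h0] I by simp
  assume "(\<integral>x. D x * ln (p x) \<partial>M) = (\<integral>x. D x * ln (D x) \<partial>M)"
  then have "AE x in M. ?h x = 0"
    using integral_nonneg_eq_0_iff_AE[OF h h0] I by simp
  then show "AE x in M. D x = p x"
    using AE_space by eventually_elim (use ln_ratio_bound(2) pos in auto)
qed

lemma coupling_prob_space:
  assumes "prob_space P" "\<pi> \<in> couplings P Q"
  shows "prob_space \<pi>"
proof -
  have \<pi>: "sets \<pi> = sets (P \<Otimes>\<^sub>M Q)" "distr \<pi> P fst = P" using assms(2) by (auto simp: couplings_def)
  have "fst \<in> \<pi> \<rightarrow>\<^sub>M P" using measurable_cong_sets[OF \<pi>(1) refl] by auto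
  then show ?thesis using assms(1) \<pi>(2) prob_space_distrD by metis
qed

locale entropic_transport = pair_prob_space M1 M2
  for M1 :: "'a measure" and M2 :: "'b measure" +
  fixes c :: "'a \<times> 'b \<Rightarrow> real" and \<epsilon> :: real
  assumes c_measurable [measurable]: "c \<in> borel_measurable (M1 \<Otimes>\<^sub>M M2)"
    and c_bounded: "AE z in M1 \<Otimes>\<^sub>M M2. \<bar>c z\<bar> \<le> 1" and \<epsilon>_pos: "0 < \<epsilon>"
begin

abbreviation "R \<equiv> M1 \<Otimes>\<^sub>M M2"

text \<open>On couplings the integrals of \<open>u\<close> and \<open>v\<close> depend only on the
  marginals. Solving the equation for \<open>ln p\<close> for the cost therefore rewrites the
  objective as \<epsilon> times the divergence of \<open>D\<close> from \<open>p\<close>, plus a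
  constant common to all couplings.\<close>

lemma eot_objective_eq:
  fixes u :: "'a \<Rightarrow> real" and v :: "'b \<Rightarrow> real"
  assumes \<pi>: "\<pi> \<in> couplings M1 M2" and D [measurable]: "D \<in> borel_measurable R" "\<And>z. 0 \<le> D z"
    and \<pi>_eq: "\<pi> = density R (\<lambda>z. ennreal (D z))"
    and int: "integrable R (\<lambda>z. D z * ln (D z))"
    and u [measurable]: "u \<in> borel_measurable M1" and u_bd: "\<forall>x\<in>space M1. \<bar>u x\<bar> \<le> B"
    and v [measurable]: "v \<in> borel_measurable M2" and v_bd: "\<forall>y\<in>space M2. \<bar>v y\<bar> \<le> B"
    and p [measurable]: "p \<in> borel_measurable R"
    and p_eq: "AE z in R. ln (p z) = u (fst z) + v (snd z) - c z / \<epsilon>"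
  shows "eot_objective c \<epsilon> M1 M2 \<pi> =
      ereal (\<epsilon> * ((\<integral>z. D z * ln (D z) \<partial>R) - (\<integral>z. D z * ln (p z) \<partial>R)
        + (\<integral>x. u x \<partial>M1) + (\<integral>y. v y \<partial>M2)))"
    "integrable R (\<lambda>z. D z * ln (p z))"
proof -
  interpret \<pi>: prob_space \<pi> using M1.prob_space_axioms \<pi> by (rule coupling_prob_space)
  have sets_\<pi> [measurable_cong]: "sets \<pi> = sets R" by (simp add: \<pi>_eq)
  have space_\<pi>: "space \<pi> = space R" by (simp add: \<pi>_eq)
  have ac: "absolutely_continuous R \<pi>"
    unfolding \<pi>_eq by (intro absolutely_continuousI_density) measurable
  have AE_\<pi>: "AE z in \<pi>. Q z" if "AE z in R. Q z" for Q
    using absolutely_continuous_AE[OF sets_\<pi> ac that] .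
  have RN: "AE z in R. ennreal (D z) = RN_deriv R \<pi> z"
    by (intro RN_deriv_unique) (auto simp: \<pi>_eq)
  \<comment> \<open>The Radon-Nikodym derivative agrees with \<open>D\<close> up to an
    \<open>R\<close>-null set; absolute continuity makes it a \<pi>-null set, and the entropy is
    integrated against \<pi>.\<close>
  have ed: "AE z in \<pi>. entropy_density (exp 1) R \<pi> z = ln (D z)"
    using AE_\<pi>[OF RN] by eventually_elim (auto simp: entropy_density_def log_def D(2) dest: sym)
  have ed_meas [measurable]: "entropy_density (exp 1) R \<pi> \<in> borel_measurable \<pi>"
    using measurable_entropy_density[of "exp 1" R \<pi>] measurable_cong_sets[OF sets_\<pi> refl] by blast
  have ln_int: "integrable \<pi> (\<lambda>z. ln (D z))"
    unfolding \<pi>_eq using int D by (subst integrable_density) auto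
  have "integrable \<pi> (entropy_density (exp 1) R \<pi>)"
    using ln_int by (subst integrable_cong_AE[OF _ _ ed]) auto
  moreover have "KL_divergence (exp 1) R \<pi> = (\<integral>z. ln (D z) \<partial>\<pi>)"
    unfolding KL_divergence_def using ed by (intro integral_cong_AE) auto
  moreover have "(\<integral>z. ln (D z) \<partial>\<pi>) = (\<integral>z. D z * ln (D z) \<partial>R)"
    unfolding \<pi>_eq using D by (subst integral_density) auto
  ultimately have KL: "KL \<pi> R = ereal (\<integral>z. D z * ln (D z) \<partial>R)"
    using ac by (simp add: KL_def)
  have fst_\<pi> [measurable]: "fst \<in> \<pi> \<rightarrow>\<^sub>M M1" and snd_\<pi> [measurable]: "snd \<in> \<pi> \<rightarrow>\<^sub>M M2"
    using measurable_cong_sets[OF sets_\<pi> refl] by auto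
  have marg: "distr \<pi> M1 fst = M1" "distr \<pi> M2 snd = M2" using \<pi> by (auto simp: couplings_def)
  have iu: "integrable \<pi> (\<lambda>z. u (fst z))"
    using u_bd by (intro \<pi>.integrable_bounded[of _ B]) (auto simp: space_\<pi> space_pair_measure)
  have iv: "integrable \<pi> (\<lambda>z. v (snd z))"
    using v_bd by (intro \<pi>.integrable_bounded[of _ B]) (auto simp: space_\<pi> space_pair_measure)
  have ic: "integrable \<pi> c"
    using AE_\<pi>[OF c_bounded] by (intro \<pi>.integrable_const_bound[of _ 1]) auto
  have Iu: "(\<integral>z. u (fst z) \<partial>\<pi>) = (\<integral>x. u x \<partial>M1)"
    using integral_distr[OF fst_\<pi>, of u] by (simp add: marg)
  have Iv: "(\<integral>z. v (snd z) \<partial>\<pi>) = (\<integral>y. v y \<partial>M2)"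
    using integral_distr[OF snd_\<pi>, of v] by (simp add: marg)
  have lnp: "integrable \<pi> (\<lambda>z. ln (p z))"
    using AE_\<pi>[OF p_eq] iu iv ic
    by (subst integrable_cong_AE[where g = "\<lambda>z. u (fst z) + v (snd z) - c z / \<epsilon>"]) auto
  then show "integrable R (\<lambda>z. D z * ln (p z))"
    unfolding \<pi>_eq using D by (subst (asm) integrable_density) auto
  have "(\<integral>z. D z * ln (p z) \<partial>R) = (\<integral>z. ln (p z) \<partial>\<pi>)"
    unfolding \<pi>_eq using D by (subst integral_density) auto
  also have "\<dots> = (\<integral>z. u (fst z) + v (snd z) - c z / \<epsilon> \<partial>\<pi>)"
    using AE_\<pi>[OF p_eq] by (intro integral_cong_AE) auto
  also have "\<dots> = (\<integral>x. u x \<partial>M1) + (\<integral>y. v y \<partial>M2) - (\<integral>z. c z \<partial>\<pi>) / \<epsilon>"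
    using iu iv ic by (simp add: Iu Iv)
  finally have "(\<integral>z. c z \<partial>\<pi>) = \<epsilon> * ((\<integral>x. u x \<partial>M1) + (\<integral>y. v y \<partial>M2) - (\<integral>z. D z * ln (p z) \<partial>R))"
    using \<epsilon>_pos by (simp add: field_simps)
  then show "eot_objective c \<epsilon> M1 M2 \<pi> =
      ereal (\<epsilon> * ((\<integral>z. D z * ln (D z) \<partial>R) - (\<integral>z. D z * ln (p z) \<partial>R)
        + (\<integral>x. u x \<partial>M1) + (\<integral>y. v y \<partial>M2)))"
    unfolding eot_objective_def KL by (simp add: algebra_simps)
qed

lemma density_in_couplings:
  assumes p [measurable]: "p \<in> borel_measurable R" and p0: "\<And>z. z \<in> space R \<Longrightarrow> 0 \<le> p z"
    and int1: "\<And>x. x \<in> space M1 \<Longrightarrow> integrable M2 (\<lambda>y. p (x, y))"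
    and int2: "\<And>y. y \<in> space M2 \<Longrightarrow> integrable M1 (\<lambda>x. p (x, y))"
    and marg1: "\<And>x. x \<in> space M1 \<Longrightarrow> (\<integral>y. p (x, y) \<partial>M2) = 1"
    and marg2: "\<And>y. y \<in> space M2 \<Longrightarrow> (\<integral>x. p (x, y) \<partial>M1) = 1"
  shows "density R (\<lambda>z. ennreal (p z)) \<in> couplings M1 M2"
proof -
  let ?\<pi> = "density R (\<lambda>z. ennreal (p z))"
  have nn1: "(\<integral>\<^sup>+y. ennreal (p (x, y)) \<partial>M2) = 1" if "x \<in> space M1" for x
    using that p0 marg1 int1 by (subst nn_integral_eq_integral) (auto simp: space_pair_measure)
  have nn2: "(\<integral>\<^sup>+x. ennreal (p (x, y)) \<partial>M1) = 1" if "y \<in> space M2" for y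
    using that p0 marg2 int2 by (subst nn_integral_eq_integral) (auto simp: space_pair_measure)
  have "distr ?\<pi> M1 fst = M1"
  proof (rule measure_eqI)
    fix A assume "A \<in> sets (distr ?\<pi> M1 fst)"
    then have A [measurable]: "A \<in> sets M1" by simp
    have "emeasure (distr ?\<pi> M1 fst) A = (\<integral>\<^sup>+z. ennreal (p z) * indicator A (fst z) \<partial>R)"
      by (subst emeasure_distr, simp_all, subst emeasure_density)
        (auto intro!: nn_integral_cong simp: indicator_def)
    also have "\<dots> = (\<integral>\<^sup>+x. \<integral>\<^sup>+y. ennreal (p (x, y)) * indicator A x \<partial>M2 \<partial>M1)"
      by (subst M2.nn_integral_fst[symmetric]) auto
    also have "\<dots> = (\<integral>\<^sup>+x. indicator A x \<partial>M1)"
      by (intro nn_integral_cong) (simp add: nn_integral_multc nn1)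
    finally show "emeasure (distr ?\<pi> M1 fst) A = emeasure M1 A" by simp
  qed simp
  moreover have "distr ?\<pi> M2 snd = M2"
  proof (rule measure_eqI)
    fix A assume "A \<in> sets (distr ?\<pi> M2 snd)"
    then have A [measurable]: "A \<in> sets M2" by simp
    have "emeasure (distr ?\<pi> M2 snd) A = (\<integral>\<^sup>+z. ennreal (p z) * indicator A (snd z) \<partial>R)"
      by (subst emeasure_distr, simp_all, subst emeasure_density)
        (auto intro!: nn_integral_cong simp: indicator_def)
    also have "\<dots> = (\<integral>\<^sup>+y. \<integral>\<^sup>+x. ennreal (p (x, y)) * indicator A y \<partial>M1 \<partial>M2)"
      by (subst nn_integral_snd[symmetric]) auto
    also have "\<dots> = (\<integral>\<^sup>+y. indicator A y \<partial>M2)"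
      by (intro nn_integral_cong) (simp add: nn_integral_multc nn2)
    finally show "emeasure (distr ?\<pi> M2 snd) A = emeasure M2 A" by simp
  qed simp
  ultimately show ?thesis by (simp add: couplings_def)
qed

text \<open>Gibbs form and exact marginals characterise the minimiser: the excess of any competitor
  of finite entropy is \<epsilon> times its divergence from \<open>p\<close>. The equality case of
  Gibbs' inequality gives uniqueness, so the definite description in \<open>eot_plan\<close>
  denotes.\<close>

lemma eot_plan_eq_density:
  assumes u [measurable]: "u \<in> borel_measurable M1" and u_bd: "\<And>x. x \<in> space M1 \<Longrightarrow> \<bar>u x\<bar> \<le> B"
    and v [measurable]: "v \<in> borel_measurable M2" and v_bd: "\<And>y. y \<in> space M2 \<Longrightarrow> \<bar>v y\<bar> \<le> B"
    and p [measurable]: "p \<in> borel_measurable R"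
    and p_eq: "AE z in R. ln (p z) = u (fst z) + v (snd z) - c z / \<epsilon>"
    and p_pos: "\<And>z. z \<in> space R \<Longrightarrow> 0 < p z" and p_bd: "\<And>z. z \<in> space R \<Longrightarrow> p z \<le> K"
    and marg1: "\<And>x. x \<in> space M1 \<Longrightarrow> (\<integral>y. p (x, y) \<partial>M2) = 1"
    and marg2: "\<And>y. y \<in> space M2 \<Longrightarrow> (\<integral>x. p (x, y) \<partial>M1) = 1"
  shows "eot_plan c \<epsilon> M1 M2 = density R (\<lambda>z. ennreal (p z))"
proof -
  define \<rho> where "\<rho> = density R (\<lambda>z. ennreal (p z))"
  \<comment> \<open>\<open>eot_objective_eq\<close> asks for nonnegativity at all arguments, while
    \<open>p\<close> is known to be positive only on the space.\<close>
  define q where "q = (\<lambda>z. max 0 (p z))"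
  have q_meas [measurable]: "q \<in> borel_measurable R" unfolding q_def by measurable
  have qp: "q z = p z" if "z \<in> space R" for z using p_pos[OF that] by (simp add: q_def)
  have \<rho>_q: "\<rho> = density R (\<lambda>z. ennreal (q z))"
    unfolding \<rho>_def by (intro density_cong) (auto simp: qp)
  have sec1: "integrable M2 (\<lambda>y. p (x, y))" if "x \<in> space M1" for x
    using that p_pos p_bd
    by (intro M2.integrable_bounded[of _ K]) (auto simp: space_pair_measure abs_of_pos)
  have sec2: "integrable M1 (\<lambda>x. p (x, y))" if "y \<in> space M2" for y
    using that p_pos p_bd
    by (intro M1.integrable_bounded[of _ K]) (auto simp: space_pair_measure abs_of_pos)
  have \<rho>: "\<rho> \<in> couplings M1 M2"
    unfolding \<rho>_def using p p_pos sec1 sec2 marg1 marg2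
    by (intro density_in_couplings) (auto intro: less_imp_le)
  have ip: "integrable R p" using p_pos p_bd by (intro P.integrable_bounded[of _ K]) (auto simp: abs_of_pos)
  have lnp_bd: "AE z in R. \<bar>ln (p z)\<bar> \<le> 2 * B + 1 / \<epsilon>"
    using p_eq c_bounded AE_space
  proof eventually_elim
    case (elim z)
    then have "\<bar>u (fst z)\<bar> \<le> B" "\<bar>v (snd z)\<bar> \<le> B" using u_bd v_bd by (auto simp: space_pair_measure)
    moreover have "\<bar>c z / \<epsilon>\<bar> \<le> 1 / \<epsilon>" using elim(2) \<epsilon>_pos by (simp add: abs_divide divide_right_mono)
    ultimately show ?case unfolding elim(1) by linarith
  qed
  have "integrable R (\<lambda>z. q z * ln (q z))"
  proof (rule P.integrable_const_bound)
    show "AE z in R. norm (q z * ln (q z)) \<le> K * (2 * B + 1 / \<epsilon>)"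
      using lnp_bd AE_space
    proof eventually_elim
      case (elim z)
      then show ?case unfolding qp[OF elim(2)] real_norm_def abs_mult
        using p_pos[OF elim(2)] p_bd[OF elim(2)] by (intro mult_mono) auto
    qed
  qed measurable
  have u_bd': "\<forall>x\<in>space M1. \<bar>u x\<bar> \<le> B" and v_bd': "\<forall>y\<in>space M2. \<bar>v y\<bar> \<le> B"
    using u_bd v_bd by auto
  note obj_eq = eot_objective_eq[OF _ _ _ _ _ u u_bd' v v_bd' p p_eq]
  define E where "E = \<epsilon> * ((\<integral>x. u x \<partial>M1) + (\<integral>y. v y \<partial>M2))"
  have "(\<integral>z. q z * ln (q z) \<partial>R) = (\<integral>z. q z * ln (p z) \<partial>R)"
    by (intro Bochner_Integration.integral_cong) (auto simp: qp)
  then have obj_\<rho>: "eot_objective c \<epsilon> M1 M2 \<rho> = ereal E"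
    using obj_eq(1)[OF \<rho> q_meas _ \<rho>_q] \<open>integrable R (\<lambda>z. q z * ln (q z))\<close>
    by (simp add: q_def E_def)
  have other: "ereal E \<le> eot_objective c \<epsilon> M1 M2 \<pi>"
    "eot_objective c \<epsilon> M1 M2 \<pi> = ereal E \<Longrightarrow> \<pi> = \<rho>" if \<pi>: "\<pi> \<in> couplings M1 M2" for \<pi>
  proof -
    have "ereal E \<le> eot_objective c \<epsilon> M1 M2 \<pi> \<and> (eot_objective c \<epsilon> M1 M2 \<pi> = ereal E \<longrightarrow> \<pi> = \<rho>)"
    proof (cases "absolutely_continuous R \<pi> \<and> integrable \<pi> (entropy_density (exp 1) R \<pi>)")
      case False
      then have "KL \<pi> R = \<infinity>" unfolding KL_def by simp
      then have "eot_objective c \<epsilon> M1 M2 \<pi> = \<infinity>"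
        using \<epsilon>_pos by (simp add: eot_objective_def)
      then show ?thesis by simp
    next
      case True
      interpret \<pi>: prob_space \<pi> using M1.prob_space_axioms \<pi> by (rule coupling_prob_space)
      have sets_\<pi>: "sets \<pi> = sets R" using \<pi> by (simp add: couplings_def)
      define D where "D = (\<lambda>z. enn2real (RN_deriv R \<pi> z))"
      have D [measurable]: "D \<in> borel_measurable R" unfolding D_def by measurable
      have D0: "0 \<le> D z" for z by (simp add: D_def)
      have dens: "density R (RN_deriv R \<pi>) = \<pi>"
        using True sets_\<pi> by (intro density_RN_deriv) auto
      have "AE z in R. RN_deriv R \<pi> z \<noteq> \<infinity>"
        using True sets_\<pi> \<pi>.sigma_finite_measure_axioms by (intro RN_deriv_finite) auto
      then have RN: "AE z in R. RN_deriv R \<pi> z = ennreal (D z)"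
        by eventually_elim (auto simp: D_def less_top)
      have \<pi>_eq: "\<pi> = density R (\<lambda>z. ennreal (D z))"
        using RN by (subst dens[symmetric], intro density_cong) auto
      have "integrable \<pi> (\<lambda>z. ln (D z))"
        using True by (simp add: entropy_density_def comp_def D_def log_def)
      then have DlnD: "integrable R (\<lambda>z. D z * ln (D z))"
        unfolding \<pi>_eq using D0 by (subst (asm) integrable_density) auto
      note obj = obj_eq[OF \<pi> D D0 \<pi>_eq DlnD]
      have "(\<integral>\<^sup>+z. ennreal (D z) \<partial>R) = emeasure \<pi> (space \<pi>)"
        by (subst (1 2) \<pi>_eq, subst emeasure_density) (auto intro!: nn_integral_cong)
      then have nnD: "(\<integral>\<^sup>+z. ennreal (D z) \<partial>R) = ennreal 1" by (simp add: \<pi>.emeasure_space_1)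
      have iD: "integrable R D" "(\<integral>z. D z \<partial>R) = 1"
        using D0 nnD by (auto intro!: integrableI_nn_integral_finite[where x = 1] integral_eq_nn_integral
            simp: integral_eq_nn_integral)
      have "(\<integral>z. p z \<partial>R) = (\<integral>x. \<integral>y. p (x, y) \<partial>M2 \<partial>M1)"
        using ip by (rule integral_fst'[symmetric])
      also have "\<dots> = 1" using marg1 by (simp cong: Bochner_Integration.integral_cong add: M1.prob_space)
      finally have "(\<integral>z. D z \<partial>R) = (\<integral>z. p z \<partial>R)" using iD by simp
      note gibbs = gibbs_inequality[OF iD(1) ip DlnD obj(2) D0 p_pos this]
      have obj_\<pi>: "eot_objective c \<epsilon> M1 M2 \<pi> =
          ereal (\<epsilon> * ((\<integral>z. D z * ln (D z) \<partial>R) - (\<integral>z. D z * ln (p z) \<partial>R)) + E)"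
        using obj(1) by (simp add: E_def algebra_simps)
      have "ereal E \<le> eot_objective c \<epsilon> M1 M2 \<pi>"
        unfolding obj_\<pi> using gibbs(1) \<epsilon>_pos by simp
      moreover have "\<pi> = \<rho>" if "eot_objective c \<epsilon> M1 M2 \<pi> = ereal E"
      proof -
        have "(\<integral>z. D z * ln (p z) \<partial>R) = (\<integral>z. D z * ln (D z) \<partial>R)"
          using that \<epsilon>_pos unfolding obj_\<pi> by simp
        with gibbs(2) have "AE z in R. D z = p z" by blast
        then show ?thesis unfolding \<pi>_eq \<rho>_def by (intro density_cong) auto
      qed
      ultimately show ?thesis by blast
    qed
    then show "ereal E \<le> eot_objective c \<epsilon> M1 M2 \<pi>"
      "eot_objective c \<epsilon> M1 M2 \<pi> = ereal E \<Longrightarrow> \<pi> = \<rho>" by auto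
  qed
  have value_eq: "eot_value c \<epsilon> M1 M2 = ereal E"
    unfolding eot_value_def
  proof (rule antisym)
    show "(INF \<pi>\<in>couplings M1 M2. eot_objective c \<epsilon> M1 M2 \<pi>) \<le> ereal E"
      using INF_lower[OF \<rho>, of "eot_objective c \<epsilon> M1 M2"] unfolding obj_\<rho> .
    show "ereal E \<le> (INF \<pi>\<in>couplings M1 M2. eot_objective c \<epsilon> M1 M2 \<pi>)"
      using other(1) by (rule INF_greatest)
  qed
  have "eot_plan c \<epsilon> M1 M2 = \<rho>"
    unfolding eot_plan_def value_eq
  proof (rule the_equality)
    show "\<rho> \<in> couplings M1 M2 \<and> eot_objective c \<epsilon> M1 M2 \<rho> = ereal E" using \<rho> obj_\<rho> by blast
    show "\<pi> = \<rho>" if "\<pi> \<in> couplings M1 M2 \<and> eot_objective c \<epsilon> M1 M2 \<pi> = ereal E" for \<pi>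
      using other(2) that by blast
  qed
  then show ?thesis by (simp add: \<rho>_def)
qed

end

text \<open>Truncating the cost at level 1 changes it only on a null set, and makes the kernel bounded everywhere.\<close>

definition gibbs :: "('a \<Rightarrow> real) \<Rightarrow> real \<Rightarrow> 'a \<Rightarrow> real" where
  "gibbs c \<epsilon> z = exp (- max (- 1) (min 1 (c z)) / \<epsilon>)"

text \<open>The potentials are the logarithms of the Schroedinger scalings, and their bounds are the
  logarithms of \<open>1 / m\<^sup>2\<close> and \<open>1 / m\<close> for
  \<open>m = exp (- 1 / \<epsilon>)\<close>. The marginal equations hold at every point; only the
  identification with the Radon-Nikodym derivative is up to null sets.\<close>

lemma (in entropic_transport) eot_density_form:
  obtains u v where
    "u \<in> borel_measurable M1" "\<And>x. x \<in> space M1 \<Longrightarrow> \<bar>u x\<bar> \<le> 2 / \<epsilon>"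
    "v \<in> borel_measurable M2" "\<And>y. y \<in> space M2 \<Longrightarrow> \<bar>v y\<bar> \<le> 1 / \<epsilon>"
    "\<And>x. x \<in> space M1 \<Longrightarrow> (\<integral>y. exp (u x + v y) * gibbs c \<epsilon> (x, y) \<partial>M2) = 1"
    "\<And>y. y \<in> space M2 \<Longrightarrow> (\<integral>x. exp (u x + v y) * gibbs c \<epsilon> (x, y) \<partial>M1) = 1"
    "AE z in M1 \<Otimes>\<^sub>M M2. eot_density c \<epsilon> M1 M2 z = exp (u (fst z) + v (snd z)) * gibbs c \<epsilon> z"
proof -
  define m where "m = exp (- 1 / \<epsilon>)"
  have inv_m: "1 / m = exp (1 / \<epsilon>)" by (simp add: m_def exp_minus field_simps)
  interpret bounded_kernel M1 M2 "gibbs c \<epsilon>" m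
  proof
    show "gibbs c \<epsilon> \<in> borel_measurable (M1 \<Otimes>\<^sub>M M2)" unfolding gibbs_def by measurable
    show "m \<le> gibbs c \<epsilon> z" for z using \<epsilon>_pos by (simp add: m_def gibbs_def divide_right_mono)
    have "- max (- 1) (min 1 (c z)) / \<epsilon> \<le> 1 / \<epsilon>" for z
      using \<epsilon>_pos by (intro divide_right_mono) auto
    then show "gibbs c \<epsilon> z \<le> 1 / m" for z unfolding inv_m gibbs_def by simp
  qed (simp add: m_def)
  obtain a b where ab: "normalized a" "admissible b"
    and marg: "\<And>x. x \<in> space M1 \<Longrightarrow> (\<integral>y. a x * b y * gibbs c \<epsilon> (x, y) \<partial>M2) = 1"
    "\<And>y. y \<in> space M2 \<Longrightarrow> (\<integral>x. a x * b y * gibbs c \<epsilon> (x, y) \<partial>M1) = 1"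
    using schroedinger_system by blast
  note a = normalizedD[OF ab(1)] and b = admissibleD[OF ab(2)]
  note [measurable] = a(1) b(1)
  define u where "u = (\<lambda>x. ln (a x))"
  define v where "v = (\<lambda>y. ln (b y))"
  have [measurable]: "u \<in> borel_measurable M1" "v \<in> borel_measurable M2"
    unfolding u_def v_def by measurable
  have exp_u: "exp (u x) = a x" if "x \<in> space M1" for x using a(5)[OF that] by (simp add: u_def)
  have exp_v: "exp (v y) = b y" if "y \<in> space M2" for y using b(4)[OF that] by (simp add: v_def)
  have m2: "m\<^sup>2 = exp (- 2 / \<epsilon>)" by (simp add: m_def power2_eq_square flip: exp_add)
  have "1 / m\<^sup>2 = exp (2 / \<epsilon>)" by (simp add: m2 exp_minus field_simps)
  then have u_bd: "\<bar>u x\<bar> \<le> 2 / \<epsilon>" if "x \<in> space M1" for x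
    using a(3,4)[OF that] unfolding exp_u[OF that, symmetric] m2 by (simp add: abs_le_iff)
  have v_bd: "\<bar>v y\<bar> \<le> 1 / \<epsilon>" if "y \<in> space M2" for y
    using b(2,3)[OF that] unfolding exp_v[OF that, symmetric] inv_m by (simp add: m_def abs_le_iff)
  define p where "p = (\<lambda>z. exp (u (fst z) + v (snd z)) * gibbs c \<epsilon> z)"
  have [measurable]: "p \<in> borel_measurable R" unfolding p_def by measurable
  have marg1: "(\<integral>y. p (x, y) \<partial>M2) = 1" if "x \<in> space M1" for x
    unfolding marg(1)[OF that, symmetric]
    by (intro Bochner_Integration.integral_cong) (simp_all add: p_def exp_add exp_u exp_v that)
  have marg2: "(\<integral>x. p (x, y) \<partial>M1) = 1" if "y \<in> space M2" for y
    unfolding marg(2)[OF that, symmetric]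
    by (intro Bochner_Integration.integral_cong) (simp_all add: p_def exp_add exp_u exp_v that)
  have plan: "eot_plan c \<epsilon> M1 M2 = density R (\<lambda>z. ennreal (p z))"
  proof (rule eot_plan_eq_density)
    show "AE z in R. ln (p z) = u (fst z) + v (snd z) - c z / \<epsilon>"
      using c_bounded by eventually_elim (auto simp: p_def gibbs_def ln_mult)
    show "\<bar>u x\<bar> \<le> 2 / \<epsilon>" if "x \<in> space M1" for x using u_bd[OF that] .
    show "\<bar>v y\<bar> \<le> 2 / \<epsilon>" if "y \<in> space M2" for y
      using v_bd[OF that] \<epsilon>_pos by (auto intro: order_trans divide_right_mono)
    show "0 < p z" for z by (simp add: p_def gibbs_def)
    show "p z \<le> exp (2 / \<epsilon> + 1 / \<epsilon>) * (1 / m)" if "z \<in> space R" for z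
      unfolding p_def using that u_bd[of "fst z"] v_bd[of "snd z"] k_le[of z] k_pos[of z]
      by (intro mult_mono) (auto simp: space_pair_measure abs_le_iff intro!: add_mono)
  qed (use marg1 marg2 in auto)
  have "AE z in R. ennreal (p z) = RN_deriv R (eot_plan c \<epsilon> M1 M2) z"
    unfolding plan by (intro RN_deriv_unique) auto
  then have "AE z in R. eot_density c \<epsilon> M1 M2 z = p z"
    by eventually_elim (auto simp: eot_density_def p_def gibbs_def dest!: sym)
  with u_bd v_bd marg1 marg2 show thesis
    by (intro that[of u v]) (auto simp: p_def)
qed

section \<open>Perturbation of the Schroedinger system\<close>

text \<open>The difference vanishes at 1 and has derivative
  \<open>(x - 1)\<^sup>2 / (x * (x + 1)\<^sup>2)\<close>.\<close>

lemma ln_ge_ratio: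
  fixes t :: real
  assumes "1 \<le> t"
  shows "2 * (t - 1) / (t + 1) \<le> ln t"
proof -
  let ?f = "\<lambda>t::real. ln t - 2 * (t - 1) / (t + 1)"
  have "?f 1 \<le> ?f t"
  proof (rule DERIV_nonneg_imp_nondecreasing[OF assms])
    fix x :: real assume x: "1 \<le> x" "x \<le> t"
    have "(?f has_real_derivative (1 / x - 4 / (x + 1)\<^sup>2)) (at x)"
      using x by (auto intro!: derivative_eq_intros simp: power2_eq_square)
    moreover have "0 \<le> 1 / x - 4 / (x + 1)\<^sup>2"
    proof -
      have "0 \<le> (x - 1)\<^sup>2" by simp
      then have "4 * x \<le> (x + 1)\<^sup>2" by (simp add: power2_eq_square algebra_simps)
      then show ?thesis using x by (simp add: field_simps)
    qed
    ultimately show "\<exists>y. (?f has_real_derivative y) (at x) \<and> 0 \<le> y" by blast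
  qed
  then show ?thesis by simp
qed

text \<open>The logarithmic mean is at most the arithmetic mean, multiplied out so that
  \<open>a = b\<close> is no exception.\<close>

lemma square_diff_le_ln_diff:
  fixes a b :: real
  assumes "0 < a" "0 < b"
  shows "2 * (a - b)\<^sup>2 / (a + b) \<le> (a - b) * (ln a - ln b)"
proof -
  have *: "2 * (a - b)\<^sup>2 / (a + b) \<le> (a - b) * (ln a - ln b)" if "0 < b" "b \<le> a" for a b :: real
  proof -
    have "2 * (a / b - 1) / (a / b + 1) \<le> ln (a / b)" using that by (intro ln_ge_ratio) simp
    moreover have "a / b - 1 = (a - b) / b" "a / b + 1 = (a + b) / b" using that by (simp_all add: field_simps)
    then have "2 * (a / b - 1) / (a / b + 1) = 2 * (a - b) / (a + b)" using that by simp
    ultimately have "(a - b) * (2 * (a - b) / (a + b)) \<le> (a - b) * (ln a - ln b)"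
      using that by (intro mult_left_mono) (auto simp: ln_div)
    then show ?thesis by (simp add: power2_eq_square mult_ac)
  qed
  show ?thesis
  proof (cases "b \<le> a")
    case False
    then have "2 * (b - a)\<^sup>2 / (b + a) \<le> (b - a) * (ln b - ln a)" using *[of a b] assms by simp
    then show ?thesis by (simp add: power2_commute add.commute algebra_simps)
  qed (use * assms in simp)
qed

text \<open>A pointwise Pinsker inequality: AM-GM with weight \<open>s\<close> splits the distance
  into its square over \<open>a + b\<close> and \<open>a + b\<close> itself. Being linear in both
  terms, it can be integrated as it stands.\<close>

lemma abs_diff_le_ln_diff:
  fixes a b s :: real
  assumes "0 < a" "0 < b" "0 < s"
  shows "\<bar>a - b\<bar> \<le> s / 4 * ((a - b) * (ln a - ln b)) + (a + b) / (2 * s)"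
proof -
  define w where "w = a + b"
  define t where "t = \<bar>a - b\<bar>"
  have w: "0 < w" using assms by (simp add: w_def)
  have "0 \<le> (s * t - w)\<^sup>2 / (2 * s * w)" using assms w by simp
  also have "\<dots> = s / 2 * (t\<^sup>2 / w) - t + w / (2 * s)"
    using assms w by (simp add: field_simps power2_eq_square)
  finally have "t \<le> s / 4 * (2 * t\<^sup>2 / w) + w / (2 * s)" by simp
  then have "\<bar>a - b\<bar> \<le> s / 4 * (2 * (a - b)\<^sup>2 / (a + b)) + (a + b) / (2 * s)"
    by (simp add: t_def w_def)
  also have "\<dots> \<le> s / 4 * ((a - b) * (ln a - ln b)) + (a + b) / (2 * s)"
    using square_diff_le_ln_diff[OF assms(1,2)] assms(3) by (intro add_right_mono mult_left_mono) auto
  finally show ?thesis .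
qed

text \<open>Exact marginals are available for \<open>q\<close> alone: \<open>p\<close> is a coupling
  density for the population and not for the sample, so its defects and its mass stay in the bound.
  The weight \<open>s\<close> is left free, to be balanced against their expectations.\<close>

lemma (in pair_prob_space) density_perturbation:
  fixes p q :: "'a \<times> 'b \<Rightarrow> real"
  assumes p [measurable]: "p \<in> borel_measurable (M1 \<Otimes>\<^sub>M M2)" and p_bd: "\<And>z. z \<in> space (M1 \<Otimes>\<^sub>M M2) \<Longrightarrow> 0 < p z \<and> p z \<le> K"
    and q [measurable]: "q \<in> borel_measurable (M1 \<Otimes>\<^sub>M M2)" and q_bd: "\<And>z. z \<in> space (M1 \<Otimes>\<^sub>M M2) \<Longrightarrow> 0 < q z \<and> q z \<le> K"
    and marg: "\<And>x. x \<in> space M1 \<Longrightarrow> (\<integral>y. q (x, y) \<partial>M2) = 1" "\<And>y. y \<in> space M2 \<Longrightarrow> (\<integral>x. q (x, y) \<partial>M1) = 1"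
    and u [measurable]: "u \<in> borel_measurable M1" and u_bd: "\<And>x. x \<in> space M1 \<Longrightarrow> \<bar>u x\<bar> \<le> A"
    and v [measurable]: "v \<in> borel_measurable M2" and v_bd: "\<And>y. y \<in> space M2 \<Longrightarrow> \<bar>v y\<bar> \<le> B"
    and ln_eq: "\<And>z. z \<in> space (M1 \<Otimes>\<^sub>M M2) \<Longrightarrow> ln (q z) - ln (p z) = u (fst z) + v (snd z)"
    and s: "0 < s"
  shows "(\<integral>z. \<bar>q z - p z\<bar> \<partial>(M1 \<Otimes>\<^sub>M M2)) \<le>
    s / 4 * (A * (\<integral>x. \<bar>1 - (\<integral>y. p (x, y) \<partial>M2)\<bar> \<partial>M1) + B * (\<integral>y. \<bar>1 - (\<integral>x. p (x, y) \<partial>M1)\<bar> \<partial>M2))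
      + (1 + (\<integral>z. p z \<partial>(M1 \<Otimes>\<^sub>M M2))) / (2 * s)"
proof -
  let ?R = "M1 \<Otimes>\<^sub>M M2"
  have abs_bd: "\<bar>p z\<bar> \<le> K" "\<bar>q z\<bar> \<le> K" if "z \<in> space ?R" for z
    using p_bd[OF that] q_bd[OF that] by simp_all
  have ip: "integrable ?R p" and iq: "integrable ?R q"
    using P.integrable_bounded[OF p abs_bd(1)] P.integrable_bounded[OF q abs_bd(2)] by auto
  have sec: "integrable M2 (\<lambda>y. p (x, y))" "integrable M2 (\<lambda>y. q (x, y))" if "x \<in> space M1" for x
    using that abs_bd by (auto intro!: M2.integrable_bounded[of _ K] simp: space_pair_measure)
  have sec': "integrable M1 (\<lambda>x. p (x, y))" "integrable M1 (\<lambda>x. q (x, y))" if "y \<in> space M2" for y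
    using that abs_bd by (auto intro!: M1.integrable_bounded[of _ K] simp: space_pair_measure)
  have iu: "integrable ?R (\<lambda>z. (q z - p z) * u (fst z))" and iv: "integrable ?R (\<lambda>z. (q z - p z) * v (snd z))"
  proof -
    have bd: "\<bar>q z - p z\<bar> * \<bar>u (fst z)\<bar> \<le> K * A" "\<bar>q z - p z\<bar> * \<bar>v (snd z)\<bar> \<le> K * B" if z: "z \<in> space ?R" for z
    proof -
      have "\<bar>u (fst z)\<bar> \<le> A" "\<bar>v (snd z)\<bar> \<le> B" using z u_bd v_bd by (auto simp: space_pair_measure)
      moreover have "\<bar>q z - p z\<bar> \<le> K" "0 \<le> K" using p_bd[OF z] q_bd[OF z] by linarith+
      ultimately show "\<bar>q z - p z\<bar> * \<bar>u (fst z)\<bar> \<le> K * A" "\<bar>q z - p z\<bar> * \<bar>v (snd z)\<bar> \<le> K * B"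
        by (intro mult_mono; simp)+
    qed
    show "integrable ?R (\<lambda>z. (q z - p z) * u (fst z))"
      using bd(1) by (intro P.integrable_bounded[of _ "K * A"]) (simp_all add: abs_mult)
    show "integrable ?R (\<lambda>z. (q z - p z) * v (snd z))"
      using bd(2) by (intro P.integrable_bounded[of _ "K * B"]) (simp_all add: abs_mult)
  qed
  have abs1: "integrable M1 (\<lambda>x. \<bar>1 - (\<integral>y. p (x, y) \<partial>M2)\<bar>)"
    using integrable_fst'[OF ip] by (intro integrable_abs Bochner_Integration.integrable_diff) auto
  have abs2: "integrable M2 (\<lambda>y. \<bar>1 - (\<integral>x. p (x, y) \<partial>M1)\<bar>)"
    using integrable_snd[of "\<lambda>x y. p (x, y)"] ip
    by (intro integrable_abs Bochner_Integration.integrable_diff) auto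
  have U: "(\<integral>z. (q z - p z) * u (fst z) \<partial>?R) \<le> A * (\<integral>x. \<bar>1 - (\<integral>y. p (x, y) \<partial>M2)\<bar> \<partial>M1)"
  proof -
    have "(\<integral>z. (q z - p z) * u (fst z) \<partial>?R) = (\<integral>x. \<integral>y. (q (x, y) - p (x, y)) * u x \<partial>M2 \<partial>M1)"
      using integral_fst'[OF iu] by simp
    also have "\<dots> = (\<integral>x. u x * (1 - (\<integral>y. p (x, y) \<partial>M2)) \<partial>M1)"
      using sec marg(1) by (intro Bochner_Integration.integral_cong) simp_all
    also have "\<dots> \<le> (\<integral>x. A * \<bar>1 - (\<integral>y. p (x, y) \<partial>M2)\<bar> \<partial>M1)"
    proof (rule integral_mono')
      fix x assume x: "x \<in> space M1"
      have "u x * (1 - (\<integral>y. p (x, y) \<partial>M2)) \<le> \<bar>u x\<bar> * \<bar>1 - (\<integral>y. p (x, y) \<partial>M2)\<bar>"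
        by (simp flip: abs_mult)
      also have "\<dots> \<le> A * \<bar>1 - (\<integral>y. p (x, y) \<partial>M2)\<bar>" using u_bd[OF x] by (rule mult_right_mono) simp
      finally show "u x * (1 - (\<integral>y. p (x, y) \<partial>M2)) \<le> A * \<bar>1 - (\<integral>y. p (x, y) \<partial>M2)\<bar>" .
      show "0 \<le> A * \<bar>1 - (\<integral>y. p (x, y) \<partial>M2)\<bar>" using order_trans[OF abs_ge_zero u_bd[OF x]] by simp
    qed (use abs1 in simp)
    finally show ?thesis by simp
  qed
  have V: "(\<integral>z. (q z - p z) * v (snd z) \<partial>?R) \<le> B * (\<integral>y. \<bar>1 - (\<integral>x. p (x, y) \<partial>M1)\<bar> \<partial>M2)"
  proof -
    have "(\<integral>z. (q z - p z) * v (snd z) \<partial>?R) = (\<integral>y. \<integral>x. (q (x, y) - p (x, y)) * v y \<partial>M1 \<partial>M2)"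
      using integral_snd[of "\<lambda>x y. (q (x, y) - p (x, y)) * v y"] iv by (simp add: case_prod_unfold)
    also have "\<dots> = (\<integral>y. v y * (1 - (\<integral>x. p (x, y) \<partial>M1)) \<partial>M2)"
      using sec' marg(2) by (intro Bochner_Integration.integral_cong) simp_all
    also have "\<dots> \<le> (\<integral>y. B * \<bar>1 - (\<integral>x. p (x, y) \<partial>M1)\<bar> \<partial>M2)"
    proof (rule integral_mono')
      fix y assume y: "y \<in> space M2"
      have "v y * (1 - (\<integral>x. p (x, y) \<partial>M1)) \<le> \<bar>v y\<bar> * \<bar>1 - (\<integral>x. p (x, y) \<partial>M1)\<bar>"
        by (simp flip: abs_mult)
      also have "\<dots> \<le> B * \<bar>1 - (\<integral>x. p (x, y) \<partial>M1)\<bar>" using v_bd[OF y] by (rule mult_right_mono) simp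
      finally show "v y * (1 - (\<integral>x. p (x, y) \<partial>M1)) \<le> B * \<bar>1 - (\<integral>x. p (x, y) \<partial>M1)\<bar>" .
      show "0 \<le> B * \<bar>1 - (\<integral>x. p (x, y) \<partial>M1)\<bar>" using order_trans[OF abs_ge_zero v_bd[OF y]] by simp
    qed (use abs2 in simp)
    finally show ?thesis by simp
  qed
  have "(\<integral>z. q z \<partial>?R) = (\<integral>x. \<integral>y. q (x, y) \<partial>M2 \<partial>M1)" using integral_fst'[OF iq] by simp
  also have "\<dots> = 1" using marg(1) by (simp cong: Bochner_Integration.integral_cong add: M1.prob_space)
  finally have q1: "(\<integral>z. q z \<partial>?R) = 1" .
  have "(\<integral>z. \<bar>q z - p z\<bar> \<partial>?R) \<le> (\<integral>z. s / 4 * ((q z - p z) * u (fst z) + (q z - p z) * v (snd z)) + (q z + p z) / (2 * s) \<partial>?R)"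
  proof (rule integral_mono)
    fix z assume z: "z \<in> space ?R"
    show "\<bar>q z - p z\<bar> \<le> s / 4 * ((q z - p z) * u (fst z) + (q z - p z) * v (snd z)) + (q z + p z) / (2 * s)"
      using abs_diff_le_ln_diff[of "q z" "p z" s] p_bd[OF z] q_bd[OF z] s
      unfolding ln_eq[OF z] by (simp add: distrib_left)
  qed (use ip iq iu iv in simp_all)
  also have "\<dots> = s / 4 * ((\<integral>z. (q z - p z) * u (fst z) \<partial>?R) + (\<integral>z. (q z - p z) * v (snd z) \<partial>?R))
      + (1 + (\<integral>z. p z \<partial>?R)) / (2 * s)"
    using ip iq iu iv by (simp add: q1)
  also have "\<dots> \<le> s / 4 * (A * (\<integral>x. \<bar>1 - (\<integral>y. p (x, y) \<partial>M2)\<bar> \<partial>M1)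
      + B * (\<integral>y. \<bar>1 - (\<integral>x. p (x, y) \<partial>M1)\<bar> \<partial>M2)) + (1 + (\<integral>z. p z \<partial>?R)) / (2 * s)"
    using U V s by (intro add_right_mono mult_left_mono add_mono) auto
  finally show ?thesis .
qed

section \<open>The second moment of the density\<close>

lemma (in pair_prob_space) distr_pair_snd: "distr (M1 \<Otimes>\<^sub>M M2) M2 snd = M2"
proof -
  have "distr (M1 \<Otimes>\<^sub>M M2) M2 snd = distr (M2 \<Otimes>\<^sub>M M1) M2 (snd \<circ> (\<lambda>(x, y). (y, x)))"
    by (subst distr_pair_swap, subst distr_distr) auto
  also have "snd \<circ> (\<lambda>(x, y). (y, x)) = fst" by auto
  finally show ?thesis by (simp add: M1.distr_pair_fst)
qed

lemma (in pair_prob_space) AE_fst: "AE x in M1. P x \<Longrightarrow> AE z in M1 \<Otimes>\<^sub>M M2. P (fst z)"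
  using AE_distrD[of fst "M1 \<Otimes>\<^sub>M M2" M1 P] unfolding M2.distr_pair_fst by simp

lemma (in pair_prob_space) AE_snd: "AE y in M2. P y \<Longrightarrow> AE z in M1 \<Otimes>\<^sub>M M2. P (snd z)"
  using AE_distrD[of snd "M1 \<Otimes>\<^sub>M M2" M2 P] unfolding distr_pair_snd by simp

text \<open>The numbers \<open>a\<close> and \<open>a'\<close> are reciprocals of integrals, so a
  comparison of the kernels reverses. With \<open>a = exp (u x)\<close> this bounds the oscillation
  of a potential by that of the kernel.\<close>

lemma (in prob_space) normalizer_ratio:
  fixes w K K' :: "'a \<Rightarrow> real"
  assumes int: "integrable M (\<lambda>y. w y * K y)" "integrable M (\<lambda>y. w y * K' y)"
    and w: "\<And>y. y \<in> space M \<Longrightarrow> 0 \<le> w y" and le: "AE y in M. K' y \<le> \<kappa> * K y"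
    and eq: "a * (\<integral>y. w y * K y \<partial>M) = 1" "a' * (\<integral>y. w y * K' y \<partial>M) = 1" and a: "0 < a" "0 < a'"
  shows "a \<le> \<kappa> * a'"
proof -
  have "(\<integral>y. w y * K' y \<partial>M) \<le> (\<integral>y. \<kappa> * (w y * K y) \<partial>M)"
  proof (rule integral_mono_AE)
    show "AE y in M. w y * K' y \<le> \<kappa> * (w y * K y)"
      using le AE_space
    proof eventually_elim
      case (elim y)
      then show ?case using mult_left_mono[OF elim(1) w[OF elim(2)]] by (simp add: mult_ac)
    qed
  qed (use int in simp_all)
  then have "(\<integral>y. w y * K' y \<partial>M) \<le> \<kappa> * (\<integral>y. w y * K y \<partial>M)" by simp
  moreover have "(\<integral>y. w y * K y \<partial>M) = 1 / a" "(\<integral>y. w y * K' y \<partial>M) = 1 / a'"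
    using eq a by (metis mult.commute nonzero_eq_divide_eq order_less_irrefl)+
  ultimately have "1 / a' \<le> \<kappa> * (1 / a)" by simp
  then show ?thesis using a by (simp add: field_simps)
qed

text \<open>On a cell \<open>C z\<close> the density is comparable to its average over the cell, hence at most
  \<open>\<kappa> / M1 (C z)\<close> there; the factor \<open>M1 (C z)\<close> cancels on integrating over the cell.\<close>

lemma (in pair_prob_space) integral_square_le_cover:
  fixes p :: "'a \<times> 'b \<Rightarrow> real"
  assumes p [measurable]: "p \<in> borel_measurable (M1 \<Otimes>\<^sub>M M2)"
    and p_bd: "\<And>z. z \<in> space (M1 \<Otimes>\<^sub>M M2) \<Longrightarrow> 0 \<le> p z \<and> p z \<le> K"
    and marg: "\<And>x. x \<in> space M1 \<Longrightarrow> (\<integral>y. p (x, y) \<partial>M2) = 1" "\<And>y. y \<in> space M2 \<Longrightarrow> (\<integral>x. p (x, y) \<partial>M1) = 1"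
    and S: "finite S" and C [measurable]: "\<And>z. z \<in> S \<Longrightarrow> C z \<in> sets M1"
    and G: "AE x in M1. x \<in> G1" "AE y in M2. y \<in> G2" and cover: "G1 \<subseteq> (\<Union>z\<in>S. C z)"
    and cmp: "\<And>z x x' y. z \<in> S \<Longrightarrow> x \<in> C z \<inter> G1 \<Longrightarrow> x' \<in> C z \<inter> G1 \<Longrightarrow> y \<in> G2 \<Longrightarrow> p (x, y) \<le> \<kappa> * p (x', y)"
    and \<kappa>: "0 \<le> \<kappa>"
  shows "(\<integral>z. (p z)\<^sup>2 \<partial>(M1 \<Otimes>\<^sub>M M2)) \<le> \<kappa> * card S"
proof -
  let ?R = "M1 \<Otimes>\<^sub>M M2"
  \<comment> \<open>Cells of measure zero would lead to divisions by zero below; almost no point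
    lies in them, so they are discarded.\<close>
  define S' where "S' = {z \<in> S. measure M1 (C z) > 0}"
  have S': "finite S'" "S' \<subseteq> S" using S by (auto simp: S'_def)
  have sec': "integrable M1 (\<lambda>x. p (x, y))" if "y \<in> space M2" for y
    using that p_bd by (auto intro!: M1.integrable_bounded[of _ K] simp: space_pair_measure)
  have key: "p (x, y) * measure M1 (C z) \<le> \<kappa>"
    if z: "z \<in> S" and x: "x \<in> C z" "x \<in> G1" "x \<in> space M1" and y: "y \<in> G2" "y \<in> space M2" for x y z
  proof -
    have [measurable]: "C z \<in> sets M1" using C z .
    have "(\<integral>x'. p (x, y) * indicator (C z) x' \<partial>M1) \<le> (\<integral>x'. \<kappa> * p (x', y) \<partial>M1)"
    proof (rule integral_mono_AE)
      show "integrable M1 (\<lambda>x'. p (x, y) * indicator (C z) x')"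
        by (intro integrable_mult_right integrable_real_indicator) (auto simp: M1.emeasure_eq_measure)
      show "AE x' in M1. p (x, y) * indicator (C z) x' \<le> \<kappa> * p (x', y)"
        using G(1) AE_space
      proof eventually_elim
        case (elim x')
        then show ?case using cmp[OF z, of x x' y] x y \<kappa> p_bd[of "(x', y)"]
          by (auto simp: indicator_def space_pair_measure)
      qed
    qed (use sec' y in simp)
    then show ?thesis using marg(2)[OF y(2)] by simp
  qed
  have AE1: "AE z in ?R. fst z \<in> G1" and AE2: "AE z in ?R. snd z \<in> G2"
    using G by (auto intro: AE_fst AE_snd)
  have null: "AE x in M1. \<forall>z\<in>S - S'. x \<notin> C z"
  proof (intro AE_finite_allI)
    fix z assume "z \<in> S - S'"
    then have "C z \<in> null_sets M1"
      using C M1.emeasure_eq_measure by (auto simp: S'_def null_sets_def zero_less_measure_iff)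
    then show "AE x in M1. x \<notin> C z" by (rule AE_not_in)
  qed (use S in simp)
  have AE3: "AE w in ?R. \<forall>z\<in>S - S'. fst w \<notin> C z"
    using null by (rule AE_fst)
  have pint: "integrable ?R (\<lambda>w. p w * indicator (C z) (fst w))"
    and pint_eq: "(\<integral>w. p w * indicator (C z) (fst w) \<partial>?R) = measure M1 (C z)" if z: "z \<in> S" for z
  proof -
    have [measurable]: "C z \<in> sets M1" using C z .
    show i: "integrable ?R (\<lambda>w. p w * indicator (C z) (fst w))"
      using p_bd by (intro P.integrable_bounded[of _ K]) (auto simp: indicator_def intro: order_trans)
    have "(\<integral>w. p w * indicator (C z) (fst w) \<partial>?R) = (\<integral>x. \<integral>y. p (x, y) * indicator (C z) x \<partial>M2 \<partial>M1)"
      using integral_fst'[OF i] by simp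
    also have "\<dots> = (\<integral>x. indicator (C z) x \<partial>M1)"
      using marg(1) by (intro Bochner_Integration.integral_cong) simp_all
    finally show "(\<integral>w. p w * indicator (C z) (fst w) \<partial>?R) = measure M1 (C z)" by simp
  qed
  have "(\<integral>w. (p w)\<^sup>2 \<partial>?R) \<le> (\<integral>w. (\<Sum>z\<in>S'. \<kappa> / measure M1 (C z) * (p w * indicator (C z) (fst w))) \<partial>?R)"
  proof (rule integral_mono_AE)
    show "integrable ?R (\<lambda>w. (p w)\<^sup>2)"
      using p_bd by (intro P.integrable_bounded[of _ "K\<^sup>2"]) (auto intro!: power_mono)
    show "integrable ?R (\<lambda>w. \<Sum>z\<in>S'. \<kappa> / measure M1 (C z) * (p w * indicator (C z) (fst w)))"
      using S'(2) pint by (intro Bochner_Integration.integrable_sum integrable_mult_right) auto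
    show "AE w in ?R. (p w)\<^sup>2 \<le> (\<Sum>z\<in>S'. \<kappa> / measure M1 (C z) * (p w * indicator (C z) (fst w)))"
      using AE1 AE2 AE3 AE_space
    proof eventually_elim
      case (elim w)
      obtain x y where w: "w = (x, y)" by (cases w)
      have xy: "x \<in> space M1" "y \<in> space M2" using elim(4) by (auto simp: w space_pair_measure)
      obtain z where z: "z \<in> S" "x \<in> C z" using elim(1) cover by (auto simp: w)
      then have z': "z \<in> S'" using elim(3) by (auto simp: w)
      then have pos: "measure M1 (C z) > 0" by (simp add: S'_def)
      have p0: "0 \<le> p w" using p_bd[OF elim(4)] by simp
      have "p w \<le> \<kappa> / measure M1 (C z)"
        using key[OF z(1,2) _ xy(1) _ xy(2)] elim(1,2) pos by (simp add: w field_simps)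
      then have "(p w)\<^sup>2 \<le> \<kappa> / measure M1 (C z) * (p w * indicator (C z) (fst w))"
        using mult_right_mono[OF _ p0, of "p w" "\<kappa> / measure M1 (C z)"] z(2) by (simp add: w power2_eq_square)
      \<comment> \<open>The cells may overlap; all summands are nonnegative, so the one for a single
        cell containing \<open>x\<close> is enough.\<close>
      also have "\<dots> \<le> (\<Sum>z\<in>S'. \<kappa> / measure M1 (C z) * (p w * indicator (C z) (fst w)))"
        using S' z' \<kappa> p0 by (intro member_le_sum) auto
      finally show ?case .
    qed
  qed
  also have "\<dots> = (\<Sum>z\<in>S'. \<kappa> / measure M1 (C z) * measure M1 (C z))"
    using S'(2) pint pint_eq by (subst Bochner_Integration.integral_sum) (auto intro!: sum.cong)
  also have "\<dots> = \<kappa> * card S'" by (simp add: S'_def)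
  also have "\<dots> \<le> \<kappa> * card S" using \<kappa> S S' by (intro mult_left_mono) (auto intro: card_mono)
  finally show ?thesis .
qed

section \<open>Supports and covering numbers in Euclidean space\<close>

lemma edist_triangle: "edist d x z \<le> edist d x y + edist d y z"
  using L2_set_triangle_ineq[of "\<lambda>i. x i - y i" "\<lambda>i. y i - z i" "{..<d}"] by (simp add: edist_def)

lemma edist_commute: "edist d x y = edist d y x"
  by (simp add: edist_def L2_set_def power2_commute)

lemma edist_measurable [measurable]: "(\<lambda>y. edist d x y) \<in> borel_measurable (Rd d)"
  unfolding edist_def L2_set_def by measurable

lemma rational_point_near:
  assumes "0 < s"
  obtains q where "q \<in> {..<d} \<rightarrow>\<^sub>E \<rat>" "edist d q x < s"
proof -
  \<comment> \<open>Dividing by \<open>d + 1\<close> instead of \<open>d\<close> keeps the sum over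
    \<open>d\<close> coordinates strictly below \<open>s\<close>, also for
    \<open>d = 0\<close>.\<close>
  have "\<exists>r\<in>\<rat>. \<bar>r - x i\<bar> < s / (d + 1)" for i
  proof -
    have "x i - s / (d + 1) < x i + s / (d + 1)" using assms by simp
    from Rats_dense_in_real[OF this] obtain r where "r \<in> \<rat>" "x i - s / (d + 1) < r" "r < x i + s / (d + 1)"
      by blast
    then show ?thesis by (intro bexI[of _ r]) (simp_all only: abs_less_iff, linarith)
  qed
  then obtain r where r: "\<And>i. r i \<in> \<rat>" "\<And>i. \<bar>r i - x i\<bar> < s / (d + 1)" by metis
  have "edist d (restrict r {..<d}) x \<le> (\<Sum>i<d. \<bar>r i - x i\<bar>)"
    using L2_set_le_sum_abs[of "\<lambda>i. restrict r {..<d} i - x i" "{..<d}"] by (simp add: edist_def)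
  also have "\<dots> \<le> (\<Sum>i<d. s / (d + 1))" using r(2) by (intro sum_mono less_imp_le)
  also have "\<dots> < s" using assms by (simp add: field_simps)
  finally show thesis using r(1) by (intro that[of "restrict r {..<d}"]) auto
qed

text \<open>Separability: a point outside the support is the centre of a null ball, and this ball
  contains a null ball around the point with rational centre and radius. Only countably many such
  balls exist.\<close>

lemma AE_in_supp:
  assumes "borel_prob d \<mu>"
  shows "AE x in \<mu>. x \<in> supp d \<mu>"
proof -
  have sets_\<mu>: "sets \<mu> = sets (Rd d)" using assms by (simp add: borel_prob_def)
  have space_\<mu>: "space \<mu> = space (Rd d)" using sets_\<mu> by (rule sets_eq_imp_space_eq)
  define B where "B = (\<lambda>(x, r). {y \<in> space (Rd d). edist d x y < r})"
  define I where "I = {w \<in> ({..<d} \<rightarrow>\<^sub>E \<rat>) \<times> \<rat>. B w \<in> null_sets \<mu>}"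
  have "countable (({..<d} \<rightarrow>\<^sub>E \<rat>) \<times> (\<rat> :: real set))"
    by (intro countable_SIGMA countable_PiE countable_rat) auto
  then have "countable I" unfolding I_def by (rule countable_subset[rotated]) auto
  then have "(\<Union>w\<in>I. B w) \<in> null_sets \<mu>" by (rule null_sets_UN') (simp add: I_def)
  moreover have "{x \<in> space \<mu>. x \<notin> supp d \<mu>} \<subseteq> (\<Union>w\<in>I. B w)"
  proof
    fix x assume "x \<in> {x \<in> space \<mu>. x \<notin> supp d \<mu>}"
    then obtain r where x: "x \<in> space (Rd d)" and r: "0 < r" "emeasure \<mu> (B (x, r)) = 0"
      by (auto simp: supp_def space_\<mu> B_def)
    \<comment> \<open>With \<open>s < r / 2\<close>, a ball of radius \<open>s\<close> whose centre
      is within \<open>s\<close> of \<open>x\<close> contains \<open>x\<close> and stays inside the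
      ball of radius \<open>r\<close> around \<open>x\<close>.\<close>
    obtain s where s: "s \<in> \<rat>" "0 < s" "s < r / 2"
      using Rats_dense_in_real[of 0 "r / 2"] r(1) by auto
    obtain q where q: "q \<in> {..<d} \<rightarrow>\<^sub>E \<rat>" "edist d q x < s" using rational_point_near[OF s(2)] .
    have B_meas: "B (x, r) \<in> sets \<mu>" for x r unfolding sets_\<mu> B_def prod.case by measurable
    have "B (q, s) \<subseteq> B (x, r)"
    proof
      fix y assume "y \<in> B (q, s)"
      then show "y \<in> B (x, r)"
        using edist_triangle[of d x y q] edist_commute[of d x q] q(2) s(3) by (auto simp: B_def)
    qed
    moreover have "B (x, r) \<in> null_sets \<mu>" using r(2) B_meas by (simp add: null_sets_def)
    ultimately have "B (q, s) \<in> null_sets \<mu>" using B_meas by (meson null_sets_subset)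
    then have "(q, s) \<in> I" using q(1) s(1) by (simp add: I_def)
    moreover have "x \<in> B (q, s)" using q(2) x by (simp add: B_def)
    ultimately show "x \<in> (\<Union>w\<in>I. B w)" by blast
  qed
  ultimately show ?thesis by (rule AE_I')
qed

text \<open>\<open>enat\<close> is well-ordered, so the infimum of a nonempty set is attained; a
  finite value rules out the empty set, whose infimum is \<open>\<infinity>\<close>.\<close>

lemma covering_number_witness:
  assumes "covering_number d \<mu> \<delta> = enat N"
  obtains S where "finite S" "card S = N" "S \<subseteq> space (Rd d)"
    "supp d \<mu> \<subseteq> (\<Union>z\<in>S. {x \<in> space (Rd d). edist d z x \<le> \<delta>})"
proof -
  let ?A = "{enat (card S) | S. finite S \<and> S \<subseteq> space (Rd d) \<and>
            supp d \<mu> \<subseteq> (\<Union>z\<in>S. {x \<in> space (Rd d). edist d z x \<le> \<delta>})}"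
  have "?A \<noteq> {}"
  proof
    assume "?A = {}"
    then have "covering_number d \<mu> \<delta> = \<infinity>" unfolding covering_number_def by (simp only: Inf_enat_def) simp
    then show False using assms by simp
  qed
  then obtain e where "e \<in> ?A" by blast
  then have "(LEAST x. x \<in> ?A) \<in> ?A" by (rule LeastI)
  then have "Inf ?A \<in> ?A" using \<open>?A \<noteq> {}\<close> by (simp only: Inf_enat_def if_False)
  then have "enat N \<in> ?A" using assms unfolding covering_number_def by simp
  then show thesis using that by auto
qed

section \<open>Sampling errors of the marginals\<close>

lemma (in prob_space) integral_PiM_component:
  fixes f :: "'a \<Rightarrow> real"
  assumes "i \<in> I" and [measurable]: "f \<in> borel_measurable M"
  shows "(\<integral>y. f (y i) \<partial>Pi\<^sub>M I (\<lambda>_. M)) = (\<integral>x. f x \<partial>M)"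
proof -
  have "distr (Pi\<^sub>M I (\<lambda>_. M)) M (\<lambda>y. y i) = M"
    using assms(1) by (intro distr_PiM_component prob_space_axioms)
  then have "(\<integral>x. f x \<partial>M) = (\<integral>x. f x \<partial>distr (Pi\<^sub>M I (\<lambda>_. M)) M (\<lambda>y. y i))" by simp
  also have "\<dots> = (\<integral>y. f (y i) \<partial>Pi\<^sub>M I (\<lambda>_. M))"
    using assms by (intro integral_distr) auto
  finally show ?thesis ..
qed

lemma (in prob_space) integral_PiM_mult:
  fixes f g :: "'a \<Rightarrow> real"
  assumes I: "finite I" "i \<in> I" "j \<in> I" "i \<noteq> j" and int: "integrable M f" "integrable M g"
  shows "(\<integral>y. f (y i) * g (y j) \<partial>Pi\<^sub>M I (\<lambda>_. M)) = (\<integral>x. f x \<partial>M) * (\<integral>x. g x \<partial>M)"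
proof -
  interpret product_sigma_finite "\<lambda>_::'b. M" by standard
  define h where "h = (\<lambda>l. if l = i then f else if l = j then g else (\<lambda>_. 1))"
  have prod: "(\<Prod>l\<in>I. if l = i then a else if l = j then b else 1) = a * b" for a b :: real
  proof -
    have "(\<Prod>l\<in>I. if l = i then a else if l = j then b else 1) = (\<Prod>l\<in>{i, j}. if l = i then a else if l = j then b else 1)"
      using I by (intro prod.mono_neutral_right) auto
    then show ?thesis using I(4) by simp
  qed
  have "(\<integral>y. (\<Prod>l\<in>I. h l (y l)) \<partial>Pi\<^sub>M I (\<lambda>_. M)) = (\<Prod>l\<in>I. \<integral>x. h l x \<partial>M)"
    using I(1) int by (intro product_integral_prod) (auto simp: h_def)
  moreover have "(\<Prod>l\<in>I. h l (y l)) = f (y i) * g (y j)" for y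
    unfolding prod[symmetric] by (intro prod.cong) (auto simp: h_def)
  moreover have "(\<Prod>l\<in>I. \<integral>x. h l x \<partial>M) = (\<integral>x. f x \<partial>M) * (\<integral>x. g x \<partial>M)"
    unfolding prod[symmetric] by (intro prod.cong) (auto simp: h_def prob_space)
  ultimately show ?thesis by simp
qed

text \<open>Off the diagonal, independence factors the expectation into a product of two zero
  means.\<close>

lemma (in prob_space) integral_square_sum_PiM:
  fixes f :: "'a \<Rightarrow> real"
  assumes I: "finite I" and f [measurable]: "f \<in> borel_measurable M" and f_bd: "\<And>x. x \<in> space M \<Longrightarrow> \<bar>f x\<bar> \<le> B"
    and f0: "(\<integral>x. f x \<partial>M) = 0"
  shows "(\<integral>y. (\<Sum>j\<in>I. f (y j))\<^sup>2 \<partial>Pi\<^sub>M I (\<lambda>_. M)) = card I * (\<integral>x. (f x)\<^sup>2 \<partial>M)"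
proof -
  interpret \<Pi>: prob_space "Pi\<^sub>M I (\<lambda>_. M)" by (intro prob_space_PiM prob_space_axioms)
  have int: "integrable M f" using f f_bd by (rule integrable_bounded)
  have int2: "integrable (Pi\<^sub>M I (\<lambda>_. M)) (\<lambda>y. f (y i) * f (y j))" if "i \<in> I" "j \<in> I" for i j
  proof (rule \<Pi>.integrable_bounded)
    show "(\<lambda>y. f (y i) * f (y j)) \<in> borel_measurable (Pi\<^sub>M I (\<lambda>_. M))" using that by measurable
    show "\<bar>f (y i) * f (y j)\<bar> \<le> B * B" if "y \<in> space (Pi\<^sub>M I (\<lambda>_. M))" for y
    proof -
      have "y i \<in> space M" "y j \<in> space M" using that \<open>i \<in> I\<close> \<open>j \<in> I\<close> by (auto simp: space_PiM)
      then show ?thesis using f_bd order_trans[OF abs_ge_zero f_bd] by (simp add: abs_mult mult_mono)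
    qed
  qed
  have "(\<integral>y. (\<Sum>j\<in>I. f (y j))\<^sup>2 \<partial>Pi\<^sub>M I (\<lambda>_. M))
      = (\<Sum>i\<in>I. \<Sum>j\<in>I. \<integral>y. f (y i) * f (y j) \<partial>Pi\<^sub>M I (\<lambda>_. M))"
    unfolding power2_eq_square sum_product using int2 by (simp add: Bochner_Integration.integral_sum)
  also have "\<dots> = (\<Sum>i\<in>I. \<Sum>j\<in>I. if j = i then \<integral>x. (f x)\<^sup>2 \<partial>M else 0)"
  proof (intro sum.cong refl)
    fix i j assume ij: "i \<in> I" "j \<in> I"
    show "(\<integral>y. f (y i) * f (y j) \<partial>Pi\<^sub>M I (\<lambda>_. M)) = (if j = i then \<integral>x. (f x)\<^sup>2 \<partial>M else 0)"
    proof (cases "j = i")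
      case True
      then show ?thesis using integral_PiM_component[OF ij(1), of "\<lambda>x. (f x)\<^sup>2"] by (simp add: power2_eq_square)
    next
      case False
      then show ?thesis using integral_PiM_mult[OF I ij _ int int] f0 by simp
    qed
  qed
  also have "\<dots> = card I * (\<integral>x. (f x)\<^sup>2 \<partial>M)" using I by simp
  finally show ?thesis .
qed

section \<open>Pairs drawn from two independent samples\<close>

abbreviation samples :: "nat \<Rightarrow> 'a measure \<Rightarrow> (nat \<Rightarrow> 'a) measure" where
  "samples n M \<equiv> Pi\<^sub>M {..<n} (\<lambda>_. M)"

text \<open>Passes linearly from second to first moments; at the optimal \<open>r\<close> the effect
  is that of Cauchy-Schwarz.\<close>

lemma abs_le_weighted_square: "0 < r \<Longrightarrow> \<bar>t\<bar> \<le> (r * t\<^sup>2 + 1 / r) / 2" for r t :: real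
proof -
  assume r: "0 < r"
  have "0 \<le> (r * \<bar>t\<bar> - 1)\<^sup>2 / r" using r by simp
  also have "\<dots> = r * t\<^sup>2 - 2 * \<bar>t\<bar> + 1 / r" using r by (simp add: power2_eq_square field_simps)
  finally show ?thesis by simp
qed

context pair_prob_space
begin

lemma samples_prob_spaces: "pair_prob_space (samples n M1) (samples n M2)"
proof -
  interpret S1: prob_space "samples n M1" by (intro prob_space_PiM M1.prob_space_axioms)
  interpret S2: prob_space "samples n M2" by (intro prob_space_PiM M2.prob_space_axioms)
  show ?thesis by standard
qed

text \<open>Every single pair has the population law because the two samples are independent of each
  other, even though pairs sharing an index are dependent.\<close>

lemma distr_samples_component:
  assumes "i < n" "j < n"
  shows "distr (samples n M1 \<Otimes>\<^sub>M samples n M2) (M1 \<Otimes>\<^sub>M M2) (\<lambda>\<omega>. (fst \<omega> i, snd \<omega> j)) = M1 \<Otimes>\<^sub>M M2"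
proof -
  have d1: "distr (samples n M1) M1 (\<lambda>x. x i) = M1" using assms by (intro distr_PiM_component M1.prob_space_axioms) auto
  have d2: "distr (samples n M2) M2 (\<lambda>y. y j) = M2" using assms by (intro distr_PiM_component M2.prob_space_axioms) auto
  have "distr (samples n M1) M1 (\<lambda>x. x i) \<Otimes>\<^sub>M distr (samples n M2) M2 (\<lambda>y. y j) =
      distr (samples n M1 \<Otimes>\<^sub>M samples n M2) (M1 \<Otimes>\<^sub>M M2) (\<lambda>(x, y). (x i, y j))"
    using assms by (intro pair_measure_distr) (auto simp: d2 M2.sigma_finite_measure_axioms)
  then show ?thesis by (simp add: d1 d2 case_prod_unfold)
qed

lemma samples_component_measurable [measurable]:
  assumes "i < n" "j < n"
  shows "(\<lambda>\<omega>. (fst \<omega> i, snd \<omega> j)) \<in> samples n M1 \<Otimes>\<^sub>M samples n M2 \<rightarrow>\<^sub>M M1 \<Otimes>\<^sub>M M2"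
proof -
  have "(\<lambda>x. x i) \<in> samples n M1 \<rightarrow>\<^sub>M M1" "(\<lambda>y. y j) \<in> samples n M2 \<rightarrow>\<^sub>M M2"
    using assms by (auto intro!: measurable_component_singleton)
  note [measurable] = this
  show ?thesis by measurable
qed

lemma samples_component_space:
  assumes "i < n" "j < n" "\<omega> \<in> space (samples n M1 \<Otimes>\<^sub>M samples n M2)"
  shows "(fst \<omega> i, snd \<omega> j) \<in> space (M1 \<Otimes>\<^sub>M M2)"
  using measurable_space[OF samples_component_measurable[OF assms(1,2)] assms(3)] .

text \<open>A finite union of null events, one for each pair of indices. It makes almost-everywhere
  statements about the population usable at the sample pairs, which carry all the mass of the
  empirical product.\<close>

lemma AE_samples:
  assumes "AE z in M1 \<Otimes>\<^sub>M M2. P z"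
  shows "AE \<omega> in samples n M1 \<Otimes>\<^sub>M samples n M2. \<forall>i<n. \<forall>j<n. P (fst \<omega> i, snd \<omega> j)"
proof -
  have "AE \<omega> in samples n M1 \<Otimes>\<^sub>M samples n M2. P (fst \<omega> i, snd \<omega> j)" if "i < n" "j < n" for i j
    using AE_distrD[OF samples_component_measurable[OF that], of P] assms
    unfolding distr_samples_component[OF that] by simp
  then have "AE \<omega> in samples n M1 \<Otimes>\<^sub>M samples n M2. \<forall>i\<in>{..<n}. \<forall>j\<in>{..<n}. P (fst \<omega> i, snd \<omega> j)"
    by (intro AE_finite_allI) auto
  then show ?thesis unfolding Ball_def lessThan_iff .
qed

lemma integral_samples_component:
  fixes p :: "'a \<times> 'b \<Rightarrow> real"
  assumes "i < n" "j < n" and p: "p \<in> borel_measurable (M1 \<Otimes>\<^sub>M M2)"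
  shows "(\<integral>\<omega>. p (fst \<omega> i, snd \<omega> j) \<partial>(samples n M1 \<Otimes>\<^sub>M samples n M2)) = (\<integral>z. p z \<partial>(M1 \<Otimes>\<^sub>M M2))"
  using integral_distr[OF samples_component_measurable[OF assms(1,2)] p]
  unfolding distr_samples_component[OF assms(1,2)] by (rule sym)

text \<open>Given the first sample, the row average is a mean of \<open>n\<close> independent copies
  of \<open>p (x i, y)\<close>, whose expectation is 1 by the exact marginal. Its variance is at
  most the conditional second moment over \<open>n\<close>, and averaging over \<open>x i\<close>
  leaves \<open>V / n\<close>.\<close>

lemma integral_fst_marginal_error:
  fixes p :: "'a \<times> 'b \<Rightarrow> real"
  assumes p [measurable]: "p \<in> borel_measurable (M1 \<Otimes>\<^sub>M M2)"
    and p_bd: "\<And>z. z \<in> space (M1 \<Otimes>\<^sub>M M2) \<Longrightarrow> \<bar>p z\<bar> \<le> K"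
    and marg: "\<And>x. x \<in> space M1 \<Longrightarrow> (\<integral>y. p (x, y) \<partial>M2) = 1"
    and V: "(\<integral>z. (p z)\<^sup>2 \<partial>(M1 \<Otimes>\<^sub>M M2)) \<le> V" and r: "0 < r" and i: "i < n"
  shows "(\<integral>\<omega>. \<bar>1 - (\<Sum>j<n. p (fst \<omega> i, snd \<omega> j)) / n\<bar> \<partial>(samples n M1 \<Otimes>\<^sub>M samples n M2))
      \<le> (r * (V / n) + 1 / r) / 2"
proof -
  interpret S: pair_prob_space "samples n M1" "samples n M2" by (rule samples_prob_spaces)
  let ?S = "samples n M1 \<Otimes>\<^sub>M samples n M2"
  let ?e = "\<lambda>\<omega>. 1 - (\<Sum>j<n. p (fst \<omega> i, snd \<omega> j)) / n"
  have n: "n > 0" using i by simp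
  have [measurable]: "(\<lambda>\<omega>. p (fst \<omega> i, snd \<omega> j)) \<in> borel_measurable ?S" if "j \<in> {..<n}" for j
    using that i by (intro measurable_compose[OF samples_component_measurable p]) auto
  have e_meas [measurable]: "?e \<in> borel_measurable ?S" by measurable
  have K0: "0 \<le> K"
    using P.not_empty p_bd by (meson abs_ge_zero equals0I order_trans)
  have e_bd: "\<bar>?e \<omega>\<bar> \<le> 1 + K" if "\<omega> \<in> space ?S" for \<omega>
  proof -
    have "\<bar>\<Sum>j<n. p (fst \<omega> i, snd \<omega> j)\<bar> \<le> (\<Sum>j<n. K)"
      using p_bd samples_component_space[OF i _ that] by (intro order_trans[OF sum_abs sum_mono]) auto
    then have "\<bar>(\<Sum>j<n. p (fst \<omega> i, snd \<omega> j)) / n\<bar> \<le> K" using n by (simp add: field_simps)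
    then show ?thesis by linarith
  qed
  have int_e: "integrable ?S ?e" using e_meas e_bd by (rule S.P.integrable_bounded)
  have int_e2: "integrable ?S (\<lambda>\<omega>. (?e \<omega>)\<^sup>2)"
  proof (rule S.P.integrable_bounded)
    show "\<bar>(?e \<omega>)\<^sup>2\<bar> \<le> (1 + K)\<^sup>2" if "\<omega> \<in> space ?S" for \<omega>
      using power_mono[OF e_bd[OF that] abs_ge_zero, of 2] by simp
  qed (rule borel_measurable_power[OF e_meas])
  have p2: "integrable (M1 \<Otimes>\<^sub>M M2) (\<lambda>z. (p z)\<^sup>2)"
    using power_mono[OF p_bd abs_ge_zero, of _ 2] by (intro P.integrable_bounded[of _ "K\<^sup>2"]) auto
  define F where "F = (\<lambda>x. \<integral>y. (1 - (\<Sum>j<n. p (x, y j)) / n)\<^sup>2 \<partial>samples n M2)"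
  have F_eq: "F x \<le> (\<integral>y. (p (x, y))\<^sup>2 \<partial>M2) / n" if x: "x \<in> space M1" for x
  proof -
    have px [measurable]: "(\<lambda>y. p (x, y)) \<in> borel_measurable M2" using x by measurable
    have px_bd: "\<bar>p (x, y)\<bar> \<le> K" if "y \<in> space M2" for y using x that p_bd by (auto simp: space_pair_measure)
    have i1: "integrable M2 (\<lambda>y. p (x, y))" using px px_bd by (rule M2.integrable_bounded)
    have i2: "integrable M2 (\<lambda>y. (p (x, y))\<^sup>2)"
      using power_mono[OF px_bd abs_ge_zero, of _ 2] by (intro M2.integrable_bounded[of _ "K\<^sup>2"]) auto
    have "F x = (\<integral>y. (\<Sum>j<n. 1 - p (x, y j))\<^sup>2 / (real n)\<^sup>2 \<partial>samples n M2)"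
      unfolding F_def
    proof (intro Bochner_Integration.integral_cong refl)
      fix y
      have "1 - (\<Sum>j<n. p (x, y j)) / n = (\<Sum>j<n. 1 - p (x, y j)) / n"
        using n by (simp add: sum_subtractf diff_divide_distrib)
      then show "(1 - (\<Sum>j<n. p (x, y j)) / n)\<^sup>2 = (\<Sum>j<n. 1 - p (x, y j))\<^sup>2 / (real n)\<^sup>2"
        by (simp only: power_divide)
    qed
    also have "\<dots> = (real (card {..<n}) * (\<integral>y. (1 - p (x, y))\<^sup>2 \<partial>M2)) / (real n)\<^sup>2"
      unfolding integral_divide_zero
    proof (subst M2.integral_square_sum_PiM[where B = "1 + K"])
      show "\<bar>1 - p (x, y)\<bar> \<le> 1 + K" if "y \<in> space M2" for y using px_bd[OF that] by linarith
      show "(\<integral>y. 1 - p (x, y) \<partial>M2) = 0" using i1 marg[OF x] by (simp add: M2.prob_space)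
    qed simp_all
    also have "(\<integral>y. (1 - p (x, y))\<^sup>2 \<partial>M2) = (\<integral>y. 1 - 2 * p (x, y) + (p (x, y))\<^sup>2 \<partial>M2)"
      by (simp add: power2_eq_square algebra_simps)
    also have "\<dots> = (\<integral>y. (p (x, y))\<^sup>2 \<partial>M2) - 1" using i1 i2 marg[OF x] by (simp add: M2.prob_space)
    also have "real (card {..<n}) * ((\<integral>y. (p (x, y))\<^sup>2 \<partial>M2) - 1) / (real n)\<^sup>2 = ((\<integral>y. (p (x, y))\<^sup>2 \<partial>M2) - 1) / n"
      using n by (simp add: power2_eq_square)
    \<comment> \<open>The squared mean in the variance is given away, since covering arguments
      control the second moment.\<close>
    also have "\<dots> \<le> (\<integral>y. (p (x, y))\<^sup>2 \<partial>M2) / n" using n by (intro divide_right_mono) auto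
    finally show ?thesis .
  qed
  have G_meas [measurable]: "(\<lambda>x. (\<integral>y. (p (x, y))\<^sup>2 \<partial>M2) / n) \<in> borel_measurable M1" by measurable
  have "(\<integral>\<omega>. (?e \<omega>)\<^sup>2 \<partial>?S) = (\<integral>x. F (x i) \<partial>samples n M1)"
    using S.integral_fst'[OF int_e2] by (simp add: F_def)
  also have "\<dots> \<le> (\<integral>x. (\<integral>y. (p (x i, y))\<^sup>2 \<partial>M2) / n \<partial>samples n M1)"
  proof (rule integral_mono)
    show "integrable (samples n M1) (\<lambda>x. F (x i))"
      using S.integrable_fst'[OF int_e2] by (simp add: F_def)
    show "integrable (samples n M1) (\<lambda>x. (\<integral>y. (p (x i, y))\<^sup>2 \<partial>M2) / n)"
    proof -
      have "integrable (distr (samples n M1) M1 (\<lambda>x. x i)) (\<lambda>x. (\<integral>y. (p (x, y))\<^sup>2 \<partial>M2) / n)"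
        using integrable_fst'[OF p2] i
        by (subst distr_PiM_component) (auto intro: M1.prob_space_axioms)
      then show ?thesis using i
        by (subst (asm) integrable_distr_eq) auto
    qed
    show "F (x i) \<le> (\<integral>y. (p (x i, y))\<^sup>2 \<partial>M2) / n" if "x \<in> space (samples n M1)" for x
      using that i by (intro F_eq) (auto simp: space_PiM)
  qed
  also have "\<dots> = (\<integral>x. (\<integral>y. (p (x, y))\<^sup>2 \<partial>M2) / n \<partial>M1)"
    using i by (intro M1.integral_PiM_component[of i _ "\<lambda>x. (\<integral>y. (p (x, y))\<^sup>2 \<partial>M2) / n"]) auto
  also have "\<dots> = (\<integral>z. (p z)\<^sup>2 \<partial>(M1 \<Otimes>\<^sub>M M2)) / n" using integral_fst'[OF p2] by simp
  also have "\<dots> \<le> V / n" using V n by (intro divide_right_mono) auto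
  finally have e2: "(\<integral>\<omega>. (?e \<omega>)\<^sup>2 \<partial>?S) \<le> V / n" .
  have "(\<integral>\<omega>. \<bar>?e \<omega>\<bar> \<partial>?S) \<le> (\<integral>\<omega>. (r * (?e \<omega>)\<^sup>2 + 1 / r) / 2 \<partial>?S)"
    using int_e int_e2 r by (intro integral_mono abs_le_weighted_square) auto
  also have "\<dots> = (r * (\<integral>\<omega>. (?e \<omega>)\<^sup>2 \<partial>?S) + 1 / r) / 2" using int_e2 by (simp add: S.P.prob_space)
  also have "\<dots> \<le> (r * (V / n) + 1 / r) / 2"
    using e2 r by (intro divide_right_mono add_right_mono mult_left_mono) auto
  finally show ?thesis .
qed

lemma swap_pair_prob_space: "pair_prob_space M2 M1" ..

lemma integral_snd_marginal_error:
  fixes p :: "'a \<times> 'b \<Rightarrow> real"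
  assumes p [measurable]: "p \<in> borel_measurable (M1 \<Otimes>\<^sub>M M2)"
    and p_bd: "\<And>z. z \<in> space (M1 \<Otimes>\<^sub>M M2) \<Longrightarrow> \<bar>p z\<bar> \<le> K"
    and marg: "\<And>y. y \<in> space M2 \<Longrightarrow> (\<integral>x. p (x, y) \<partial>M1) = 1"
    and V: "(\<integral>z. (p z)\<^sup>2 \<partial>(M1 \<Otimes>\<^sub>M M2)) \<le> V" and r: "0 < r" and j: "j < n"
  shows "(\<integral>\<omega>. \<bar>1 - (\<Sum>i<n. p (fst \<omega> i, snd \<omega> j)) / n\<bar> \<partial>(samples n M1 \<Otimes>\<^sub>M samples n M2))
      \<le> (r * (V / n) + 1 / r) / 2"
proof -
  interpret T: pair_prob_space M2 M1 by (rule swap_pair_prob_space)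
  interpret S: pair_prob_space "samples n M1" "samples n M2" by (rule samples_prob_spaces)
  let ?p = "\<lambda>(y, x). p (x, y)"
  have p': "?p \<in> borel_measurable (M2 \<Otimes>\<^sub>M M1)" by measurable
  have meas: "(\<lambda>\<omega>. p (fst \<omega> i, snd \<omega> j)) \<in> borel_measurable (samples n M1 \<Otimes>\<^sub>M samples n M2)" if "i \<in> {..<n}" for i
    using that j by (intro measurable_compose[OF samples_component_measurable p]) auto
  have "(\<integral>z. (?p z)\<^sup>2 \<partial>(M2 \<Otimes>\<^sub>M M1)) = (\<integral>z. (p z)\<^sup>2 \<partial>(M1 \<Otimes>\<^sub>M M2))"
    using integral_product_swap[of "\<lambda>z. (p z)\<^sup>2"] by (simp add: case_prod_unfold)
  then have "(\<integral>\<omega>. \<bar>1 - (\<Sum>i<n. ?p (fst \<omega> j, snd \<omega> i)) / n\<bar> \<partial>(samples n M2 \<Otimes>\<^sub>M samples n M1))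
      \<le> (r * (V / n) + 1 / r) / 2"
    using V p_bd marg by (intro T.integral_fst_marginal_error[OF p' _ _ _ r j, of K]) (auto simp: space_pair_measure)
  moreover have "(\<integral>(y, x). \<bar>1 - (\<Sum>i<n. p (x i, y j)) / n\<bar> \<partial>(samples n M2 \<Otimes>\<^sub>M samples n M1))
      = (\<integral>\<omega>. \<bar>1 - (\<Sum>i<n. p (fst \<omega> i, snd \<omega> j)) / n\<bar> \<partial>(samples n M1 \<Otimes>\<^sub>M samples n M2))"
    using meas S.integral_product_swap[of "\<lambda>\<omega>. \<bar>1 - (\<Sum>i<n. p (fst \<omega> i, snd \<omega> j)) / n\<bar>"]
    by (simp add: case_prod_unfold)
  ultimately show ?thesis by (simp add: case_prod_unfold)
qed

end

section \<open>The empirical problem\<close>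

lemma samples_measurable:
  assumes "\<And>i. i < n \<Longrightarrow> x i \<in> space M"
  shows "x \<in> uniform_count_measure {..<n} \<rightarrow>\<^sub>M M"
  using assms by (auto simp: measurable_def uniform_count_measure_def space_point_measure sets_point_measure)

lemma sets_empirical [simp, measurable_cong]: "sets (empirical M n x) = sets M"
  and space_empirical [simp]: "space (empirical M n x) = space M"
  by (simp_all add: empirical_def)

lemma prob_space_empirical:
  assumes "1 \<le> n" "\<And>i. i < n \<Longrightarrow> x i \<in> space M"
  shows "prob_space (empirical M n x)"
  unfolding empirical_def using assms samples_measurable[OF assms(2)]
  by (intro prob_space.prob_space_distr prob_space_uniform_count_measure) (auto simp: lessThan_empty_iff)

lemma integral_empirical:
  fixes f :: "'a \<Rightarrow> real"
  assumes "\<And>i. i < n \<Longrightarrow> x i \<in> space M" "f \<in> borel_measurable M"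
  shows "(\<integral>z. f z \<partial>empirical M n x) = (\<Sum>i<n. f (x i)) / n"
  unfolding empirical_def using samples_measurable[OF assms(1)] assms(2)
  by (subst integral_distr) (auto simp: integral_uniform_count_measure)

text \<open>The empirical product is the image of the uniform measure on a finite grid of indices,
  so the property has to be verified only at the sample pairs. Measurability of the property lets it
  be pulled back to the grid.\<close>

lemma AE_empirical_pair:
  assumes n: "1 \<le> n" and x: "\<And>i. i < n \<Longrightarrow> x i \<in> space M1" and y: "\<And>j. j < n \<Longrightarrow> y j \<in> space M2"
    and Q: "{z \<in> space (M1 \<Otimes>\<^sub>M M2). Q z} \<in> sets (M1 \<Otimes>\<^sub>M M2)"
    and holds: "\<And>i j. i < n \<Longrightarrow> j < n \<Longrightarrow> Q (x i, y j)"
  shows "AE z in empirical M1 n x \<Otimes>\<^sub>M empirical M2 n y. Q z"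
proof -
  let ?U = "uniform_count_measure {..<n}"
  note [measurable] = samples_measurable[OF x] samples_measurable[OF y]
  interpret E2: prob_space "empirical M2 n y" using n y by (rule prob_space_empirical)
  have eq: "empirical M1 n x \<Otimes>\<^sub>M empirical M2 n y = distr (?U \<Otimes>\<^sub>M ?U) (M1 \<Otimes>\<^sub>M M2) (\<lambda>(i, j). (x i, y j))"
    unfolding empirical_def using E2.sigma_finite_measure_axioms
    by (intro pair_measure_distr) (auto simp: empirical_def)
  have "AE w in ?U \<Otimes>\<^sub>M ?U. Q (case w of (i, j) \<Rightarrow> (x i, y j))"
    using holds by (intro AE_I2) (auto simp: space_pair_measure space_uniform_count_measure)
  then show ?thesis unfolding eq using Q by (subst AE_distr_iff) auto
qed

text \<open>The deterministic part, for one fixed sample. The population density enters as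
  \<open>g\<close>, tied to \<open>p\<close> only at the sample pairs, because that is all an almost
  sure statement provides.\<close>

lemma empirical_density_error:
  fixes c :: "'a \<times> 'b \<Rightarrow> real"
  assumes c [measurable]: "c \<in> borel_measurable (M1 \<Otimes>\<^sub>M M2)" and \<epsilon>: "0 < \<epsilon>" and n: "1 \<le> n"
    and x: "\<And>i. i < n \<Longrightarrow> x i \<in> space M1" and y: "\<And>j. j < n \<Longrightarrow> y j \<in> space M2"
    and c_bd: "\<And>i j. i < n \<Longrightarrow> j < n \<Longrightarrow> \<bar>c (x i, y j)\<bar> \<le> 1"
    and u [measurable]: "u \<in> borel_measurable M1" and u_bd: "\<And>x. x \<in> space M1 \<Longrightarrow> \<bar>u x\<bar> \<le> 2 / \<epsilon>"
    and v [measurable]: "v \<in> borel_measurable M2" and v_bd: "\<And>y. y \<in> space M2 \<Longrightarrow> \<bar>v y\<bar> \<le> 1 / \<epsilon>"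
    and p_def: "p = (\<lambda>z. exp (u (fst z) + v (snd z)) * gibbs c \<epsilon> z)"
    and g [measurable]: "g \<in> borel_measurable (M1 \<Otimes>\<^sub>M M2)"
    and g_eq: "\<And>i j. i < n \<Longrightarrow> j < n \<Longrightarrow> g (x i, y j) = p (x i, y j)"
    and s: "0 < s"
  shows "(\<integral>\<^sup>+z. ennreal \<bar>eot_density c \<epsilon> (empirical M1 n x) (empirical M2 n y) z - g z\<bar>
        \<partial>(empirical M1 n x \<Otimes>\<^sub>M empirical M2 n y))
      \<le> ennreal (s / 4 * (4 / \<epsilon> * ((\<Sum>i<n. \<bar>1 - (\<Sum>j<n. p (x i, y j)) / n\<bar>) / n)
          + 2 / \<epsilon> * ((\<Sum>j<n. \<bar>1 - (\<Sum>i<n. p (x i, y j)) / n\<bar>) / n))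
        + (1 + (\<Sum>i<n. (\<Sum>j<n. p (x i, y j)) / n) / n) / (2 * s))"
proof -
  let ?E1 = "empirical M1 n x" and ?E2 = "empirical M2 n y"
  interpret E1: prob_space ?E1 using n x by (rule prob_space_empirical)
  interpret E2: prob_space ?E2 using n y by (rule prob_space_empirical)
  interpret pair_prob_space ?E1 ?E2 ..
  have setsR: "sets (?E1 \<Otimes>\<^sub>M ?E2) = sets (M1 \<Otimes>\<^sub>M M2)" by (intro sets_pair_measure_cong) auto
  have spaceR: "space (?E1 \<Otimes>\<^sub>M ?E2) = space (M1 \<Otimes>\<^sub>M M2)" by (simp add: space_pair_measure)
  have bmR: "f \<in> borel_measurable (?E1 \<Otimes>\<^sub>M ?E2)" if "f \<in> borel_measurable (M1 \<Otimes>\<^sub>M M2)" for f :: "'a \<times> 'b \<Rightarrow> real"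
    using that measurable_cong_sets[OF setsR refl] by blast
  have AE_c: "AE z in ?E1 \<Otimes>\<^sub>M ?E2. \<bar>c z\<bar> \<le> 1"
    using n x y _ c_bd by (rule AE_empirical_pair) measurable
  interpret entropic_transport ?E1 ?E2 c \<epsilon>
    using bmR[OF c] AE_c \<epsilon> by unfold_locales
  obtain u' v' where u' [measurable]: "u' \<in> borel_measurable M1" and u'_bd: "\<And>x. x \<in> space M1 \<Longrightarrow> \<bar>u' x\<bar> \<le> 2 / \<epsilon>"
    and v' [measurable]: "v' \<in> borel_measurable M2" and v'_bd: "\<And>y. y \<in> space M2 \<Longrightarrow> \<bar>v' y\<bar> \<le> 1 / \<epsilon>"
    and marg': "\<And>x. x \<in> space M1 \<Longrightarrow> (\<integral>y. exp (u' x + v' y) * gibbs c \<epsilon> (x, y) \<partial>?E2) = 1"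
      "\<And>y. y \<in> space M2 \<Longrightarrow> (\<integral>x. exp (u' x + v' y) * gibbs c \<epsilon> (x, y) \<partial>?E1) = 1"
    and dens': "AE z in ?E1 \<Otimes>\<^sub>M ?E2. eot_density c \<epsilon> ?E1 ?E2 z = exp (u' (fst z) + v' (snd z)) * gibbs c \<epsilon> z"
  proof (rule eot_density_form)
    fix u v
    assume a: "u \<in> borel_measurable ?E1" "\<And>x. x \<in> space ?E1 \<Longrightarrow> \<bar>u x\<bar> \<le> 2 / \<epsilon>"
      "v \<in> borel_measurable ?E2" "\<And>y. y \<in> space ?E2 \<Longrightarrow> \<bar>v y\<bar> \<le> 1 / \<epsilon>"
      "\<And>x. x \<in> space ?E1 \<Longrightarrow> (\<integral>y. exp (u x + v y) * gibbs c \<epsilon> (x, y) \<partial>?E2) = 1"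
      "\<And>y. y \<in> space ?E2 \<Longrightarrow> (\<integral>x. exp (u x + v y) * gibbs c \<epsilon> (x, y) \<partial>?E1) = 1"
      "AE z in ?E1 \<Otimes>\<^sub>M ?E2. eot_density c \<epsilon> ?E1 ?E2 z = exp (u (fst z) + v (snd z)) * gibbs c \<epsilon> z"
    have "u \<in> borel_measurable M1" "v \<in> borel_measurable M2"
      using a(1,3) measurable_cong_sets[OF sets_empirical refl] by blast+
    with a show thesis by (intro that[of u v]) auto
  qed
  define q where "q = (\<lambda>z. exp (u' (fst z) + v' (snd z)) * gibbs c \<epsilon> z)"
  have gibbs_meas [measurable]: "gibbs c \<epsilon> \<in> borel_measurable (M1 \<Otimes>\<^sub>M M2)" unfolding gibbs_def by measurable
  have gibbs_bd: "0 < gibbs c \<epsilon> z" "gibbs c \<epsilon> z \<le> exp (1 / \<epsilon>)" for z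
  proof -
    have "- max (- 1) (min 1 (c z)) / \<epsilon> \<le> 1 / \<epsilon>" using \<epsilon> by (intro divide_right_mono) auto
    then show "0 < gibbs c \<epsilon> z" "gibbs c \<epsilon> z \<le> exp (1 / \<epsilon>)" by (simp_all add: gibbs_def)
  qed
  have p_meas [measurable]: "p \<in> borel_measurable (M1 \<Otimes>\<^sub>M M2)" unfolding p_def by measurable
  have q_meas [measurable]: "q \<in> borel_measurable (M1 \<Otimes>\<^sub>M M2)" unfolding q_def by measurable
  let ?K = "exp (2 / \<epsilon> + 1 / \<epsilon>) * exp (1 / \<epsilon>)"
  have p_bd: "0 < p z \<and> p z \<le> ?K" if "z \<in> space (?E1 \<Otimes>\<^sub>M ?E2)" for z
  proof -
    have "u (fst z) \<le> 2 / \<epsilon>" "v (snd z) \<le> 1 / \<epsilon>"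
      using that u_bd[of "fst z"] v_bd[of "snd z"] by (auto simp: space_pair_measure)
    then have "exp (u (fst z) + v (snd z)) * gibbs c \<epsilon> z \<le> ?K"
      using gibbs_bd[of z] by (intro mult_mono) auto
    then show ?thesis using gibbs_bd[of z] by (simp add: p_def)
  qed
  have q_bd: "0 < q z \<and> q z \<le> ?K" if "z \<in> space (?E1 \<Otimes>\<^sub>M ?E2)" for z
  proof -
    have "u' (fst z) \<le> 2 / \<epsilon>" "v' (snd z) \<le> 1 / \<epsilon>"
      using that u'_bd[of "fst z"] v'_bd[of "snd z"] by (auto simp: space_pair_measure)
    then have "exp (u' (fst z) + v' (snd z)) * gibbs c \<epsilon> z \<le> ?K"
      using gibbs_bd[of z] by (intro mult_mono) auto
    then show ?thesis using gibbs_bd[of z] by (simp add: q_def)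
  qed
  have ip: "integrable (?E1 \<Otimes>\<^sub>M ?E2) p" and iq: "integrable (?E1 \<Otimes>\<^sub>M ?E2) q"
    using p_bd q_bd bmR[OF p_meas] bmR[OF q_meas]
    by (intro P.integrable_bounded[of _ ?K]; simp add: abs_of_pos)+
  have inner2: "(\<integral>y. p (a, y) \<partial>?E2) = (\<Sum>j<n. p (a, y j)) / n" if "a \<in> space M1" for a
    using that by (intro integral_empirical y) measurable
  have inner1: "(\<integral>x. p (x, b) \<partial>?E1) = (\<Sum>i<n. p (x i, b)) / n" if "b \<in> space M2" for b
    using that by (intro integral_empirical x) measurable
  have sec2 [measurable]: "(\<lambda>a. p (a, y j)) \<in> borel_measurable M1" if "j \<in> {..<n}" for j
    using y[of j] that by (intro measurable_compose[OF measurable_Pair2' p_meas]) auto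
  have sec1 [measurable]: "(\<lambda>b. p (x i, b)) \<in> borel_measurable M2" if "i \<in> {..<n}" for i
    using x[of i] that by (intro measurable_compose[OF measurable_Pair1' p_meas]) auto
  have err1: "(\<integral>a. \<bar>1 - (\<integral>b. p (a, b) \<partial>?E2)\<bar> \<partial>?E1) = (\<Sum>i<n. \<bar>1 - (\<Sum>j<n. p (x i, y j)) / n\<bar>) / n"
  proof -
    have "(\<integral>a. \<bar>1 - (\<integral>b. p (a, b) \<partial>?E2)\<bar> \<partial>?E1) = (\<integral>a. \<bar>1 - (\<Sum>j<n. p (a, y j)) / n\<bar> \<partial>?E1)"
      using inner2 by (intro Bochner_Integration.integral_cong) simp_all
    also have "\<dots> = (\<Sum>i<n. \<bar>1 - (\<Sum>j<n. p (x i, y j)) / n\<bar>) / n"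
      by (intro integral_empirical x) measurable
    finally show ?thesis .
  qed
  have err2: "(\<integral>b. \<bar>1 - (\<integral>a. p (a, b) \<partial>?E1)\<bar> \<partial>?E2) = (\<Sum>j<n. \<bar>1 - (\<Sum>i<n. p (x i, y j)) / n\<bar>) / n"
  proof -
    have "(\<integral>b. \<bar>1 - (\<integral>a. p (a, b) \<partial>?E1)\<bar> \<partial>?E2) = (\<integral>b. \<bar>1 - (\<Sum>i<n. p (x i, b)) / n\<bar> \<partial>?E2)"
      using inner1 by (intro Bochner_Integration.integral_cong) simp_all
    also have "\<dots> = (\<Sum>j<n. \<bar>1 - (\<Sum>i<n. p (x i, y j)) / n\<bar>) / n"
      by (intro integral_empirical y) measurable
    finally show ?thesis .
  qed
  have mass: "(\<integral>z. p z \<partial>(?E1 \<Otimes>\<^sub>M ?E2)) = (\<Sum>i<n. (\<Sum>j<n. p (x i, y j)) / n) / n"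
  proof -
    have "(\<integral>z. p z \<partial>(?E1 \<Otimes>\<^sub>M ?E2)) = (\<integral>a. (\<Sum>j<n. p (a, y j)) / n \<partial>?E1)"
      unfolding integral_fst'[OF ip, symmetric] using inner2
      by (intro Bochner_Integration.integral_cong) simp_all
    also have "\<dots> = (\<Sum>i<n. (\<Sum>j<n. p (x i, y j)) / n) / n"
      by (intro integral_empirical x) measurable
    finally show ?thesis .
  qed
  have L1: "(\<integral>z. \<bar>q z - p z\<bar> \<partial>(?E1 \<Otimes>\<^sub>M ?E2)) \<le>
    s / 4 * (4 / \<epsilon> * (\<integral>a. \<bar>1 - (\<integral>b. p (a, b) \<partial>?E2)\<bar> \<partial>?E1)
        + 2 / \<epsilon> * (\<integral>b. \<bar>1 - (\<integral>a. p (a, b) \<partial>?E1)\<bar> \<partial>?E2))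
      + (1 + (\<integral>z. p z \<partial>(?E1 \<Otimes>\<^sub>M ?E2))) / (2 * s)"
  proof (rule density_perturbation)
    show "p \<in> borel_measurable (?E1 \<Otimes>\<^sub>M ?E2)" "q \<in> borel_measurable (?E1 \<Otimes>\<^sub>M ?E2)"
      using bmR p_meas q_meas by auto
    show "(\<lambda>a. u' a - u a) \<in> borel_measurable ?E1" "(\<lambda>b. v' b - v b) \<in> borel_measurable ?E2" by measurable
    \<comment> \<open>Empirical and population potentials obey the same bounds, so their differences
      obey the doubled ones: 4 / \<epsilon> here and 2 / \<epsilon> for the second variable.\<close>
    show "\<bar>u' a - u a\<bar> \<le> 4 / \<epsilon>" if "a \<in> space ?E1" for a
      using u_bd[of a] u'_bd[of a] that by (simp add: abs_le_iff)
    show "\<bar>v' b - v b\<bar> \<le> 2 / \<epsilon>" if "b \<in> space ?E2" for b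
      using v_bd[of b] v'_bd[of b] that by (simp add: abs_le_iff)
    \<comment> \<open>The truncated kernel is built from the cost alone, without reference to a
      measure; hence both densities share it and it cancels.\<close>
    show "ln (q z) - ln (p z) = (u' (fst z) - u (fst z)) + (v' (snd z) - v (snd z))" for z
      using gibbs_bd[of z] by (simp add: p_def q_def ln_mult)
    show "(\<integral>b. q (a, b) \<partial>?E2) = 1" if "a \<in> space ?E1" for a using marg'(1) that by (simp add: q_def)
    show "(\<integral>a. q (a, b) \<partial>?E1) = 1" if "b \<in> space ?E2" for b using marg'(2) that by (simp add: q_def)
  qed (use p_bd q_bd s in auto)
  have AE_g: "AE z in ?E1 \<Otimes>\<^sub>M ?E2. g z = p z"
    using n x y _ g_eq by (rule AE_empirical_pair) measurable
  have "(\<integral>\<^sup>+z. ennreal \<bar>eot_density c \<epsilon> ?E1 ?E2 z - g z\<bar> \<partial>(?E1 \<Otimes>\<^sub>M ?E2))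
      = (\<integral>\<^sup>+z. ennreal \<bar>q z - p z\<bar> \<partial>(?E1 \<Otimes>\<^sub>M ?E2))"
    using dens' AE_g by (intro nn_integral_cong_AE) (auto simp: q_def)
  also have "\<dots> = ennreal (\<integral>z. \<bar>q z - p z\<bar> \<partial>(?E1 \<Otimes>\<^sub>M ?E2))"
    using ip iq by (intro nn_integral_eq_integral) auto
  also have "\<dots> \<le> ennreal (s / 4 * (4 / \<epsilon> * ((\<Sum>i<n. \<bar>1 - (\<Sum>j<n. p (x i, y j)) / n\<bar>) / n)
          + 2 / \<epsilon> * ((\<Sum>j<n. \<bar>1 - (\<Sum>i<n. p (x i, y j)) / n\<bar>) / n))
        + (1 + (\<Sum>i<n. (\<Sum>j<n. p (x i, y j)) / n) / n) / (2 * s))"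
    using L1 unfolding err1 err2 mass by (rule ennreal_leI)
  finally show ?thesis .
qed

text \<open>The deterministic bound is affine in the marginal errors, each of expectation at most
  \<open>sqrt (V / n)\<close>, and in the mass of \<open>p\<close>, of expectation 1. What remains
  is to choose the two weights.\<close>

lemma expected_density_error_le:
  assumes sets_\<mu>: "sets \<mu> = sets (Rd d)" and sets_\<nu>: "sets \<nu> = sets (Rd d)"
    and et: "entropic_transport \<mu> \<nu> c \<epsilon>" and n: "1 \<le> n"
    and u: "u \<in> borel_measurable \<mu>" and u_bd: "\<And>x. x \<in> space \<mu> \<Longrightarrow> \<bar>u x\<bar> \<le> 2 / \<epsilon>"
    and v: "v \<in> borel_measurable \<nu>" and v_bd: "\<And>y. y \<in> space \<nu> \<Longrightarrow> \<bar>v y\<bar> \<le> 1 / \<epsilon>"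
    and p_def: "p = (\<lambda>z. exp (u (fst z) + v (snd z)) * gibbs c \<epsilon> z)"
    and marg: "\<And>x. x \<in> space \<mu> \<Longrightarrow> (\<integral>y. p (x, y) \<partial>\<nu>) = 1" "\<And>y. y \<in> space \<nu> \<Longrightarrow> (\<integral>x. p (x, y) \<partial>\<mu>) = 1"
    and dens: "AE z in \<mu> \<Otimes>\<^sub>M \<nu>. eot_density c \<epsilon> \<mu> \<nu> z = p z"
    and V: "(\<integral>z. (p z)\<^sup>2 \<partial>(\<mu> \<Otimes>\<^sub>M \<nu>)) \<le> V" "0 < V"
  shows "expected_density_error d c \<epsilon> \<mu> \<nu> n \<le> ennreal (sqrt (6 * sqrt (V / n) / \<epsilon>))"
proof -
  interpret entropic_transport \<mu> \<nu> c \<epsilon> by (rule et)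
  interpret S: pair_prob_space "samples n \<mu>" "samples n \<nu>" by (rule samples_prob_spaces)
  let ?S = "samples n \<mu> \<Otimes>\<^sub>M samples n \<nu>"
  have sets_R: "sets (\<mu> \<Otimes>\<^sub>M \<nu>) = sets (Rd d \<Otimes>\<^sub>M Rd d)" using sets_\<mu> sets_\<nu> by (rule sets_pair_measure_cong)
  have bm: "f \<in> borel_measurable (\<mu> \<Otimes>\<^sub>M \<nu>) \<longleftrightarrow> f \<in> borel_measurable (Rd d \<Otimes>\<^sub>M Rd d)" for f :: "_ \<Rightarrow> real"
    using measurable_cong_sets[OF sets_R refl] by blast
  have space_\<mu>: "space \<mu> = space (Rd d)" and space_\<nu>: "space \<nu> = space (Rd d)"
    using sets_eq_imp_space_eq[OF sets_\<mu>] sets_eq_imp_space_eq[OF sets_\<nu>] .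
  note [measurable] = u v
  have gibbs_meas [measurable]: "gibbs c \<epsilon> \<in> borel_measurable (\<mu> \<Otimes>\<^sub>M \<nu>)" unfolding gibbs_def by measurable
  have p_meas [measurable]: "p \<in> borel_measurable (\<mu> \<Otimes>\<^sub>M \<nu>)" unfolding p_def by measurable
  define K where "K = exp (2 / \<epsilon> + 1 / \<epsilon>) * exp (1 / \<epsilon>)"
  have p_bd: "\<bar>p z\<bar> \<le> K" if "z \<in> space (\<mu> \<Otimes>\<^sub>M \<nu>)" for z
  proof -
    have "u (fst z) \<le> 2 / \<epsilon>" "v (snd z) \<le> 1 / \<epsilon>"
      using that u_bd[of "fst z"] v_bd[of "snd z"] by (auto simp: space_pair_measure)
    moreover have "- max (- 1) (min 1 (c z)) / \<epsilon> \<le> 1 / \<epsilon>"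
      using \<epsilon>_pos by (intro divide_right_mono) auto
    ultimately have "exp (u (fst z) + v (snd z)) * gibbs c \<epsilon> z \<le> K"
      unfolding K_def gibbs_def by (intro mult_mono) auto
    then show ?thesis by (simp add: p_def gibbs_def abs_of_pos)
  qed
  \<comment> \<open>The minimiser of \<open>r * (V / n) + 1 / r\<close>, whose minimum is twice the
    \<kappa> defined next.\<close>
  define r where "r = sqrt (n / V)"
  define \<kappa> where "\<kappa> = sqrt (V / n)"
  have \<kappa>: "0 < \<kappa>" using V n by (simp add: \<kappa>_def)
  have r: "r = 1 / \<kappa>" by (simp add: r_def \<kappa>_def real_sqrt_divide)
  have r0: "0 < r" using r \<kappa> by simp
  have \<kappa>2: "V / n = \<kappa>\<^sup>2" using V n by (simp add: \<kappa>_def)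
  have \<kappa>_eq: "(r * (V / n) + 1 / r) / 2 = \<kappa>" unfolding \<kappa>2 r using \<kappa> by (simp add: power2_eq_square)
  \<comment> \<open>Balances the two terms: with
    \<open>t = sqrt (6 * \<kappa> / \<epsilon>)\<close>, both \<open>s / 4 * t\<^sup>2\<close> and
    \<open>1 / s\<close> equal \<open>t / 2\<close>.\<close>
  define s where "s = 2 / sqrt (6 * \<kappa> / \<epsilon>)"
  have s: "0 < s" using \<kappa> \<epsilon>_pos by (simp add: s_def)
  define e1 where "e1 = (\<lambda>(i::nat) (\<omega> :: (nat \<Rightarrow> nat \<Rightarrow> real) \<times> (nat \<Rightarrow> nat \<Rightarrow> real)). \<bar>1 - (\<Sum>j<n. p (fst \<omega> i, snd \<omega> j)) / n\<bar>)"
  define e2 where "e2 = (\<lambda>(j::nat) (\<omega> :: (nat \<Rightarrow> nat \<Rightarrow> real) \<times> (nat \<Rightarrow> nat \<Rightarrow> real)). \<bar>1 - (\<Sum>i<n. p (fst \<omega> i, snd \<omega> j)) / n\<bar>)"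
  define w where "w = (\<lambda>(i::nat) (\<omega> :: (nat \<Rightarrow> nat \<Rightarrow> real) \<times> (nat \<Rightarrow> nat \<Rightarrow> real)). (\<Sum>j<n. p (fst \<omega> i, snd \<omega> j)) / n)"
  define G where "G = (\<lambda>\<omega>. s / 4 * (4 / \<epsilon> * ((\<Sum>i<n. e1 i \<omega>) / n) + 2 / \<epsilon> * ((\<Sum>j<n. e2 j \<omega>) / n))
        + (1 + (\<Sum>i<n. w i \<omega>) / n) / (2 * s))"
  have comp_int: "integrable ?S (\<lambda>\<omega>. p (fst \<omega> i, snd \<omega> j))" if "i < n" "j < n" for i j
    using measurable_compose[OF samples_component_measurable[OF that] p_meas]
      p_bd[OF samples_component_space[OF that]] by (rule S.P.integrable_bounded)
  have ints: "integrable ?S (e1 i)" "integrable ?S (e2 i)" "integrable ?S (w i)" if "i < n" for i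
    unfolding e1_def e2_def w_def using comp_int that
    by (auto intro!: integrable_abs Bochner_Integration.integrable_diff integrable_divide_zero
        Bochner_Integration.integrable_sum)
  have int_G: "integrable ?S G"
    unfolding G_def using ints
    by (intro Bochner_Integration.integrable_add integrable_mult_right integrable_divide_zero
        Bochner_Integration.integrable_sum) auto
  have G0: "0 \<le> G \<omega>" for \<omega>
  proof -
    have "0 \<le> w i \<omega>" for i by (auto simp: w_def p_def gibbs_def intro!: divide_nonneg_nonneg sum_nonneg)
    then show ?thesis unfolding G_def e1_def e2_def using s \<epsilon>_pos
      by (intro add_nonneg_nonneg mult_nonneg_nonneg divide_nonneg_nonneg sum_nonneg) auto
  qed
  have "(\<integral>z. p z \<partial>(\<mu> \<Otimes>\<^sub>M \<nu>)) = 1"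
  proof -
    have "integrable (\<mu> \<Otimes>\<^sub>M \<nu>) p" using p_meas p_bd by (rule P.integrable_bounded)
    then have "(\<integral>z. p z \<partial>(\<mu> \<Otimes>\<^sub>M \<nu>)) = (\<integral>x. \<integral>y. p (x, y) \<partial>\<nu> \<partial>\<mu>)" by (rule integral_fst'[symmetric])
    also have "\<dots> = 1" using marg(1) by (simp cong: Bochner_Integration.integral_cong add: M1.prob_space)
    finally show ?thesis .
  qed
  then have w1: "(\<integral>\<omega>. w i \<omega> \<partial>?S) = 1" if "i < n" for i
    unfolding w_def using that n comp_int
    by (simp add: Bochner_Integration.integral_sum integral_samples_component)
  have e1_le: "(\<integral>\<omega>. e1 i \<omega> \<partial>?S) \<le> \<kappa>" if "i < n" for i
    using integral_fst_marginal_error[OF p_meas p_bd marg(1) V(1) r0 that] unfolding e1_def \<kappa>_eq by simp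
  have e2_le: "(\<integral>\<omega>. e2 j \<omega> \<partial>?S) \<le> \<kappa>" if "j < n" for j
    using integral_snd_marginal_error[OF p_meas p_bd marg(2) V(1) r0 that] unfolding e2_def \<kappa>_eq by simp
  have avg: "(\<Sum>i<n. f i) / n \<le> \<kappa>" if "\<And>i. i < n \<Longrightarrow> f i \<le> \<kappa>" for f :: "nat \<Rightarrow> real"
    using sum_mono[of "{..<n}" f "\<lambda>_. \<kappa>"] that n by (simp add: field_simps)
  have "(\<integral>\<omega>. G \<omega> \<partial>?S) = s / 4 * (4 / \<epsilon> * ((\<Sum>i<n. \<integral>\<omega>. e1 i \<omega> \<partial>?S) / n) + 2 / \<epsilon> * ((\<Sum>j<n. \<integral>\<omega>. e2 j \<omega> \<partial>?S) / n))
        + (1 + (\<Sum>i<n. \<integral>\<omega>. w i \<omega> \<partial>?S) / n) / (2 * s)"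
  proof -
    define E1 where "E1 = (\<lambda>\<omega>. (\<Sum>i<n. e1 i \<omega>) / n)"
    define E2 where "E2 = (\<lambda>\<omega>. (\<Sum>j<n. e2 j \<omega>) / n)"
    define W where "W = (\<lambda>\<omega>. (\<Sum>i<n. w i \<omega>) / n)"
    have E: "integrable ?S E1" "integrable ?S E2" "integrable ?S W"
      unfolding E1_def E2_def W_def using ints
      by (auto intro!: integrable_divide_zero Bochner_Integration.integrable_sum)
    have "G = (\<lambda>\<omega>. s / 4 * (4 / \<epsilon> * E1 \<omega> + 2 / \<epsilon> * E2 \<omega>) + (1 + W \<omega>) / (2 * s))"
      by (simp add: G_def E1_def E2_def W_def)
    then have "(\<integral>\<omega>. G \<omega> \<partial>?S) = s / 4 * (4 / \<epsilon> * (\<integral>\<omega>. E1 \<omega> \<partial>?S) + 2 / \<epsilon> * (\<integral>\<omega>. E2 \<omega> \<partial>?S))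
        + (1 + (\<integral>\<omega>. W \<omega> \<partial>?S)) / (2 * s)"
      using E by (simp add: S.P.prob_space)
    then show ?thesis
      using ints by (simp add: E1_def E2_def W_def Bochner_Integration.integral_sum)
  qed
  also have "\<dots> \<le> s / 4 * (4 / \<epsilon> * \<kappa> + 2 / \<epsilon> * \<kappa>) + (1 + 1) / (2 * s)"
    using avg[OF e1_le] avg[OF e2_le] w1 n s \<epsilon>_pos
    by (intro add_mono mult_left_mono divide_right_mono) auto
  also have "\<dots> = sqrt (6 * \<kappa> / \<epsilon>)"
  proof -
    define t where "t = sqrt (6 * \<kappa> / \<epsilon>)"
    have t: "0 < t" using \<kappa> \<epsilon>_pos by (simp add: t_def)
    have "4 / \<epsilon> * \<kappa> + 2 / \<epsilon> * \<kappa> = t\<^sup>2" using \<kappa> \<epsilon>_pos by (simp add: t_def field_simps)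
    moreover have "s / 4 * t\<^sup>2 + (1 + 1) / (2 * s) = t"
      using t unfolding s_def t_def[symmetric] by (simp add: power2_eq_square)
    ultimately show ?thesis by (simp only: t_def)
  qed
  finally have int_G_le: "(\<integral>\<omega>. G \<omega> \<partial>?S) \<le> sqrt (6 * \<kappa> / \<epsilon>)" .
  \<comment> \<open>Two null events are excluded: some sample pair has cost above 1 in absolute
    value, or the population density differs from \<open>p\<close> at some sample pair. Elsewhere
    the integrable function \<open>G\<close> dominates.\<close>
  have "AE \<omega> in ?S. (case \<omega> of (x, y) \<Rightarrow>
        (let \<mu>' = empirical (Rd d) n x; \<nu>' = empirical (Rd d) n y
         in \<integral>\<^sup>+ z. ennreal \<bar>eot_density c \<epsilon> \<mu>' \<nu>' z - eot_density c \<epsilon> \<mu> \<nu> z\<bar> \<partial>(\<mu>' \<Otimes>\<^sub>M \<nu>'))) \<le> ennreal (G \<omega>)"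
    using AE_samples[OF c_bounded] AE_samples[OF dens] AE_space
  proof eventually_elim
    case (elim \<omega>)
    obtain x y where \<omega>: "\<omega> = (x, y)" by (cases \<omega>)
    have x: "x i \<in> space (Rd d)" and y: "y i \<in> space (Rd d)" if "i < n" for i
      using samples_component_space[OF that that elim(3)] by (simp_all add: \<omega> space_pair_measure space_\<mu> space_\<nu>)
    have "eot_density c \<epsilon> \<mu> \<nu> \<in> borel_measurable (\<mu> \<Otimes>\<^sub>M \<nu>)" unfolding eot_density_def by measurable
    moreover have "u \<in> borel_measurable (Rd d)" "v \<in> borel_measurable (Rd d)"
      using u v measurable_cong_sets[OF sets_\<mu> refl] measurable_cong_sets[OF sets_\<nu> refl] by blast+
    ultimately show ?case
      unfolding \<omega> prod.case Let_def G_def e1_def e2_def w_def fst_conv snd_conv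
      using elim(1,2) u_bd v_bd c_measurable x y
      by (intro empirical_density_error[OF _ \<epsilon>_pos n _ _ _ _ _ _ _ p_def _ _ s])
        (auto simp: \<omega> space_\<mu> space_\<nu> bm)
  qed
  then have "expected_density_error d c \<epsilon> \<mu> \<nu> n \<le> (\<integral>\<^sup>+\<omega>. ennreal (G \<omega>) \<partial>?S)"
    unfolding expected_density_error_def by (rule nn_integral_mono_AE)
  also have "\<dots> = ennreal (\<integral>\<omega>. G \<omega> \<partial>?S)" using int_G G0 by (intro nn_integral_eq_integral) auto
  also have "\<dots> \<le> ennreal (sqrt (6 * sqrt (V / n) / \<epsilon>))"
    using int_G_le unfolding \<kappa>_def by (rule ennreal_leI)
  finally show ?thesis .
qed

text \<open>Two points of one ball are at most 2 \<epsilon> / L apart, so kernel and potential each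
  contribute a factor \<open>exp 2\<close>. The bound is used twice, the second time with the
  marginals exchanged and the arguments of the kernel swapped.\<close>

lemma density_square_le_cover:
  fixes k :: "(nat \<Rightarrow> real) \<times> 'b \<Rightarrow> real"
  assumes \<mu>: "borel_prob d \<mu>" and \<nu>: "prob_space \<nu>" and L: "0 < L" and \<epsilon>: "0 < \<epsilon>"
    and G2: "AE y in \<nu>. y \<in> G2"
    and k [measurable]: "k \<in> borel_measurable (\<mu> \<Otimes>\<^sub>M \<nu>)" and k_bd: "\<And>z. 0 < k z \<and> k z \<le> K"
    and lip: "\<And>x x' y. x \<in> supp d \<mu> \<Longrightarrow> x' \<in> supp d \<mu> \<Longrightarrow> y \<in> G2 \<Longrightarrow> k (x, y) \<le> exp (L * edist d x x' / \<epsilon>) * k (x', y)"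
    and u [measurable]: "u \<in> borel_measurable \<mu>" and u_bd: "\<And>x. x \<in> space \<mu> \<Longrightarrow> \<bar>u x\<bar> \<le> B"
    and v [measurable]: "v \<in> borel_measurable \<nu>" and v_bd: "\<And>y. y \<in> space \<nu> \<Longrightarrow> \<bar>v y\<bar> \<le> B"
    and marg: "\<And>x. x \<in> space \<mu> \<Longrightarrow> (\<integral>y. exp (u x + v y) * k (x, y) \<partial>\<nu>) = 1"
      "\<And>y. y \<in> space \<nu> \<Longrightarrow> (\<integral>x. exp (u x + v y) * k (x, y) \<partial>\<mu>) = 1"
    and N: "covering_number d \<mu> (\<epsilon> / L) = enat N"
  shows "(\<integral>z. (exp (u (fst z) + v (snd z)) * k z)\<^sup>2 \<partial>(\<mu> \<Otimes>\<^sub>M \<nu>)) \<le> exp 4 * N" "0 < N"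
proof -
  interpret M1: prob_space \<mu> using \<mu> by (simp add: borel_prob_def)
  interpret M2: prob_space \<nu> by (rule \<nu>)
  interpret pair_prob_space \<mu> \<nu> ..
  have sets_\<mu>: "sets \<mu> = sets (Rd d)" using \<mu> by (simp add: borel_prob_def)
  have space_\<mu>: "space \<mu> = space (Rd d)" using sets_\<mu> by (rule sets_eq_imp_space_eq)
  obtain S where S: "finite S" "card S = N" "S \<subseteq> space (Rd d)"
    "supp d \<mu> \<subseteq> (\<Union>z\<in>S. {x \<in> space (Rd d). edist d z x \<le> \<epsilon> / L})"
    using covering_number_witness[OF N] .
  have supp: "AE x in \<mu>. x \<in> supp d \<mu>" using \<mu> by (rule AE_in_supp)
  have supp_space: "x \<in> space \<mu>" if "x \<in> supp d \<mu>" for x using that by (simp add: supp_def space_\<mu>)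
  \<comment> \<open>An empty cover would make the support empty although it has full measure.
    Positivity is what later gives \<open>V > 0\<close>, on which the choice of the weights
    rests.\<close>
  show "0 < N"
  proof (rule ccontr)
    assume "\<not> 0 < N"
    then have "supp d \<mu> = {}" using S by auto
    then have "AE x in \<mu>. False" using supp by simp
    then show False by simp
  qed
  let ?C = "\<lambda>z. {x \<in> space (Rd d). edist d z x \<le> \<epsilon> / L}"
  let ?p = "\<lambda>z. exp (u (fst z) + v (snd z)) * k z"
  have kle: "k (x, y) \<le> exp 2 * k (x', y)"
    if "x \<in> ?C z \<inter> supp d \<mu>" "x' \<in> ?C z \<inter> supp d \<mu>" "y \<in> G2" for x x' y z
  proof -
    have "edist d x x' \<le> 2 * (\<epsilon> / L)"
      using that edist_triangle[of d x x' z] edist_commute[of d x z] by auto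
    then have "L * edist d x x' / \<epsilon> \<le> 2" using L \<epsilon> by (simp add: field_simps)
    then have "exp (L * edist d x x' / \<epsilon>) * k (x', y) \<le> exp 2 * k (x', y)"
      using k_bd[of "(x', y)"] by (intro mult_right_mono) auto
    then show ?thesis using lip[of x x' y] that by auto
  qed
  have int_k: "integrable \<nu> (\<lambda>y. exp (v y) * k (x, y))" if "x \<in> space \<mu>" for x
  proof (rule M2.integrable_bounded)
    show "(\<lambda>y. exp (v y) * k (x, y)) \<in> borel_measurable \<nu>" using that by measurable
    show "\<bar>exp (v y) * k (x, y)\<bar> \<le> exp B * K" if "y \<in> space \<nu>" for y
      unfolding abs_mult using v_bd[OF that] k_bd[of "(x, y)"] by (intro mult_mono) auto
  qed
  have mass: "exp (u x) * (\<integral>y. exp (v y) * k (x, y) \<partial>\<nu>) = 1" if "x \<in> space \<mu>" for x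
    using marg(1)[OF that] by (simp add: exp_add mult.assoc)
  \<comment> \<open>The first marginal equation presents \<open>exp (u x)\<close> as the reciprocal
    of the integral of \<open>exp (v y) * k (x, y)\<close>. The roles of \<open>x\<close> and
    \<open>x'\<close> in the kernel bound are exchanged because of the reciprocal.\<close>
  have ule: "exp (u x) \<le> exp 2 * exp (u x')"
    if "x \<in> ?C z \<inter> supp d \<mu>" "x' \<in> ?C z \<inter> supp d \<mu>" for x x' z
  proof (rule M2.normalizer_ratio)
    show "integrable \<nu> (\<lambda>y. exp (v y) * k (x, y))" "integrable \<nu> (\<lambda>y. exp (v y) * k (x', y))"
      using that supp_space by (auto intro: int_k)
    show "AE y in \<nu>. k (x', y) \<le> exp 2 * k (x, y)"
      using G2 by eventually_elim (use kle[OF that(2,1)] in auto)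
    show "exp (u x) * (\<integral>y. exp (v y) * k (x, y) \<partial>\<nu>) = 1" "exp (u x') * (\<integral>y. exp (v y) * k (x', y) \<partial>\<nu>) = 1"
      using that supp_space by (auto intro: mass)
  qed auto
  have "(\<integral>z. (?p z)\<^sup>2 \<partial>(\<mu> \<Otimes>\<^sub>M \<nu>)) \<le> exp 4 * card S"
  proof (rule integral_square_le_cover[OF _ _ _ _ S(1) _ supp G2 S(4)])
    show "?p \<in> borel_measurable (\<mu> \<Otimes>\<^sub>M \<nu>)" by measurable
    show "0 \<le> ?p z \<and> ?p z \<le> exp (B + B) * K" if z: "z \<in> space (\<mu> \<Otimes>\<^sub>M \<nu>)" for z
    proof -
      have "u (fst z) \<le> B" "v (snd z) \<le> B"
        using z u_bd[of "fst z"] v_bd[of "snd z"] by (auto simp: space_pair_measure)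
      then show ?thesis using k_bd[of z] by (auto intro!: mult_mono)
    qed
    show "?C z \<in> sets \<mu>" for z unfolding sets_\<mu> by measurable
    show "?p (x, y) \<le> exp 4 * ?p (x', y)"
      if x: "x \<in> ?C z \<inter> supp d \<mu>" "x' \<in> ?C z \<inter> supp d \<mu>" and y: "y \<in> G2" for z x x' y
    proof -
      have "exp (u x) * k (x, y) \<le> (exp 2 * exp (u x')) * (exp 2 * k (x', y))"
        using ule[OF x] kle[OF x y] k_bd[of "(x, y)"] by (intro mult_mono) auto
      also have "\<dots> = exp 4 * (exp (u x') * k (x', y))" by (simp flip: exp_add)
      finally have "exp (v y) * (exp (u x) * k (x, y)) \<le> exp (v y) * (exp 4 * (exp (u x') * k (x', y)))"
        by (rule mult_left_mono) simp
      then show ?thesis by (simp add: exp_add mult_ac)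
    qed
  qed (use marg in auto)
  then show "(\<integral>z. (?p z)\<^sup>2 \<partial>(\<mu> \<Otimes>\<^sub>M \<nu>)) \<le> exp 4 * N" by (simp add: S(2))
qed

section \<open>From the cost assumption to the universal constant\<close>

lemma gibbs_le_of_cost_le:
  assumes "0 < \<epsilon>" "\<bar>c z - c z'\<bar> \<le> t"
  shows "gibbs c \<epsilon> z \<le> exp (t / \<epsilon>) * gibbs c \<epsilon> z'"
proof -
  \<comment> \<open>Clipping to the interval from -1 to 1 is 1-Lipschitz, so the truncated cost
    inherits the oscillation bound.\<close>
  have "- max (- 1) (min 1 (c z)) \<le> t + - max (- 1) (min 1 (c z'))" using assms(2) by linarith
  then have "- max (- 1) (min 1 (c z)) / \<epsilon> \<le> t / \<epsilon> + - max (- 1) (min 1 (c z')) / \<epsilon>"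
    unfolding add_divide_distrib[symmetric] using assms(1) by (intro divide_right_mono) auto
  then show ?thesis unfolding gibbs_def exp_add[symmetric] by simp
qed

theorem theorem4:
  shows "\<exists>C::real. C > 0 \<and>
    (\<forall>(d::nat) (\<mu>::(nat \<Rightarrow> real) measure) (\<nu>::(nat \<Rightarrow> real) measure)
      (c::(nat \<Rightarrow> real) \<times> (nat \<Rightarrow> real) \<Rightarrow> real) (L::real) (\<epsilon>::real) (n::nat).
      d \<ge> 1 \<longrightarrow> borel_prob d \<mu> \<longrightarrow> borel_prob d \<nu> \<longrightarrow>
      L > 0 \<longrightarrow> cost_assumption d \<mu> \<nu> L c \<longrightarrow> \<epsilon> > 0 \<longrightarrow> n \<ge> 1 \<longrightarrow>
      expected_density_error d c \<epsilon> \<mu> \<nu> n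
        \<le> ennreal (C * (1 + 1 / sqrt \<epsilon>)) *
          ennreal_powr
            (ennreal_of_enat (min (covering_number d \<mu> (\<epsilon> / L)) (covering_number d \<nu> (\<epsilon> / L)))
              / of_nat n) (1 / 4))"
proof (intro exI[of _ "sqrt 6 * exp 1"] conjI allI impI)
  show "0 < sqrt 6 * exp (1::real)" by simp
next
  fix d :: nat and \<mu> \<nu> :: "(nat \<Rightarrow> real) measure" and c :: "(nat \<Rightarrow> real) \<times> (nat \<Rightarrow> real) \<Rightarrow> real"
    and L \<epsilon> :: real and n :: nat
  assume \<mu>: "borel_prob d \<mu>" and \<nu>: "borel_prob d \<nu>" and L: "L > 0"
    and cost: "cost_assumption d \<mu> \<nu> L c" and \<epsilon>: "\<epsilon> > 0" and n: "n \<ge> 1"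
  have sets: "sets \<mu> = sets (Rd d)" "sets \<nu> = sets (Rd d)" and prob: "prob_space \<mu>" "prob_space \<nu>"
    using \<mu> \<nu> by (auto simp: borel_prob_def)
  interpret M1: prob_space \<mu> by (rule prob)
  interpret M2: prob_space \<nu> by (rule prob)
  interpret pair_prob_space \<mu> \<nu> ..
  have sets_R: "sets (\<mu> \<Otimes>\<^sub>M \<nu>) = sets (Rd d \<Otimes>\<^sub>M Rd d)" using sets by (rule sets_pair_measure_cong)
  have c_meas: "c \<in> borel_measurable (\<mu> \<Otimes>\<^sub>M \<nu>)"
    using cost measurable_cong_sets[OF sets_R refl] by (auto simp: cost_assumption_def)
  have "AE z in \<mu> \<Otimes>\<^sub>M \<nu>. \<bar>c z\<bar> \<le> 1"
    using esssup_AE[of "\<lambda>z. ereal \<bar>c z\<bar>" "\<mu> \<Otimes>\<^sub>M \<nu>"]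
  proof eventually_elim
    case (elim z)
    have "esssup (\<mu> \<Otimes>\<^sub>M \<nu>) (\<lambda>z. ereal \<bar>c z\<bar>) \<le> 1" using cost by (simp add: cost_assumption_def)
    with elim have "ereal \<bar>c z\<bar> \<le> 1" by (rule order_trans)
    then show ?case by (simp add: one_ereal_def)
  qed
  with c_meas \<epsilon> have et: "entropic_transport \<mu> \<nu> c \<epsilon>" by unfold_locales
  interpret entropic_transport \<mu> \<nu> c \<epsilon> by (rule et)
  obtain u v where uv: "u \<in> borel_measurable \<mu>" "\<And>x. x \<in> space \<mu> \<Longrightarrow> \<bar>u x\<bar> \<le> 2 / \<epsilon>"
    "v \<in> borel_measurable \<nu>" "\<And>y. y \<in> space \<nu> \<Longrightarrow> \<bar>v y\<bar> \<le> 1 / \<epsilon>"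
    and marg: "\<And>x. x \<in> space \<mu> \<Longrightarrow> (\<integral>y. exp (u x + v y) * gibbs c \<epsilon> (x, y) \<partial>\<nu>) = 1"
      "\<And>y. y \<in> space \<nu> \<Longrightarrow> (\<integral>x. exp (u x + v y) * gibbs c \<epsilon> (x, y) \<partial>\<mu>) = 1"
    and dens: "AE z in \<mu> \<Otimes>\<^sub>M \<nu>. eot_density c \<epsilon> \<mu> \<nu> z = exp (u (fst z) + v (snd z)) * gibbs c \<epsilon> z"
    using eot_density_form by blast
  define p where "p = (\<lambda>z. exp (u (fst z) + v (snd z)) * gibbs c \<epsilon> z)"
  have gibbs_meas [measurable]: "gibbs c \<epsilon> \<in> borel_measurable (\<mu> \<Otimes>\<^sub>M \<nu>)" unfolding gibbs_def by measurable
  have gibbs_bd: "0 < gibbs c \<epsilon> z \<and> gibbs c \<epsilon> z \<le> exp (1 / \<epsilon>)" for z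
  proof -
    have "- max (- 1) (min 1 (c z)) / \<epsilon> \<le> 1 / \<epsilon>" using \<epsilon> by (intro divide_right_mono) auto
    then show ?thesis by (simp add: gibbs_def)
  qed
  \<comment> \<open>Weakened to the bound for \<open>u\<close>, since
    \<open>density_square_le_cover\<close> takes one common bound for both potentials.\<close>
  have v_bd: "\<bar>v y\<bar> \<le> 2 / \<epsilon>" if "y \<in> space \<nu>" for y
    using uv(4)[OF that] \<epsilon> by (auto intro: order_trans divide_right_mono)
  have cover1: "(\<integral>z. (p z)\<^sup>2 \<partial>(\<mu> \<Otimes>\<^sub>M \<nu>)) \<le> exp 4 * N \<and> 0 < N"
    if N: "covering_number d \<mu> (\<epsilon> / L) = enat N" for N
  proof -
    have lip: "gibbs c \<epsilon> (x, y) \<le> exp (L * edist d x x' / \<epsilon>) * gibbs c \<epsilon> (x', y)"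
      if "x \<in> supp d \<mu>" "x' \<in> supp d \<mu>" "y \<in> supp d \<nu>" for x x' y
      using \<epsilon> cost that by (intro gibbs_le_of_cost_le) (auto simp: cost_assumption_def)
    show ?thesis unfolding p_def
      using density_square_le_cover[OF \<mu> prob(2) L \<epsilon> AE_in_supp[OF \<nu>] gibbs_meas gibbs_bd lip uv(1,2,3) v_bd marg N]
      by auto
  qed
  \<comment> \<open>The second moment is invariant under swapping the coordinates, so the covering
    number of \<nu> comes from the swapped problem with \<open>v\<close> in the place of
    \<open>u\<close>.\<close>
  have cover2: "(\<integral>z. (p z)\<^sup>2 \<partial>(\<mu> \<Otimes>\<^sub>M \<nu>)) \<le> exp 4 * N \<and> 0 < N"
    if N: "covering_number d \<nu> (\<epsilon> / L) = enat N" for N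
  proof -
    let ?k = "\<lambda>(y, x). gibbs c \<epsilon> (x, y)"
    have lip: "?k (y, x) \<le> exp (L * edist d y y' / \<epsilon>) * ?k (y', x)"
      if "y \<in> supp d \<nu>" "y' \<in> supp d \<nu>" "x \<in> supp d \<mu>" for x y y'
      unfolding prod.case using \<epsilon> cost that by (intro gibbs_le_of_cost_le) (auto simp: cost_assumption_def)
    have k_meas: "?k \<in> borel_measurable (\<nu> \<Otimes>\<^sub>M \<mu>)" by measurable
    have k_bd: "0 < ?k z \<and> ?k z \<le> exp (1 / \<epsilon>)" for z using gibbs_bd by (cases z) auto
    have marg': "(\<integral>x. exp (v y + u x) * ?k (y, x) \<partial>\<mu>) = 1" if "y \<in> space \<nu>" for y
      using marg(2)[OF that] by (simp add: add.commute)
    have marg'': "(\<integral>y. exp (v y + u x) * ?k (y, x) \<partial>\<nu>) = 1" if "x \<in> space \<mu>" for x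
      using marg(1)[OF that] by (simp add: add.commute)
    note [measurable] = uv(1,3)
    have "(\<integral>z. (p z)\<^sup>2 \<partial>(\<mu> \<Otimes>\<^sub>M \<nu>)) = (\<integral>(y, x). (p (x, y))\<^sup>2 \<partial>(\<nu> \<Otimes>\<^sub>M \<mu>))"
      unfolding p_def by (rule integral_product_swap[symmetric]) measurable
    also have "\<dots> = (\<integral>z. (exp (v (fst z) + u (snd z)) * ?k z)\<^sup>2 \<partial>(\<nu> \<Otimes>\<^sub>M \<mu>))"
      by (intro Bochner_Integration.integral_cong) (auto simp: p_def add.commute)
    finally show ?thesis
      using density_square_le_cover[OF \<nu> prob(1) L \<epsilon> AE_in_supp[OF \<mu>] k_meas k_bd lip uv(3) v_bd uv(1,2) marg' marg'' N]
      by auto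
  qed
  let ?N = "min (covering_number d \<mu> (\<epsilon> / L)) (covering_number d \<nu> (\<epsilon> / L))"
  show "expected_density_error d c \<epsilon> \<mu> \<nu> n
      \<le> ennreal (sqrt 6 * exp 1 * (1 + 1 / sqrt \<epsilon>)) * ennreal_powr (ennreal_of_enat ?N / of_nat n) (1 / 4)"
  proof (cases ?N)
    \<comment> \<open>The coefficient has to be shown nonzero, because
      \<open>0 * \<infinity> = 0\<close> in \<open>ennreal\<close>; then the right-hand side is
      infinite.\<close>
    case infinity
    have "0 < 1 + 1 / sqrt \<epsilon>" using \<epsilon> by (simp add: add_pos_pos)
    then have "0 < sqrt 6 * exp 1 * (1 + 1 / sqrt \<epsilon>)" by (intro mult_pos_pos) auto
    then have "ennreal (sqrt 6 * exp 1 * (1 + 1 / sqrt \<epsilon>)) \<noteq> 0" by (simp only: ennreal_eq_0_iff not_le)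
    moreover have "(\<infinity>::ennreal) / of_nat n = \<infinity>" by (simp add: ennreal_top_divide)
    ultimately show ?thesis unfolding infinity by (simp add: ennreal_powr_def ennreal_mult_top)
  next
    case (enat N)
    then have "covering_number d \<mu> (\<epsilon> / L) = enat N \<or> covering_number d \<nu> (\<epsilon> / L) = enat N"
      by (auto simp: min_def split: if_splits)
    then have V: "(\<integral>z. (p z)\<^sup>2 \<partial>(\<mu> \<Otimes>\<^sub>M \<nu>)) \<le> exp 4 * N" "0 < exp 4 * real N"
      using cover1 cover2 by auto
    have N: "ennreal_powr (ennreal_of_enat ?N / of_nat n) (1 / 4) = ennreal ((N / n) powr (1 / 4))"
    proof -
      have "ennreal_of_enat ?N / of_nat n = ennreal (N / n)"
        unfolding enat using n by (simp add: divide_ennreal[symmetric] ennreal_of_nat_eq_real_of_nat)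
      then show ?thesis by (simp add: ennreal_powr_def)
    qed
    \<comment> \<open>This is the bound for \<open>V = exp 4 * N\<close>. The nested roots turn
      \<open>exp 4\<close> into \<open>exp 1\<close> and \<open>N / n\<close> into its fourth root,
      while 6 and \<epsilon> stand only under the outer root.\<close>
    have "sqrt (6 * sqrt (exp 4 * N / n) / \<epsilon>) = sqrt 6 * exp 1 * (N / n) powr (1 / 4) / sqrt \<epsilon>"
    proof -
      have exp4: "sqrt (exp 4) = exp (2::real)" "sqrt (exp 2) = exp (1::real)"
        by (rule real_sqrt_unique; simp flip: exp_double)+
      have "sqrt (sqrt (N / n)) = (N / n) powr (1 / 4)"
        by (simp add: powr_half_sqrt[symmetric] powr_powr)
      then show ?thesis
        unfolding times_divide_eq_right[symmetric] real_sqrt_mult real_sqrt_divide[of _ \<epsilon>] exp4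
        by (simp add: real_sqrt_mult real_sqrt_divide exp4)
    qed
    also have "\<dots> \<le> sqrt 6 * exp 1 * (1 + 1 / sqrt \<epsilon>) * (N / n) powr (1 / 4)"
    proof -
      have "sqrt 6 * exp 1 * (N / n) powr (1 / 4) * (1 / sqrt \<epsilon>) \<le> sqrt 6 * exp 1 * (N / n) powr (1 / 4) * (1 + 1 / sqrt \<epsilon>)"
        by (intro mult_left_mono) auto
      then show ?thesis by (simp add: mult_ac)
    qed
    finally have real_le: "sqrt (6 * sqrt (exp 4 * N / n) / \<epsilon>) \<le> sqrt 6 * exp 1 * (1 + 1 / sqrt \<epsilon>) * (N / n) powr (1 / 4)" .
    have "expected_density_error d c \<epsilon> \<mu> \<nu> n \<le> ennreal (sqrt (6 * sqrt (exp 4 * N / n) / \<epsilon>))"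
      using marg dens V
      by (intro expected_density_error_le[OF sets et n uv p_def]) (auto simp: p_def)
    also have "\<dots> \<le> ennreal (sqrt 6 * exp 1 * (1 + 1 / sqrt \<epsilon>) * (N / n) powr (1 / 4))"
      using real_le by (rule ennreal_leI)
    also have "\<dots> = ennreal (sqrt 6 * exp 1 * (1 + 1 / sqrt \<epsilon>)) * ennreal ((N / n) powr (1 / 4))"
      using \<epsilon> by (intro ennreal_mult) auto
    finally show ?thesis unfolding N .
  qed
qed

end
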